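(* Let $m\ge1$, $n\ge0$, $s\ge0$ be integers. The number of $m$-periodic cliffs of height $n$ and horizontal displacement $s$ equals the number of cylindric partitions of shape $(s+m-1,s+m-2,\dots,s)/(m-1,m-2,\dots,0)/m$ all of whose entries are at most $n$, and this common number is $$[x^{\lfloor s/2\rfloor}]\prod_{k=1}^{n+\lfloor s/2\rfloor}\Big[x+\Big(2+2\cos\frac{2k\pi}{2n+s+1}\Big)^m\Big],$$ where $[x^j]p(x)$ denotes the coefficient of $x^j$ in the polynomial $p(x)$.
   Context: Stepped surfaces: surfaces in $\mathbb{R}^3$ made of unit squares of the cubic lattice (each parallel to a coordinate plane) which project injectively onto a plane perpendicular to the line $x=y=z$; viewed along that line, the faces appear as rhombi (lozenges) with angles $60^\circ$ and $120^\circ$ on the triangular lattice, faces parallel to the plane $z=0$ being called horizontal. A cliff is a stepped surface whose projection onto the triangular lattice is bounded by two parallel infinite zigzags, each of which lies in a horizontal plane. A cliff is $m$-periodic if it is invariant under translation by $m\mathbf v$, where $\mathbf v$ is the shortest nonzero vector such that translation by $\mathbf v$ leaves the bounding zigzags invariant. The height of a cliff is the difference between the heights of the two horizontal planes containing its bounding zigzags. A cliff can be viewed as consisting of slices composed of unit cubes cut out by equidistant parallel planes one unit apart; its horizontal displacement is the number of horizontal faces in each such slice. Cylindric partitions: for Young diagrams $\mu\subset\lambda$ (English convention, rows numbered from top) and a positive integer $d$, a cylindric partition of shape $\lambda/\mu/d$ is a filling of the cells of the skew diagram $\lambda/\mu$ with nonnegative integers that weakly decrease along rows (left to right) and along columns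 (top to bottom), with the additional property that if the bottom row is copied above the top row and translated $d$ units to the right, the resulting extended array is still weakly decreasing along columns. *)

theory Defs
  imports "HOL-Analysis.Analysis" "HOL-Computational_Algebra.Polynomial"
begin

section \<open>Stepped surfaces\<close>

definition lattice_points :: "(real ^ 3) set" where
  "lattice_points = {p. \<forall>i. p $ i \<in> \<int>}"

definition unit_square :: "real ^ 3 \<Rightarrow> 3 \<Rightarrow> (real ^ 3) set" where
  "unit_square p i =
     {x. x $ i = p $ i \<and> (\<forall>j. j \<noteq> i \<longrightarrow> p $ j \<le> x $ j \<and> x $ j \<le> p $ j + 1)}"

definition unit_squares :: "(real ^ 3) set set" where
  "unit_squares = {unit_square p i | p i. p \<in> lattice_points}"

definition horizontal_squares :: "(real ^ 3) set set" where
  "horizontal_squares = {unit_square p 3 | p. p \<in> lattice_points}"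

text \<open>Orthogonal projection along the line \<open>x = y = z\<close> onto the plane \<open>x + y + z = 0\<close>.\<close>

definition proj :: "real ^ 3 \<Rightarrow> real ^ 3" where
  "proj x = x - ((x \<bullet> 1) / (1 \<bullet> (1 :: real ^ 3))) *\<^sub>R 1"

text \<open>A stepped surface is represented by the set \<open>F\<close> of its faces; as a point set it is \<open>\<Union>F\<close>.
  Injectivity on the union of the closed faces also forces faces whose projections share an edge
  or a vertex to meet there in space.\<close>

definition stepped_surface :: "(real ^ 3) set set \<Rightarrow> bool" where
  "stepped_surface F \<longleftrightarrow> F \<subseteq> unit_squares \<and> inj_on proj (\<Union>F)"


section \<open>Cliffs\<close>

text \<open>The zigzag through \<open>p\<close> in the horizontal plane of \<open>p\<close>: its edges are alternately
  parallel to the \<open>x\<close>- and the \<open>y\<close>-axis, in directions \<open>(1,0,0)\<close> and \<open>(0,-1,0)\<close>, so that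
  consecutive edges form an angle of \<open>120\<close> degrees in projection.\<close>

definition zigzag_from :: "real ^ 3 \<Rightarrow> (real ^ 3) set" where
  "zigzag_from p = (\<Union>k :: int.
     (let q = p + of_int k *\<^sub>R (axis 1 1 - axis 2 1)
      in closed_segment q (q + axis 1 1)
         \<union> closed_segment (q + axis 1 1) (q + axis 1 1 - axis 2 1)))"

definition zigzag :: "(real ^ 3) set \<Rightarrow> bool" where
  "zigzag Z \<longleftrightarrow> (\<exists>p \<in> lattice_points. Z = zigzag_from p)"

text \<open>The closed region of the projection plane below the curve \<open>P\<close> and above the curve \<open>Q\<close>,
  ``up'' being the direction of the projected \<open>z\<close>-axis.  Each line in this direction meets a
  projected zigzag in exactly one point.\<close>

definition region_between :: "(real ^ 3) set \<Rightarrow> (real ^ 3) set \<Rightarrow> (real ^ 3) set" where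
  "region_between P Q =
     {q. (\<exists>t \<ge> 0. q + t *\<^sub>R proj (axis 3 1) \<in> P) \<and> (\<exists>t \<ge> 0. q - t *\<^sub>R proj (axis 3 1) \<in> Q)}"

text \<open>\<open>F\<close> is a cliff with upper bounding zigzag \<open>A\<close> and lower bounding zigzag \<open>B\<close>.  The
  zigzags are adjoined to \<open>\<Union>F\<close> explicitly; this expresses that they belong to the surface, as
  they must project injectively together with the faces.  It makes a
  difference only in the degenerate case \<open>A = B\<close>, where \<open>F\<close> is empty and the cliff consists
  of a zigzag alone.\<close>

definition cliff :: "(real ^ 3) set \<Rightarrow> (real ^ 3) set \<Rightarrow> (real ^ 3) set set \<Rightarrow> bool" where
  "cliff A B F \<longleftrightarrow>
     zigzag A \<and> zigzag B \<and> stepped_surface F \<and>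
     inj_on proj (\<Union>F \<union> A \<union> B) \<and>
     proj ` (\<Union>F \<union> A \<union> B) = region_between (proj ` A) (proj ` B)"

definition zigzag_period :: "(real ^ 3) set \<Rightarrow> (real ^ 3) set \<Rightarrow> real ^ 3 \<Rightarrow> bool" where
  "zigzag_period A B v \<longleftrightarrow> v \<noteq> 0 \<and> (+) v ` A = A \<and> (+) v ` B = B"

text \<open>The shortest period is unique only up to sign, which does not affect periodicity.\<close>

definition periodic_cliff ::
  "nat \<Rightarrow> (real ^ 3) set \<Rightarrow> (real ^ 3) set \<Rightarrow> (real ^ 3) set set \<Rightarrow> bool" where
  "periodic_cliff m A B F \<longleftrightarrow>
     cliff A B F \<and>
     (\<exists>v. zigzag_period A B v \<and> (\<forall>w. zigzag_period A B w \<longrightarrow> norm v \<le> norm w) \<and>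
          (\<lambda>f. (+) (real m *\<^sub>R v) ` f) ` F = F)"

definition has_height :: "(real ^ 3) set \<Rightarrow> (real ^ 3) set \<Rightarrow> real \<Rightarrow> bool" where
  "has_height A B h \<longleftrightarrow>
     (\<exists>a b. (\<forall>x \<in> A. x $ 3 = a) \<and> (\<forall>x \<in> B. x $ 3 = b) \<and> \<bar>a - b\<bar> = h)"

text \<open>The slices are cut out by the planes \<open>x = i\<close> for integers \<open>i\<close>.\<close>

definition has_horizontal_displacement :: "(real ^ 3) set set \<Rightarrow> nat \<Rightarrow> bool" where
  "has_horizontal_displacement F s \<longleftrightarrow>
     (\<forall>i :: int.
        let H = {f \<in> F \<inter> horizontal_squares. f \<subseteq> {x. of_int i \<le> x $ 1 \<and> x $ 1 \<le> of_int i + 1}}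
        in finite H \<and> card H = s)"

text \<open>Without fixing a position there would be infinitely many translates of each cliff, so
  cliffs are counted with a prescribed upper bounding zigzag \<open>A\<close>.\<close>

definition cliffs :: "(real ^ 3) set \<Rightarrow> nat \<Rightarrow> nat \<Rightarrow> nat \<Rightarrow> (real ^ 3) set set set" where
  "cliffs A m n s =
     {F. \<exists>B. periodic_cliff m A B F \<and> has_height A B (real n) \<and> has_horizontal_displacement F s}"


section \<open>Cylindric partitions\<close>

text \<open>A Young diagram is given by the list of its row lengths, from top to bottom.  Trailing zeros
  are allowed in \<open>lam\<close>, whose length is the number of rows; \<open>mu\<close> is padded with zeros.  Rows and
  columns are numbered from \<open>0\<close>, and a cell is a pair (row, column).\<close>

definition row_length :: "nat list \<Rightarrow> nat \<Rightarrow> nat" where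
  "row_length l i = (if i < length l then l ! i else 0)"

definition skew_cells :: "nat list \<Rightarrow> nat list \<Rightarrow> (nat \<times> nat) set" where
  "skew_cells lam mu = {(i, j). i < length lam \<and> row_length mu i \<le> j \<and> j < row_length lam i}"

text \<open>The extended array: its row \<open>0\<close> is the bottom row translated \<open>d\<close> units to the right, and
  its row \<open>Suc i\<close> is row \<open>i\<close> of the original array.\<close>

definition extended_cells :: "nat list \<Rightarrow> nat list \<Rightarrow> nat \<Rightarrow> (nat \<times> nat) set" where
  "extended_cells lam mu d =
     {(0, j + d) | j. (length lam - 1, j) \<in> skew_cells lam mu} \<union>
     {(Suc i, j) | i j. (i, j) \<in> skew_cells lam mu}"

definition extended_array :: "nat list \<Rightarrow> nat \<Rightarrow> (nat \<times> nat \<Rightarrow> nat) \<Rightarrow> nat \<times> nat \<Rightarrow> nat" where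
  "extended_array lam d T =
     (\<lambda>(i, j). case i of 0 \<Rightarrow> T (length lam - 1, j - d) | Suc i' \<Rightarrow> T (i', j))"

text \<open>Intended for Young diagrams \<open>mu \<subseteq> lam\<close> with \<open>lam \<noteq> []\<close>, and \<open>d > 0\<close>.  Fillings are
  extensional functions, so that distinct functions are distinct fillings.\<close>

definition cylindric_partitions :: "nat list \<Rightarrow> nat list \<Rightarrow> nat \<Rightarrow> (nat \<times> nat \<Rightarrow> nat) set" where
  "cylindric_partitions lam mu d =
     {T \<in> extensional (skew_cells lam mu).
        (\<forall>i j j'. (i, j) \<in> skew_cells lam mu \<longrightarrow> (i, j') \<in> skew_cells lam mu \<longrightarrow> j \<le> j' \<longrightarrow>
           T (i, j') \<le> T (i, j)) \<and>
        (\<forall>i i' j. (i, j) \<in> skew_cells lam mu \<longrightarrow> (i', j) \<in> skew_cells lam mu \<longrightarrow> i \<le> i' \<longrightarrow>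
           T (i', j) \<le> T (i, j)) \<and>
        (\<forall>i i' j. (i, j) \<in> extended_cells lam mu d \<longrightarrow> (i', j) \<in> extended_cells lam mu d \<longrightarrow> i \<le> i' \<longrightarrow>
           extended_array lam d T (i', j) \<le> extended_array lam d T (i, j))}"

definition bounded_cylindric_partitions ::
  "nat list \<Rightarrow> nat list \<Rightarrow> nat \<Rightarrow> nat \<Rightarrow> (nat \<times> nat \<Rightarrow> nat) set" where
  "bounded_cylindric_partitions lam mu d n =
     {T \<in> cylindric_partitions lam mu d. \<forall>c \<in> skew_cells lam mu. T c \<le> n}"

end

theory Submission
  imports Defs
begin

text \<open>A cliff and a cylindric partition are both encoded by an order ideal of \<open>\<int>\<^sup>3\<close> that is
  invariant under \<open>(m, -m, 0)\<close> and prescribed outside a strip.  Read along \<open>(0, 0, 1)\<close> the ideal is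
  a cylindric partition.  Read along \<open>(1, 1, 1)\<close> it is the height function of a cliff on the
  vertices of the triangular lattice.  Read along \<open>(1, 1, 0)\<close>, one horizontal level at a time, it is
  a system of \<open>n\<close> non-colliding closed walks of \<open>2 m\<close> steps on the path with vertices
  \<open>1, \<dots>, 2 n + s\<close>.

  All walkers are on sites of the same parity, so the transition matrix of the system is made of the
  \<open>n\<close>-rowed minors of the adjacency matrix of the path.  By Cauchy-Binet, the number of closed systems
  is the sum of the principal \<open>n\<close>-rowed minors of the \<open>2 m\<close>-th power of this matrix, restricted to
  the even sites.  It is diagonalised by sines, with eigenvalues the \<open>m\<close>-th powers of
  \<open>2 + 2 cos (2 k \<pi> / (2 n + s + 1))\<close>, and the sum is their \<open>n\<close>-th elementary symmetric polynomial.\<close>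

section \<open>Minors and non-colliding walks\<close>

text \<open>Non-collision is imposed one step at a time. Walkers on sites of equal parity are at
  least two apart and each moves by one, so a single step of the whole system is a minor with value
  0 or 1, and composing steps is Cauchy-Binet. The shift by two per level creates this gap and also
  fixes the length of the path: unshifted positions lie in 1, ..., s + 2, and the last level is
  shifted by 2 (n - 1), which gives 2 n + s sites. Of these, n + s div 2 are even; selecting n of
  the eigenvalues leaves s div 2 linear factors that contribute x, hence the exponent in the
  formula. On the geometric side a cliff is a set of closed squares in real space, known only
  through injectivity of its projection and through the region that it covers. It becomes
  combinatorial by probing the covering at the vertices and edge midpoints of the triangular
  lattice. Conversely, the surface built from a height function projects injectively because no two
  of its vertices are strictly ordered in all three coordinates.\<close>

text \<open>A determinant by the Leibniz formula. The size is an ordinary number, and rows and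
  columns are picked by arbitrary maps, repetitions included, because the proof of Cauchy-Binet
  passes through all maps.\<close>

definition minor :: "nat \<Rightarrow> ('a \<Rightarrow> 'b \<Rightarrow> real) \<Rightarrow> (nat \<Rightarrow> 'a) \<Rightarrow> (nat \<Rightarrow> 'b) \<Rightarrow> real" where
  "minor n M f h =
     (\<Sum>\<sigma> | \<sigma> permutes {..<n}. of_int (sign \<sigma>) * (\<Prod>i<n. M (f i) (h (\<sigma> i))))"

text \<open>Stands for the \<open>n\<close>-element subsets of \<open>X\<close>. The value outside
  the index range is fixed, so the image determines the function.\<close>

definition inc_tuples :: "nat \<Rightarrow> nat set \<Rightarrow> (nat \<Rightarrow> nat) set" where
  "inc_tuples n X = {f \<in> {..<n} \<rightarrow>\<^sub>E X. strict_mono_on {..<n} f}"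

lemma inc_tuples_mem: "f \<in> inc_tuples n X \<Longrightarrow> i < n \<Longrightarrow> f i \<in> X"
  by (auto simp: inc_tuples_def)

lemma inc_tuples_less: "f \<in> inc_tuples n X \<Longrightarrow> i < k \<Longrightarrow> k < n \<Longrightarrow> f i < f k"
  by (auto simp: inc_tuples_def strict_mono_on_def)

lemma inc_tuples_undefined: "f \<in> inc_tuples n X \<Longrightarrow> \<not> i < n \<Longrightarrow> f i = undefined"
  by (simp add: inc_tuples_def PiE_def extensional_def)

lemma inc_tuples_inj: "f \<in> inc_tuples n X \<Longrightarrow> inj_on f {..<n}"
  by (auto simp: inc_tuples_def intro: strict_mono_on_imp_inj_on)

lemma finite_inc_tuples: "finite X \<Longrightarrow> finite (inc_tuples n X)"
  unfolding inc_tuples_def by (rule finite_subset[of _ "{..<n} \<rightarrow>\<^sub>E X"]) (auto intro: finite_PiE)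

lemma minor_cong:
  assumes "\<And>i k. i < n \<Longrightarrow> k < n \<Longrightarrow> M (f i) (h k) = M' (f i) (h k)"
  shows "minor n M f h = minor n M' f h"
  unfolding minor_def
proof (intro sum.cong arg_cong2[where f = "(*)"] prod.cong refl)
  fix \<sigma> i assume "\<sigma> \<in> {\<sigma>. \<sigma> permutes {..<n}}" "i \<in> {..<n}"
  then show "M (f i) (h (\<sigma> i)) = M' (f i) (h (\<sigma> i))"
    using permutes_in_image[of \<sigma> "{..<n}" i] by (intro assms) auto
qed

lemma minor_permute_rows:
  assumes \<tau>: "\<tau> permutes {..<n}"
  shows "minor n M (f \<circ> \<tau>) h = of_int (sign \<tau>) * minor n M f h"
proof -
  have "minor n M (f \<circ> \<tau>) h = (\<Sum>\<sigma> | \<sigma> permutes {..<n}.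
      of_int (sign (\<sigma> \<circ> \<tau>)) * (\<Prod>i<n. M (f (\<tau> i)) (h (\<sigma> (\<tau> i)))))"
    unfolding minor_def by (subst sum_permutations_compose_right[OF \<tau>]) simp
  also have "\<dots> = (\<Sum>\<sigma> | \<sigma> permutes {..<n}.
      of_int (sign \<tau>) * (of_int (sign \<sigma>) * (\<Prod>i<n. M (f i) (h (\<sigma> i)))))"
  proof (intro sum.cong refl)
    fix \<sigma> assume "\<sigma> \<in> {\<sigma>. \<sigma> permutes {..<n}}"
    then have "permutation \<sigma>" "permutation \<tau>"
      using \<tau> by (auto simp: permutation_permutes)
    moreover have "(\<Prod>i<n. M (f (\<tau> i)) (h (\<sigma> (\<tau> i)))) = (\<Prod>i<n. M (f i) (h (\<sigma> i)))"
      using permutes_imp_bij[OF \<tau>]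
      by (rule prod.reindex_bij_betw)
    ultimately show "of_int (sign (\<sigma> \<circ> \<tau>)) * (\<Prod>i<n. M (f (\<tau> i)) (h (\<sigma> (\<tau> i)))) =
        of_int (sign \<tau>) * (of_int (sign \<sigma>) * (\<Prod>i<n. M (f i) (h (\<sigma> i))))"
      by (simp add: sign_compose)
  qed
  finally show ?thesis by (simp add: minor_def sum_distrib_left)
qed

text \<open>Exchanging two equal rows changes nothing and yet reverses the sign.\<close>

lemma minor_eq_0_if_not_inj:
  assumes "\<not> inj_on f {..<n}"
  shows "minor n M f h = 0"
proof -
  obtain a b where ab: "a < n" "b < n" "a \<noteq> b" "f a = f b"
    using assms by (auto simp: inj_on_def)
  have "Transposition.transpose a b permutes {..<n}" using ab by (simp add: permutes_swap_id)
  from minor_permute_rows[OF this, of M f h]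
  have "minor n M (f \<circ> Transposition.transpose a b) h = - minor n M f h"
    using ab by (simp add: sign_swap_id)
  moreover have "f \<circ> Transposition.transpose a b = f"
    using ab by (auto simp: fun_eq_iff Transposition.transpose_def)
  ultimately show ?thesis by simp
qed

lemma inc_tuples_eq_nth:
  assumes "f \<in> inc_tuples n X" "i < n"
  shows "f i = sorted_list_of_set (f ` {..<n}) ! i"
proof -
  have "sorted (map f [0..<n])" "distinct (map f [0..<n])"
    using assms(1) inc_tuples_inj[OF assms(1)] inc_tuples_less[OF assms(1)]
    by (auto simp: sorted_iff_nth_mono_less less_imp_le distinct_map lessThan_atLeast0)
  then have "sorted_list_of_set (set (map f [0..<n])) = map f [0..<n]"
    by (intro sorted_list_of_set.idem_if_sorted_distinct) auto
  then show ?thesis using assms(2) by (simp add: lessThan_atLeast0)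
qed

lemma inc_tuples_eqI:
  assumes "f \<in> inc_tuples n X" "g \<in> inc_tuples n Y" "f ` {..<n} = g ` {..<n}"
  shows "f = g"
proof
  fix i show "f i = g i"
  proof (cases "i < n")
    case True
    then show ?thesis
      using inc_tuples_eq_nth[OF assms(1) True] inc_tuples_eq_nth[OF assms(2) True] assms(3) by simp
  next
    case False
    then show ?thesis
      using inc_tuples_undefined[OF assms(1)] inc_tuples_undefined[OF assms(2)] by simp
  qed
qed

lemma ex_inc_tuple:
  assumes "finite S" "card S = n" "S \<subseteq> X"
  shows "\<exists>f \<in> inc_tuples n X. f ` {..<n} = S"
proof -
  define f where "f = (\<lambda>i\<in>{..<n}. sorted_list_of_set S ! i)"
  have "strict_mono_on {..<n} f"
    using assms sorted_wrt_nth_less[OF strict_sorted_list_of_set[of S]]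
    by (auto simp: f_def strict_mono_on_def)
  moreover have "f ` {..<n} = S"
  proof -
    have "f ` {..<n} = set (sorted_list_of_set S)"
      unfolding set_conv_nth using assms by (auto simp: f_def)
    then show ?thesis using assms by simp
  qed
  moreover have "f \<in> extensional {..<n}" by (simp add: f_def)
  ultimately show ?thesis using assms by (intro bexI[of _ f]) (auto simp: inc_tuples_def PiE_def)
qed

lemma bij_betw_inc_tuples_subsets:
  assumes "finite X"
  shows "bij_betw (\<lambda>f. f ` {..<n}) (inc_tuples n X) {S. S \<subseteq> X \<and> card S = n}"
  unfolding bij_betw_def
proof safe
  show "inj_on (\<lambda>f. f ` {..<n}) (inc_tuples n X)"
    by (auto intro!: inj_onI inc_tuples_eqI)
next
  fix f i assume "f \<in> inc_tuples n X" "i < n" then show "f i \<in> X"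
    by (rule inc_tuples_mem)
next
  fix f assume "f \<in> inc_tuples n X" then show "card (f ` {..<n}) = n"
    by (simp add: card_image inc_tuples_inj)
next
  fix S assume "S \<subseteq> X" "n = card S"
  then show "S \<in> (\<lambda>f. f ` {..<card S}) ` inc_tuples (card S) X"
    using ex_inc_tuple[of S n X] assms finite_subset[of S X] by blast
qed

text \<open>Sorting: the image of an injective tuple determines the increasing tuple, whose
  injectivity then determines the permutation. Cauchy-Binet groups its terms in this way.\<close>

lemma bij_betw_inc_tuples_permutations:
  fixes X :: "nat set"
  assumes "finite X"
  shows "bij_betw (\<lambda>(f, \<tau>). f \<circ> \<tau>) (inc_tuples n X \<times> {\<tau>. \<tau> permutes {..<n}})
           {g \<in> {..<n} \<rightarrow>\<^sub>E X. inj_on g {..<n}}"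
  unfolding bij_betw_def
proof (intro conjI)
  let ?h = "\<lambda>(f :: nat \<Rightarrow> nat, \<tau> :: nat \<Rightarrow> nat). f \<circ> \<tau>"
  have img: "(f \<circ> \<tau>) ` {..<n} = f ` {..<n}" if "\<tau> permutes {..<n}" for f :: "nat \<Rightarrow> nat" and \<tau>
    using permutes_image[OF that] by (metis image_comp)
  show "inj_on ?h (inc_tuples n X \<times> {\<tau>. \<tau> permutes {..<n}})"
  proof (rule inj_onI, clarify)
    fix f \<tau> f' \<tau>' assume *: "f \<in> inc_tuples n X" "f' \<in> inc_tuples n X"
      "\<tau> permutes {..<n}" "\<tau>' permutes {..<n}" "f \<circ> \<tau> = f' \<circ> \<tau>'"
    then have "f ` {..<n} = f' ` {..<n}" using img by metis
    then have "f = f'" using * inc_tuples_eqI by blast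
    moreover have "\<tau> i = \<tau>' i" for i
    proof (cases "i < n")
      case True
      then have "\<tau> i \<in> {..<n}" "\<tau>' i \<in> {..<n}"
        using permutes_in_image[OF *(3), of i] permutes_in_image[OF *(4), of i] by auto
      moreover have "f (\<tau> i) = f (\<tau>' i)"
        using fun_cong[OF *(5), of i] \<open>f = f'\<close> by simp
      ultimately show ?thesis using inc_tuples_inj[OF *(1)] by (simp add: inj_on_def)
    next
      case False then show ?thesis using *(3,4) by (simp add: permutes_def)
    qed
    ultimately show "f = f' \<and> \<tau> = \<tau>'" by blast
  qed
  show "?h ` (inc_tuples n X \<times> {\<tau>. \<tau> permutes {..<n}}) = {g \<in> {..<n} \<rightarrow>\<^sub>E X. inj_on g {..<n}}"
  proof (intro equalityI subsetI)
    fix g assume "g \<in> ?h ` (inc_tuples n X \<times> {\<tau>. \<tau> permutes {..<n}})"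
    then obtain f \<tau> where *: "f \<in> inc_tuples n X" "\<tau> permutes {..<n}" "g = f \<circ> \<tau>" by auto
    have "\<tau> i < n" if "i < n" for i using permutes_in_image[OF *(2), of i] that by auto
    moreover have "\<tau> i = i" if "\<not> i < n" for i using *(2) that by (simp add: permutes_def)
    moreover have "inj_on g {..<n}" unfolding *(3)
      using * inc_tuples_inj[of f n X] permutes_image[of \<tau> "{..<n}"]
      by (intro comp_inj_on) (auto intro: permutes_inj_on)
    ultimately show "g \<in> {g \<in> {..<n} \<rightarrow>\<^sub>E X. inj_on g {..<n}}"
      using * by (auto simp: inc_tuples_def PiE_def extensional_def)
  next
    fix g assume "g \<in> {g \<in> {..<n} \<rightarrow>\<^sub>E X. inj_on g {..<n}}"
    then have g: "g \<in> {..<n} \<rightarrow>\<^sub>E X" "inj_on g {..<n}" by auto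
    obtain f where f: "f \<in> inc_tuples n X" "f ` {..<n} = g ` {..<n}"
      using ex_inc_tuple[of "g ` {..<n}" n X] g by (auto simp: card_image PiE_def)
    have "bij_betw f {..<n} (g ` {..<n})"
      using f inc_tuples_inj bij_betw_def by metis
    moreover have "bij_betw g {..<n} (g ` {..<n})"
      using g by (simp add: bij_betw_def)
    ultimately have b: "bij_betw (\<lambda>i. inv_into {..<n} f (g i)) {..<n} {..<n}"
      using bij_betw_inv_into bij_betw_trans[unfolded comp_def] by blast
    \<comment> \<open>\<open>\<tau> i\<close> is the rank of \<open>g i\<close> among the values of
      \<open>g\<close>; outside the index range a permutation of \<open>{..<n}\<close> has to be the
      identity.\<close>
    define \<tau> where "\<tau> = (\<lambda>i. if i < n then inv_into {..<n} f (g i) else i)"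
    have "bij_betw \<tau> {..<n} {..<n}"
      using b by (rule bij_betw_cong[THEN iffD1, rotated]) (simp add: \<tau>_def)
    then have "\<tau> permutes {..<n}"
      by (rule bij_imp_permutes) (simp add: \<tau>_def)
    moreover have "g i = (f \<circ> \<tau>) i" for i
    proof (cases "i < n")
      case True
      then have "g i \<in> f ` {..<n}" using f(2) by simp
      then show ?thesis using True by (simp add: \<tau>_def f_inv_into_f)
    next
      case False
      then show ?thesis
        using inc_tuples_undefined[OF f(1) False] g(1) by (simp add: \<tau>_def PiE_def extensional_def)
    qed
    ultimately have "\<tau> permutes {..<n}" "g = f \<circ> \<tau>" by auto
    then show "g \<in> ?h ` (inc_tuples n X \<times> {\<tau>. \<tau> permutes {..<n}})"
      using f(1) by (intro image_eqI[of _ _ "(f, \<tau>)"]) simp_all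
  qed
qed

text \<open>Expanding the product of sums yields one term for each map \<open>g\<close> into
  \<open>X\<close>, whose Leibniz sum is the minor of \<open>N\<close> with rows \<open>g\<close>.
  Maps with repeated values vanish; the others are sorted, and the signs of the sorting permutations
  assemble the minor of \<open>M\<close>.\<close>

theorem Cauchy_Binet:
  fixes M :: "'a \<Rightarrow> nat \<Rightarrow> real" and N :: "nat \<Rightarrow> 'b \<Rightarrow> real"
  assumes X: "finite X"
  shows "minor n (\<lambda>p q. \<Sum>r\<in>X. M p r * N r q) f h =
         (\<Sum>g\<in>inc_tuples n X. minor n M f g * minor n N g h)"
proof -
  let ?P = "{\<sigma>. \<sigma> permutes {..<n}}" and ?E = "{..<n} \<rightarrow>\<^sub>E X"
  let ?F = "\<lambda>g. (\<Prod>i<n. M (f i) (g i)) * minor n N g h"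
  have finE: "finite ?E" using X by (auto intro: finite_PiE)
  have "minor n (\<lambda>p q. \<Sum>r\<in>X. M p r * N r q) f h =
      (\<Sum>\<sigma>\<in>?P. of_int (sign \<sigma>) * (\<Sum>g\<in>?E. \<Prod>i<n. M (f i) (g i) * N (g i) (h (\<sigma> i))))"
    unfolding minor_def using X by (subst prod_sum_PiE) auto
  also have "\<dots> = (\<Sum>\<sigma>\<in>?P. \<Sum>g\<in>?E. (\<Prod>i<n. M (f i) (g i)) *
      (of_int (sign \<sigma>) * (\<Prod>i<n. N (g i) (h (\<sigma> i)))))"
    by (simp add: sum_distrib_left prod.distrib mult_ac)
  also have "\<dots> = (\<Sum>g\<in>?E. ?F g)"
    by (subst sum.swap) (simp add: minor_def sum_distrib_left)
  also have "\<dots> = (\<Sum>g\<in>{g \<in> ?E. inj_on g {..<n}}. ?F g)"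
    using finE by (intro sum.mono_neutral_right) (auto simp: minor_eq_0_if_not_inj)
  also have "\<dots> = (\<Sum>(g, \<tau>)\<in>inc_tuples n X \<times> ?P. ?F (g \<circ> \<tau>))"
    by (subst sum.reindex_bij_betw[OF bij_betw_inc_tuples_permutations[OF X], symmetric])
       (simp add: case_prod_unfold)
  also have "\<dots> = (\<Sum>g\<in>inc_tuples n X. \<Sum>\<tau>\<in>?P. ?F (g \<circ> \<tau>))"
    by (simp add: sum.cartesian_product)
  also have "\<dots> = (\<Sum>g\<in>inc_tuples n X. minor n M f g * minor n N g h)"
    by (intro sum.cong refl) (simp add: minor_permute_rows minor_def[of n M] sum_distrib_left mult_ac)
  finally show ?thesis .
qed

text \<open>Both tuples increase, so a permutation that matches them entry by entry is the identity.
  This starts the induction on walks and evaluates the trace at the end.\<close>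

lemma minor_delta:
  assumes f: "f \<in> inc_tuples n X" and h: "h \<in> inc_tuples n X"
  shows "minor n (\<lambda>p q. if p = q then 1 else 0) f h = (if f = h then 1 else 0)"
proof -
  have *: "\<sigma> = id \<and> f = h" if s: "\<sigma> permutes {..<n}" and eq: "\<forall>i<n. f i = h (\<sigma> i)" for \<sigma>
  proof -
    have "f ` {..<n} = (h \<circ> \<sigma>) ` {..<n}" using eq by (intro image_cong) auto
    also have "\<dots> = h ` {..<n}" using permutes_image[OF s] by (metis image_comp)
    finally have fh: "f = h" using f h inc_tuples_eqI by blast
    have "\<sigma> i = i" for i
    proof (cases "i < n")
      case True
      then have "\<sigma> i < n" using permutes_in_image[OF s, of i] by auto
      then show ?thesis using True eq fh inc_tuples_inj[OF h] by (auto simp: inj_on_def)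
    qed (use s in \<open>auto simp: permutes_def\<close>)
    then show ?thesis using fh by auto
  qed
  have "(\<Prod>i<n. if f i = h (\<sigma> i) then 1 else 0 :: real) = (if \<sigma> = id \<and> f = h then 1 else 0)"
    if "\<sigma> permutes {..<n}" for \<sigma>
  proof (cases "\<forall>i<n. f i = h (\<sigma> i)")
    case True then show ?thesis using *[OF that] by auto
  next
    case False
    then have "(\<Prod>i<n. if f i = h (\<sigma> i) then 1 else 0 :: real) = 0"
      by (intro prod_zero) auto
    moreover have "\<not> (\<sigma> = id \<and> f = h)" using False by auto
    ultimately show ?thesis by auto
  qed
  then have "minor n (\<lambda>p q. if p = q then 1 else 0) f h =
      (\<Sum>\<sigma> | \<sigma> permutes {..<n}. if \<sigma> = id then (if f = h then 1 else 0) else 0)"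
    unfolding minor_def by (intro sum.cong refl) auto
  also have "\<dots> = (if f = h then 1 else 0)"
    by (subst sum.delta) (auto simp: finite_permutations permutes_id)
  finally show ?thesis .
qed

section \<open>Systems of walkers on a path\<close>

definition adj :: "nat \<Rightarrow> nat \<Rightarrow> real" where
  "adj p q = (if p = Suc q \<or> q = Suc p then 1 else 0)"

text \<open>Each step changes the parity, so a walker that starts on an even vertex occupies a
  vertex of the parity of \<open>u\<close> at time \<open>u\<close>.\<close>

definition sites :: "nat \<Rightarrow> nat \<Rightarrow> nat set" where
  "sites j u = {p \<in> {1..j}. even (p + u)}"

lemma finite_sites [simp]: "finite (sites j u)"
  by (simp add: sites_def)

definition tuple_step :: "nat \<Rightarrow> (nat \<Rightarrow> nat) \<Rightarrow> (nat \<Rightarrow> nat) \<Rightarrow> bool" where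
  "tuple_step n f h \<longleftrightarrow> (\<forall>i<n. f i = Suc (h i) \<or> h i = Suc (f i))"

text \<open>The entries of a tuple have the same parity, so only the identity permutation contributes.\<close>

lemma minor_adj:
  assumes f: "f \<in> inc_tuples n (sites j u)" and h: "h \<in> inc_tuples n (sites j (Suc u))"
  shows "minor n adj f h = (if tuple_step n f h then 1 else 0)"
proof -
  have gap: "Suc (g i) < g k" if "g \<in> inc_tuples n (sites j v)" "i < k" "k < n" for g i k v
  proof -
    have "g i < g k" "even (g i + v)" "even (g k + v)"
      using that inc_tuples_mem[OF that(1), of i] inc_tuples_mem[OF that(1), of k] inc_tuples_less
      by (auto simp: sites_def)
    then show ?thesis by (metis Suc_lessI even_Suc add_Suc)
  qed
  have zero: "(\<Prod>i<n. adj (f i) (h (\<sigma> i))) = 0" if s: "\<sigma> permutes {..<n}" "\<sigma> \<noteq> id" for \<sigma>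
  proof (rule ccontr)
    assume "(\<Prod>i<n. adj (f i) (h (\<sigma> i))) \<noteq> 0"
    then have nz: "f i = Suc (h (\<sigma> i)) \<or> h (\<sigma> i) = Suc (f i)" if "i < n" for i
      using that by (auto simp: adj_def split: if_splits)
    have lt: "\<sigma> i < n" if "i < n" for i using permutes_in_image[OF s(1), of i] that by auto
    have mono: "\<sigma> i < \<sigma> k" if "i < k" "k < n" for i k
    proof (rule ccontr)
      assume "\<not> \<sigma> i < \<sigma> k"
      moreover have "\<sigma> i \<noteq> \<sigma> k" using permutes_inj[OF s(1)] that by (auto dest: injD)
      ultimately have "\<sigma> k < \<sigma> i" by auto
      \<comment> \<open>Both pairs are at least two apart and every move has length one, so the two
        walkers cannot have exchanged their order.\<close>
      then have "Suc (h (\<sigma> k)) < h (\<sigma> i)" using gap[OF h] lt that by simp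
      moreover have "Suc (f i) < f k" using gap[OF f] that by simp
      ultimately show False using nz[of i] nz[of k] that by linarith
    qed
    have "\<sigma> i \<ge> i" if "i < n" for i
      using that
    proof (induction i)
      case (Suc i)
      then show ?case using mono[of i "Suc i"] by simp
    qed simp
    then have "\<sigma> = id" using permutes_natset_ge[OF s(1)] by auto
    then show False using s by simp
  qed
  have "minor n adj f h =
      (\<Sum>\<sigma> | \<sigma> permutes {..<n}. if \<sigma> = id then \<Prod>i<n. adj (f i) (h i) else 0)"
    unfolding minor_def using zero by (intro sum.cong refl) auto
  also have "\<dots> = (\<Prod>i<n. adj (f i) (h i))"
    by (subst sum.delta) (auto simp: finite_permutations permutes_id)
  also have "\<dots> = (if tuple_step n f h then 1 else 0)"
  proof (cases "tuple_step n f h")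
    case False
    then have "(\<Prod>i<n. adj (f i) (h i)) = 0"
      by (intro prod_zero) (auto simp: tuple_step_def adj_def)
    then show ?thesis using False by simp
  qed (auto simp: tuple_step_def adj_def intro!: prod.neutral)
  finally show ?thesis .
qed

text \<open>For \<open>p\<close> in \<open>sites j 0\<close> and \<open>q\<close> in
  \<open>sites j k\<close> this counts the walks of \<open>k\<close> steps on the path from
  \<open>p\<close> to \<open>q\<close>. Intermediate vertices are summed over the sites of the right
  parity only, so that Cauchy-Binet produces tuples in \<open>sites j k\<close>.\<close>

fun walk_weight :: "nat \<Rightarrow> nat \<Rightarrow> nat \<Rightarrow> nat \<Rightarrow> real" where
  "walk_weight j 0 p q = (if p = q then 1 else 0)"
| "walk_weight j (Suc k) p q = (\<Sum>r\<in>sites j k. walk_weight j k p r * adj r q)"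

definition tuple_walks ::
  "nat \<Rightarrow> nat \<Rightarrow> nat \<Rightarrow> (nat \<Rightarrow> nat) \<Rightarrow> (nat \<Rightarrow> nat) \<Rightarrow> (nat \<Rightarrow> nat) list set" where
  "tuple_walks n j k f h = {cs. length cs = Suc k \<and> cs ! 0 = f \<and> cs ! k = h \<and>
     (\<forall>u\<le>k. cs ! u \<in> inc_tuples n (sites j u)) \<and> (\<forall>u<k. tuple_step n (cs ! u) (cs ! Suc u))}"

lemma tuple_walks_Suc:
  assumes "h \<in> inc_tuples n (sites j (Suc k))"
  shows "tuple_walks n j (Suc k) f h =
    (\<lambda>cs. cs @ [h]) ` (\<Union>g\<in>{g \<in> inc_tuples n (sites j k). tuple_step n g h}. tuple_walks n j k f g)"
    (is "_ = ?R")
proof (intro equalityI subsetI)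
  fix cs assume cs: "cs \<in> tuple_walks n j (Suc k) f h"
  then have len: "length cs = Suc (Suc k)" and c0: "cs ! 0 = f" and ck: "cs ! Suc k = h"
    and ci: "\<And>u. u \<le> Suc k \<Longrightarrow> cs ! u \<in> inc_tuples n (sites j u)"
    and cst: "\<And>u. u < Suc k \<Longrightarrow> tuple_step n (cs ! u) (cs ! Suc u)"
    by (auto simp: tuple_walks_def)
  define ds where "ds = butlast cs"
  have ds: "cs = ds @ [h]" "length ds = Suc k"
  proof -
    have "cs \<noteq> []" using len by auto
    moreover have "last cs = h"
      using \<open>cs \<noteq> []\<close> ck len by (simp add: last_conv_nth)
    ultimately show "cs = ds @ [h]" unfolding ds_def by (metis append_butlast_last_id)
    show "length ds = Suc k" using len by (simp add: ds_def)
  qed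
  have nth: "cs ! u = ds ! u" if "u \<le> k" for u using that ds by (simp add: nth_append)
  have "ds \<in> tuple_walks n j k f (ds ! k)"
    unfolding tuple_walks_def
  proof (intro CollectI conjI allI impI)
    show "length ds = Suc k" by (rule ds(2))
    show "ds ! 0 = f" using c0 nth[of 0] by simp
    show "ds ! u \<in> inc_tuples n (sites j u)" if "u \<le> k" for u
      using ci[of u] nth[OF that] that by simp
    show "tuple_step n (ds ! u) (ds ! Suc u)" if "u < k" for u
      using cst[of u] nth[of u] nth[of "Suc u"] that by simp
  qed simp
  moreover have "ds ! k \<in> inc_tuples n (sites j k)" "tuple_step n (ds ! k) h"
    using ci[of k] cst[of k] nth[of k] ck by simp_all
  ultimately show "cs \<in> ?R" using ds by blast
next
  fix cs assume "cs \<in> ?R"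
  then obtain g ds where cs: "cs = ds @ [h]" and g: "tuple_step n g h" and ds: "ds \<in> tuple_walks n j k f g"
    by auto
  have len: "length ds = Suc k" using ds by (simp add: tuple_walks_def)
  have nth: "cs ! u = (if u = Suc k then h else ds ! u)" if "u \<le> Suc k" for u
    using that len cs by (simp add: nth_append)
  have lencs: "length cs = Suc (Suc k)" using cs len by simp
  show "cs \<in> tuple_walks n j (Suc k) f h"
    using assms ds g lencs unfolding tuple_walks_def by (auto simp: nth le_Suc_eq less_Suc_eq)
qed

lemma finite_tuple_walks: "finite (tuple_walks n j k f h)"
proof (rule finite_subset)
  have "cs ! i \<in> (\<Union>u\<le>k. inc_tuples n (sites j u))" if "cs \<in> tuple_walks n j k f h" "i \<le> k" for cs i
    using that by (auto simp: tuple_walks_def)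
  then show "tuple_walks n j k f h \<subseteq>
      {cs. set cs \<subseteq> (\<Union>u\<le>k. inc_tuples n (sites j u)) \<and> length cs = Suc k}"
    by (force simp: tuple_walks_def in_set_conv_nth less_Suc_eq_le)
  show "finite {cs. set cs \<subseteq> (\<Union>u\<le>k. inc_tuples n (sites j u)) \<and> length cs = Suc k}"
    by (intro finite_lists_length_eq) (auto intro: finite_inc_tuples)
qed

text \<open>The last step is split off. Its indicator is a minor of \<open>adj\<close>, and
  Cauchy-Binet absorbs the sum over the preceding tuple.\<close>

lemma card_tuple_walks:
  assumes f: "f \<in> inc_tuples n (sites j 0)"
  shows "h \<in> inc_tuples n (sites j k) \<Longrightarrow>
    real (card (tuple_walks n j k f h)) = minor n (walk_weight j k) f h"
proof (induction k arbitrary: h)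
  case 0
  have "tuple_walks n j 0 f h = (if f = h then {[f]} else {})"
    using 0 f by (auto simp: tuple_walks_def length_Suc_conv)
  then show ?case using minor_delta[OF f 0] by simp
next
  case (Suc k)
  let ?I = "inc_tuples n (sites j k)"
  have "card (tuple_walks n j (Suc k) f h) =
      card (\<Union>g\<in>{g \<in> ?I. tuple_step n g h}. tuple_walks n j k f g)"
    unfolding tuple_walks_Suc[OF Suc.prems] by (intro card_image inj_onI) auto
  also have "\<dots> = (\<Sum>g | g \<in> ?I \<and> tuple_step n g h. card (tuple_walks n j k f g))"
    by (intro card_UN_disjoint) (auto simp: finite_inc_tuples finite_tuple_walks, auto simp: tuple_walks_def)
  finally have "real (card (tuple_walks n j (Suc k) f h)) =
      (\<Sum>g\<in>?I. if tuple_step n g h then minor n (walk_weight j k) f g else 0)"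
    using Suc.IH by (simp add: sum.inter_filter[symmetric] finite_inc_tuples)
  also have "\<dots> = (\<Sum>g\<in>?I. minor n (walk_weight j k) f g * minor n adj g h)"
    using minor_adj Suc.prems by (intro sum.cong) auto
  also have "\<dots> = minor n (walk_weight j (Suc k)) f h"
    by (subst Cauchy_Binet[symmetric]) (auto intro: minor_cong)
  finally show ?case .
qed

section \<open>Diagonalisation by sines\<close>

text \<open>The sine vanishes at 0 and at \<open>j + 1\<close>, the two vertices just outside the
  path. Hence both neighbours may be summed at every site, and the addition formulas produce the
  eigenvalue.\<close>

lemma sum_adj_even_sites:
  assumes p: "p \<in> sites j k"
  shows "(\<Sum>r\<in>sites j (Suc k). adj p r * sin (real \<kappa> * pi * real r / real (j + 1))) =
    2 * cos (real \<kappa> * pi / real (j + 1)) * sin (real \<kappa> * pi * real p / real (j + 1))"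
proof -
  define \<theta> where "\<theta> = real \<kappa> * pi / real (j + 1)"
  have arg: "real \<kappa> * pi * real r / real (j + 1) = real r * \<theta>" for r
    by (simp add: \<theta>_def)
  have end0: "sin (real (j + 1) * \<theta>) = 0"
    using sin_npi[of \<kappa>] by (simp add: \<theta>_def)
  obtain q where q: "p = Suc q" using p by (cases p) (auto simp: sites_def)
  have "(\<Sum>r\<in>sites j (Suc k). adj p r * sin (real r * \<theta>)) =
      (\<Sum>r\<in>{q, Suc p}. sin (real r * \<theta>))"
  proof (rule sum.mono_neutral_cong)
    fix r assume "r \<in> {q, Suc p} - sites j (Suc k)"
    then have "r = 0 \<or> r = j + 1" using p q by (auto simp: sites_def)
    then show "sin (real r * \<theta>) = 0" using end0 by auto
  next
    fix r assume "r \<in> sites j (Suc k) - {q, Suc p}"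
    then show "adj p r * sin (real r * \<theta>) = 0" using q by (auto simp: adj_def)
  next
    fix r assume "r \<in> sites j (Suc k) \<inter> {q, Suc p}"
    then show "adj p r * sin (real r * \<theta>) = sin (real r * \<theta>)" using q by (auto simp: adj_def)
  qed auto
  also have "\<dots> = sin (real p * \<theta> - \<theta>) + sin (real p * \<theta> + \<theta>)"
    using q by (simp add: algebra_simps)
  also have "\<dots> = 2 * cos \<theta> * sin (real p * \<theta>)"
    by (simp add: sin_add sin_diff)
  finally show ?thesis unfolding arg by (simp add: \<theta>_def)
qed

lemma sum_walk_weight_sin:
  assumes p: "p \<in> sites j 0"
  shows "(\<Sum>q\<in>sites j k. walk_weight j k p q * sin (real \<kappa> * pi * real q / real (j + 1))) =
    (2 * cos (real \<kappa> * pi / real (j + 1))) ^ k * sin (real \<kappa> * pi * real p / real (j + 1))"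
proof (induction k)
  case 0
  then show ?case using p by (simp add: if_distrib[of "\<lambda>x. x * _"] sum.delta' cong: if_cong)
next
  case (Suc k)
  let ?s = "\<lambda>r. sin (real \<kappa> * pi * real r / real (j + 1))"
  have "(\<Sum>q\<in>sites j (Suc k). walk_weight j (Suc k) p q * ?s q) =
      (\<Sum>r\<in>sites j k. \<Sum>q\<in>sites j (Suc k). walk_weight j k p r * adj r q * ?s q)"
    by (subst sum.swap) (simp add: sum_distrib_right)
  also have "\<dots> = (\<Sum>r\<in>sites j k. walk_weight j k p r * (\<Sum>q\<in>sites j (Suc k). adj r q * ?s q))"
    by (simp only: sum_distrib_left mult.assoc)
  also have "\<dots> = (\<Sum>r\<in>sites j k. 2 * cos (real \<kappa> * pi / real (j + 1)) * (walk_weight j k p r * ?s r))"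
    by (intro sum.cong refl, subst sum_adj_even_sites) auto
  also have "\<dots> = 2 * cos (real \<kappa> * pi / real (j + 1)) * (\<Sum>r\<in>sites j k. walk_weight j k p r * ?s r)"
    by (simp only: sum_distrib_left)
  finally show ?case using Suc by simp
qed

text \<open>The real part of a geometric sum whose ratio is an \<open>M\<close>-th root of unity
  other than 1.\<close>

lemma sum_cos_full_period:
  fixes l :: int
  assumes M: "M > 0" and l: "\<not> int M dvd l"
  shows "(\<Sum>r<M. cos (2 * pi * of_int l * real r / real M)) = 0"
proof -
  define z where "z = cis (2 * pi * of_int l / real M)"
  have "z ^ M = 1"
  proof -
    have "real M * (2 * pi * of_int l / real M) = 2 * pi * of_int l" using M by simp
    then have "z ^ M = cis (2 * pi * of_int l)"
      unfolding z_def Complex.DeMoivre by (simp only:)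
    then show ?thesis using cis_multiple_2pi[of "of_int l"] by simp
  qed
  moreover have "z \<noteq> 1"
  proof
    assume "z = 1"
    then have "cos (2 * pi * of_int l / real M) = 1" by (simp add: z_def complex_eq_iff)
    then obtain x :: int where "2 * pi * of_int l / real M = of_int x * 2 * pi"
      by (auto simp: cos_one_2pi_int)
    then have "real_of_int l = of_int x * real M"
      using M by (simp add: field_simps)
    then have "l = x * int M" by (metis of_int_eq_iff of_int_mult of_int_of_nat_eq)
    then show False using l by simp
  qed
  ultimately have "(\<Sum>r<M. z ^ r) = 0"
    by (simp add: geometric_sum)
  then have "(\<Sum>r<M. Re (z ^ r)) = 0"
    by (metis Re_sum zero_complex.simps(1))
  then show ?thesis by (simp add: z_def Complex.DeMoivre mult_ac)
qed

text \<open>The two cases for \<open>M\<close> are \<open>j + 1\<close> with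
  \<open>N = j div 2\<close>, for \<open>j\<close> even and odd. A full period is evaluated by
  turning the product into cosines; the reflection of \<open>r\<close> to \<open>M - r\<close>
  preserves the summand, so the range from 1 to \<open>N\<close> contributes half.\<close>

lemma sin_orthogonality:
  fixes k l :: nat
  assumes M: "M = 2 * N + 1 \<or> M = 2 * N + 2" and kl: "k \<in> {1..N}" "l \<in> {1..N}"
  shows "(\<Sum>r = 1..N. sin (2 * pi * real k * real r / real M) * sin (2 * pi * real l * real r / real M)) =
    (if k = l then real M / 4 else 0)"
proof -
  let ?f = "\<lambda>r. sin (2 * pi * real k * real r / real M) * sin (2 * pi * real l * real r / real M)"
  let ?c = "\<lambda>x :: int. \<Sum>r<M. cos (2 * pi * of_int x * real r / real M)"
  have Mpos: "M > 0" using M by auto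
  have half: "?f r = (cos (2 * pi * of_int (int k - int l) * real r / real M) -
      cos (2 * pi * of_int (int k + int l) * real r / real M)) / 2" for r
    by (simp add: sin_times_sin algebra_simps diff_divide_distrib add_divide_distrib)
  \<comment> \<open>Here \<open>k + l\<close> lies between 2 and \<open>2 * N\<close>, which is less
    than \<open>M\<close>.\<close>
  have plus: "?c (int k + int l) = 0"
    using kl M Mpos zdvd_imp_le[of "int M" "int k + int l"] by (intro sum_cos_full_period) auto
  have minus: "?c (int k - int l) = (if k = l then real M else 0)"
  proof (cases "k = l")
    case False
    have "\<not> int M dvd (int k - int l)"
      using kl M False dvd_imp_le_int[of "int k - int l" "int M"] by auto
    then show ?thesis using False sum_cos_full_period[OF Mpos] by (simp only: if_False)
  qed simp
  have full: "(\<Sum>r<M. ?f r) = (if k = l then real M / 2 else 0)"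
    unfolding half sum_divide_distrib[symmetric] sum_subtractf plus minus by simp
  have refl: "?f (M - r) = ?f r" if "r < M" for r
  proof -
    have "sin (2 * pi * real x * real (M - r) / real M) = - sin (2 * pi * real x * real r / real M)" for x :: nat
    proof -
      have "2 * pi * real x * real (M - r) / real M = real x * (2 * pi) - 2 * pi * real x * real r / real M"
        using that Mpos by (simp add: of_nat_diff field_simps)
      then show ?thesis
        using sin_npi[of "2 * x"] cos_npi[of "2 * x"] by (simp add: sin_diff mult_ac)
    qed
    then show ?thesis by simp
  qed
  have upper: "(\<Sum>r\<in>{M - N..<M}. ?f r) = (\<Sum>r = 1..N. ?f r)"
  proof (rule sum.reindex_bij_witness[of _ "\<lambda>r. M - r" "\<lambda>r. M - r"])
    fix r assume "r \<in> {M - N..<M}"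
    then show "?f (M - r) = ?f r" by (intro refl) simp
  qed (use M in auto)
  \<comment> \<open>Besides 0, the two ranges miss an index only if \<open>M\<close> is even, namely
    its half, where the argument of the sine is a multiple of \<pi>.\<close>
  have mid: "?f r = 0" if "r \<in> {..<M} - ({1..N} \<union> {M - N..<M})" for r
  proof -
    have "r = 0 \<or> 2 * r = M" using that M by auto
    then show ?thesis
    proof
      assume "2 * r = M"
      then have "2 * pi * real k * real r / real M = real k * pi"
        using Mpos by (auto simp: field_simps)
      then show ?thesis using sin_npi[of k] by (simp add: mult_ac)
    qed simp
  qed
  have "(\<Sum>r<M. ?f r) = (\<Sum>r\<in>{1..N} \<union> {M - N..<M}. ?f r)"
  proof (rule sum.mono_neutral_right)
    show "\<forall>r\<in>{..<M} - ({1..N} \<union> {M - N..<M}). ?f r = 0" using mid by blast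
  qed (use M in auto)
  also have "\<dots> = 2 * (\<Sum>r = 1..N. ?f r)"
  proof -
    have "{1..N} \<inter> {M - N..<M} = {}" using M by auto
    then have "(\<Sum>r\<in>{1..N} \<union> {M - N..<M}. ?f r) = (\<Sum>r = 1..N. ?f r) + (\<Sum>r\<in>{M - N..<M}. ?f r)"
      by (intro sum.union_disjoint) simp_all
    then show ?thesis unfolding upper by simp
  qed
  finally show ?thesis using full by (simp split: if_splits)
qed

lemma sum_sites_0:
  "(\<Sum>p\<in>sites j 0. F p) = (\<Sum>r = 1..j div 2. F (2 * r))"
  by (rule sum.reindex_bij_witness[of _ "\<lambda>r. 2 * r" "\<lambda>p. p div 2"]) (auto simp: sites_def elim!: evenE)

text \<open>This is the trace of the \<open>n\<close>-th compound of a diagonalised matrix. On even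
  sites the frequencies \<open>\<kappa>\<close> and \<open>j + 1 - \<kappa>\<close> give the same
  vector up to sign, so only those up to \<open>j div 2\<close> occur, as many as there are even
  sites.\<close>

theorem sum_card_closed_tuple_walks:
  fixes j m n :: nat
  shows "real (\<Sum>f\<in>inc_tuples n (sites j 0). card (tuple_walks n j (2 * m) f f)) =
    (\<Sum>\<kappa>\<in>inc_tuples n {1..j div 2}. \<Prod>i<n. (2 + 2 * cos (2 * real (\<kappa> i) * pi / real (j + 1))) ^ m)"
proof -
  define N where "N = j div 2"
  define M where "M = j + 1"
  have MN: "M = 2 * N + 1 \<or> M = 2 * N + 2" and Mpos: "real M > 0" by (auto simp: M_def N_def)
  \<comment> \<open>The factor makes the vectors orthonormal, since the squares of the sines sum to
    \<open>M / 4\<close>.\<close>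
  define \<phi> where "\<phi> = (\<lambda>p \<kappa> :: nat. sqrt (4 / real M) * sin (real \<kappa> * pi * real p / real M))"
  \<comment> \<open>As 2 + 2 cos (2 t) is the square of 2 cos t, this is the eigenvalue of
    \<open>2 * m\<close> steps.\<close>
  define \<mu> where "\<mu> = (\<lambda>\<kappa> :: nat. (2 + 2 * cos (2 * real \<kappa> * pi / real M)) ^ m)"
  define \<delta> where "\<delta> = (\<lambda>p q :: nat. if p = q then 1 else 0 :: real)"
  have \<mu>: "\<mu> \<kappa> = (2 * cos (real \<kappa> * pi / real M)) ^ (2 * m)" for \<kappa>
    using cos_double_cos[of "real \<kappa> * pi / real M"]
    unfolding \<mu>_def power_mult by (intro arg_cong[where f = "\<lambda>x. x ^ m"]) (simp add: power2_eq_square mult_ac)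
  have \<phi>2: "\<phi> (2 * r) \<kappa> * \<phi> (2 * r') \<kappa>' = 4 / real M *
      (sin (2 * pi * real r * real \<kappa> / real M) * sin (2 * pi * real r' * real \<kappa>' / real M))"
    for r r' \<kappa> \<kappa>'
  proof -
    have "\<phi> (2 * r) \<kappa> * \<phi> (2 * r') \<kappa>' = (sqrt (4 / real M) * sqrt (4 / real M)) *
      (sin (2 * pi * real r * real \<kappa> / real M) * sin (2 * pi * real r' * real \<kappa>' / real M))"
      unfolding \<phi>_def by (simp only: of_nat_mult of_nat_numeral mult_ac)
    also have "sqrt (4 / real M) * sqrt (4 / real M) = 4 / real M" using Mpos by simp
    finally show ?thesis .
  qed
  have orth: "(\<Sum>p\<in>sites j 0. \<phi> p \<kappa> * \<phi> p \<kappa>') = \<delta> \<kappa> \<kappa>'"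
    if "\<kappa> \<in> {1..N}" "\<kappa>' \<in> {1..N}" for \<kappa> \<kappa>'
  proof -
    have "(\<Sum>p\<in>sites j 0. \<phi> p \<kappa> * \<phi> p \<kappa>') = (\<Sum>r = 1..N. 4 / real M *
        (sin (2 * pi * real \<kappa> * real r / real M) * sin (2 * pi * real \<kappa>' * real r / real M)))"
      unfolding sum_sites_0 N_def[symmetric]
      by (intro sum.cong refl, subst \<phi>2) (simp only: mult_ac)
    then show ?thesis
      using sin_orthogonality[OF MN that] Mpos by (simp only: sum_distrib_left[symmetric]) (simp add: \<delta>_def)
  qed
  \<comment> \<open>At an even site \<open>2 * r\<close> the sine is symmetric in \<open>r\<close>
    and the frequency, so completeness is orthogonality with the two roles exchanged.\<close>
  have complete: "(\<Sum>\<kappa>\<in>{1..N}. \<phi> p \<kappa> * \<phi> q \<kappa>) = \<delta> p q"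
    if pq: "p \<in> sites j 0" "q \<in> sites j 0" for p q
  proof -
    obtain r r' where r: "p = 2 * r" "q = 2 * r'" "r \<in> {1..N}" "r' \<in> {1..N}"
      using pq by (auto simp: sites_def N_def elim!: evenE)
    show ?thesis unfolding r(1,2) \<phi>2
      using sin_orthogonality[OF MN r(3,4)] Mpos by (simp only: sum_distrib_left[symmetric]) (simp add: \<delta>_def)
  qed
  have eig: "(\<Sum>q\<in>sites j 0. walk_weight j (2 * m) p q * \<phi> q \<kappa>) = \<mu> \<kappa> * \<phi> p \<kappa>"
    if "p \<in> sites j 0" for p \<kappa>
  proof -
    have "sites j (2 * m) = sites j 0" by (simp add: sites_def)
    then show ?thesis
      using arg_cong[OF sum_walk_weight_sin[OF that, of "2 * m" \<kappa>], of "\<lambda>x. sqrt (4 / real M) * x"]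
      unfolding \<phi>_def \<mu> M_def by (simp add: sum_distrib_left mult_ac)
  qed
  have spectral: "walk_weight j (2 * m) p q = (\<Sum>\<kappa>\<in>{1..N}. (\<mu> \<kappa> * \<phi> p \<kappa>) * \<phi> q \<kappa>)"
    if pq: "p \<in> sites j 0" "q \<in> sites j 0" for p q
  proof -
    have "walk_weight j (2 * m) p q = (\<Sum>q'\<in>sites j 0. walk_weight j (2 * m) p q' * \<delta> q' q)"
      using pq by (simp add: \<delta>_def if_distrib[of "\<lambda>x. _ * x"] sum.delta cong: if_cong)
    also have "\<dots> = (\<Sum>q'\<in>sites j 0. walk_weight j (2 * m) p q' * (\<Sum>\<kappa>\<in>{1..N}. \<phi> q' \<kappa> * \<phi> q \<kappa>))"
      using complete pq by (intro sum.cong) auto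
    also have "\<dots> = (\<Sum>\<kappa>\<in>{1..N}. (\<Sum>q'\<in>sites j 0. walk_weight j (2 * m) p q' * \<phi> q' \<kappa>) * \<phi> q \<kappa>)"
      by (simp add: sum_distrib_left sum_distrib_right mult.assoc sum.swap[of _ "sites j 0"])
    finally show ?thesis using eig pq by simp
  qed
  let ?T = "inc_tuples n (sites j 0)" and ?K = "inc_tuples n {1..N}"
  have "real (\<Sum>f\<in>?T. card (tuple_walks n j (2 * m) f f)) =
      (\<Sum>f\<in>?T. minor n (walk_weight j (2 * m)) f f)"
    by (simp add: card_tuple_walks sites_def)
  also have "\<dots> = (\<Sum>f\<in>?T. minor n (\<lambda>p q. \<Sum>\<kappa>\<in>{1..N}. (\<mu> \<kappa> * \<phi> p \<kappa>) * \<phi> q \<kappa>) f f)"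
    by (intro sum.cong refl minor_cong spectral) (auto intro: inc_tuples_mem)
  also have "\<dots> = (\<Sum>f\<in>?T. \<Sum>\<kappa>\<in>?K. minor n (\<lambda>p \<kappa>. \<mu> \<kappa> * \<phi> p \<kappa>) f \<kappa> * minor n (\<lambda>\<kappa> q. \<phi> q \<kappa>) \<kappa> f)"
    by (subst Cauchy_Binet) auto
  also have "\<dots> = (\<Sum>f\<in>?T. \<Sum>\<kappa>\<in>?K. (\<Prod>i<n. \<mu> (\<kappa> i)) *
      (minor n (\<lambda>\<kappa> q. \<phi> q \<kappa>) \<kappa> f * minor n (\<lambda>p \<kappa>. \<phi> p \<kappa>) f \<kappa>))"
  proof (intro sum.cong refl)
    fix f \<kappa> :: "nat \<Rightarrow> nat"
    have "(\<Prod>i<n. \<mu> (\<kappa> (\<sigma> i))) = (\<Prod>i<n. \<mu> (\<kappa> i))" if "\<sigma> permutes {..<n}" for \<sigma>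
      using prod.reindex_bij_betw[OF permutes_imp_bij[OF that], of "\<lambda>i. \<mu> (\<kappa> i)"] .
    then have "minor n (\<lambda>p \<kappa>. \<mu> \<kappa> * \<phi> p \<kappa>) f \<kappa> = (\<Prod>i<n. \<mu> (\<kappa> i)) * minor n (\<lambda>p \<kappa>. \<phi> p \<kappa>) f \<kappa>"
      unfolding minor_def by (simp add: prod.distrib sum_distrib_left mult_ac)
    then show "minor n (\<lambda>p \<kappa>. \<mu> \<kappa> * \<phi> p \<kappa>) f \<kappa> * minor n (\<lambda>\<kappa> q. \<phi> q \<kappa>) \<kappa> f =
        (\<Prod>i<n. \<mu> (\<kappa> i)) * (minor n (\<lambda>\<kappa> q. \<phi> q \<kappa>) \<kappa> f * minor n (\<lambda>p \<kappa>. \<phi> p \<kappa>) f \<kappa>)"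
      by simp
  qed
  \<comment> \<open>Cyclicity of the trace: with the sum over \<open>f\<close> performed innermost,
    Cauchy-Binet is applied backwards and meets the Gram matrix of the eigenvectors.\<close>
  also have "\<dots> = (\<Sum>\<kappa>\<in>?K. (\<Prod>i<n. \<mu> (\<kappa> i)) *
      minor n (\<lambda>\<kappa> \<kappa>'. \<Sum>p\<in>sites j 0. \<phi> p \<kappa> * \<phi> p \<kappa>') \<kappa> \<kappa>)"
    by (subst sum.swap) (simp add: Cauchy_Binet sum_distrib_left)
  also have "\<dots> = (\<Sum>\<kappa>\<in>?K. (\<Prod>i<n. \<mu> (\<kappa> i)) * minor n \<delta> \<kappa> \<kappa>)"
    by (intro sum.cong refl arg_cong2[where f = "(*)"] minor_cong orth) (auto dest: inc_tuples_mem)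
  also have "\<dots> = (\<Sum>\<kappa>\<in>?K. \<Prod>i<n. \<mu> (\<kappa> i))"
    unfolding \<delta>_def by (intro sum.cong refl) (simp add: minor_delta)
  finally show ?thesis by (simp add: \<mu>_def M_def N_def)
qed

section \<open>Coefficients as elementary symmetric polynomials\<close>

text \<open>In the expanded product, \<open>t\<close> factors contribute the variable and the
  remaining \<open>n\<close> factors contribute their constants.\<close>

lemma coeff_prod_linear:
  fixes c :: "nat \<Rightarrow> 'a :: comm_ring_1"
  shows "coeff (\<Prod>k = 1..n + t. [:c k, 1:]) t = (\<Sum>\<kappa>\<in>inc_tuples n {1..n + t}. \<Prod>i<n. c (\<kappa> i))"
proof -
  let ?A = "{1..n + t}"
  have "(\<Prod>k\<in>?A. [:c k, 1:]) = (\<Prod>k\<in>?A. [:c k:] + monom 1 1)"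
    by (intro prod.cong) (auto simp: monom_altdef)
  also have "\<dots> = (\<Sum>S\<in>Pow ?A. (\<Prod>k\<in>S. [:c k:]) * (\<Prod>k\<in>?A - S. monom 1 1))"
    by (subst prod_add) auto
  also have "\<dots> = (\<Sum>S\<in>Pow ?A. monom (\<Prod>k\<in>S. c k) (card (?A - S)))"
  proof (intro sum.cong refl)
    fix S assume "S \<in> Pow ?A"
    have "(\<Prod>k\<in>S. [:c k:]) = [:\<Prod>k\<in>S. c k:]"
      by (induction S rule: infinite_finite_induct) (auto simp: one_pCons mult_ac)
    moreover have "(\<Prod>k\<in>?A - S. monom 1 1 :: 'a poly) = monom 1 (card (?A - S))"
      by (simp add: monom_power)
    ultimately show "(\<Prod>k\<in>S. [:c k:]) * (\<Prod>k\<in>?A - S. monom 1 1) = monom (\<Prod>k\<in>S. c k) (card (?A - S))"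
      by (simp add: smult_monom)
  qed
  finally have "coeff (\<Prod>k\<in>?A. [:c k, 1:]) t =
      (\<Sum>S\<in>Pow ?A. if card (?A - S) = t then \<Prod>k\<in>S. c k else 0)"
    by (simp add: coeff_sum)
  also have "\<dots> = (\<Sum>S | S \<subseteq> ?A \<and> card S = n. \<Prod>k\<in>S. c k)"
  proof (rule sum.mono_neutral_cong_right)
    have *: "card (?A - S) = n + t - card S" "card S \<le> n + t" if "S \<subseteq> ?A" for S
      using that card_mono[OF _ that] by (auto simp: card_Diff_subset finite_subset)
    show "\<forall>S\<in>Pow ?A - {S. S \<subseteq> ?A \<and> card S = n}.
        (if card (?A - S) = t then \<Prod>k\<in>S. c k else 0) = 0"
    proof
      fix S assume "S \<in> Pow ?A - {S. S \<subseteq> ?A \<and> card S = n}"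
      then have "S \<subseteq> ?A" "card S \<noteq> n" by auto
      then have "card (?A - S) \<noteq> t" using *[of S] by linarith
      then show "(if card (?A - S) = t then \<Prod>k\<in>S. c k else 0) = 0" by simp
    qed
    show "(if card (?A - S) = t then \<Prod>k\<in>S. c k else 0) = (\<Prod>k\<in>S. c k)"
      if "S \<in> {S. S \<subseteq> ?A \<and> card S = n}" for S
      using *[of S] that by simp
  qed auto
  also have "\<dots> = (\<Sum>\<kappa>\<in>inc_tuples n ?A. \<Prod>k\<in>\<kappa> ` {..<n}. c k)"
    by (rule sum.reindex_bij_betw[symmetric, OF bij_betw_inc_tuples_subsets]) simp
  also have "\<dots> = (\<Sum>\<kappa>\<in>inc_tuples n ?A. \<Prod>i<n. c (\<kappa> i))"
    by (intro sum.cong refl) (simp add: prod.reindex inc_tuples_inj)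
  finally show ?thesis .
qed

section \<open>Matchings and integer cuts\<close>

text \<open>A bijection is presented as a relation: each object is built from its partner
  separately, and uniqueness of partners replaces the check that two maps are mutually
  inverse.\<close>

lemma card_eq_if_matching:
  assumes "\<And>a. a \<in> A \<Longrightarrow> \<exists>b\<in>B. R a b" and "\<And>b. b \<in> B \<Longrightarrow> \<exists>a\<in>A. R a b"
    and "\<And>a b b'. a \<in> A \<Longrightarrow> b \<in> B \<Longrightarrow> b' \<in> B \<Longrightarrow> R a b \<Longrightarrow> R a b' \<Longrightarrow> b = b'"
    and "\<And>a a' b. a \<in> A \<Longrightarrow> a' \<in> A \<Longrightarrow> b \<in> B \<Longrightarrow> R a b \<Longrightarrow> R a' b \<Longrightarrow> a = a'"
  shows "card A = card B"
proof -
  obtain f where f: "\<And>a. a \<in> A \<Longrightarrow> f a \<in> B \<and> R a (f a)"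
    using assms(1) by metis
  have "bij_betw f A B"
    unfolding bij_betw_def
  proof (intro conjI inj_onI equalityI subsetI)
    fix a a' assume "a \<in> A" "a' \<in> A" "f a = f a'"
    then show "a = a'" using assms(4)[of a a' "f a"] f[of a] f[of a'] by simp
  next
    fix b assume "b \<in> f ` A" then show "b \<in> B" using f by auto
  next
    fix b assume b: "b \<in> B"
    then obtain a where a: "a \<in> A" "R a b" using assms(2) by blast
    then have "f a = b" using assms(3)[of a "f a" b] f[of a] b by simp
    then show "b \<in> f ` A" using a by blast
  qed
  then show ?thesis by (rule bij_betw_same_card)
qed

text \<open>Turns the trace of an order ideal on a line into a number. It is applied along columns,
  along horizontal diagonals and along space diagonals, once for each reading of the ideal.\<close>

lemma int_cut_exists:
  fixes P :: "int \<Rightarrow> bool"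
  assumes step: "\<And>z. P (z + 1) \<Longrightarrow> P z" and lo: "P lo" and hi: "\<not> P hi"
  shows "\<exists>t. \<forall>z. P z \<longleftrightarrow> z \<le> t"
proof -
  have down: "P (z - int k)" if "P z" for z k
    using that by (induction k) (auto intro: step simp: algebra_simps)
  have mono: "P z'" if "P z" "z' \<le> z" for z z'
    using down[OF that(1), of "nat (z - z')"] that(2) by simp
  have bound: "z < hi" if "P z" for z using mono[OF that, of hi] hi by linarith
  define t where "t = lo + int (GREATEST k. P (lo + int k))"
  have P0: "P (lo + int 0)" using lo by simp
  have le: "k \<le> nat (hi - lo)" if "P (lo + int k)" for k using bound[OF that] by linarith
  have "P t" unfolding t_def by (rule GreatestI_nat[of "\<lambda>k. P (lo + int k)", OF P0 le])
  moreover have "z \<le> t" if "P z" for z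
  proof (cases "lo \<le> z")
    case True
    then have "P (lo + int (nat (z - lo)))" using that by simp
    then have "nat (z - lo) \<le> (GREATEST k. P (lo + int k))"
      by (rule Greatest_le_nat[of "\<lambda>k. P (lo + int k)", OF _ le])
    then show ?thesis using True unfolding t_def by linarith
  qed (simp add: t_def)
  ultimately show ?thesis using mono by blast
qed

section \<open>Cylindric partitions as order ideals\<close>

text \<open>\<open>D x y z\<close> says that the column of unit cubes over the cell with corner \<open>(x, y)\<close> reaches height
  \<open>z\<close>, where heights run from \<open>-n\<close> to \<open>0\<close>.  The cell in row \<open>i\<close> and column \<open>c\<close> of the partition has
  \<open>(x, y) = (i, c - m + 1)\<close>, and its entry is the column height plus \<open>n\<close>.\<close>

definition cyl_ideals :: "nat \<Rightarrow> nat \<Rightarrow> nat \<Rightarrow> (int \<Rightarrow> int \<Rightarrow> int \<Rightarrow> bool) set" where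
  "cyl_ideals m n s = {D.
     (\<forall>x y z. D (x + 1) y z \<longrightarrow> D x y z) \<and>
     (\<forall>x y z. D x (y + 1) z \<longrightarrow> D x y z) \<and>
     (\<forall>x y z. D x y (z + 1) \<longrightarrow> D x y z) \<and>
     (\<forall>x y z. D x y z \<longrightarrow> z \<le> 0) \<and>
     (\<forall>x y z. x + y < 0 \<longrightarrow> z \<le> 0 \<longrightarrow> D x y z) \<and>
     (\<forall>x y z. z \<le> - int n \<longrightarrow> D x y z) \<and>
     (\<forall>x y z. D x y z \<longrightarrow> int s \<le> x + y \<longrightarrow> z \<le> - int n) \<and>
     (\<forall>x y z. D (x + int m) (y - int m) z \<longleftrightarrow> D x y z)}"

lemma cyl_idealsD:
  assumes "D \<in> cyl_ideals m n s"
  shows "D (x + 1) y z \<Longrightarrow> D x y z" "D x (y + 1) z \<Longrightarrow> D x y z" "D x y (z + 1) \<Longrightarrow> D x y z"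
    "D x y z \<Longrightarrow> z \<le> 0" "x + y < 0 \<Longrightarrow> z \<le> 0 \<Longrightarrow> D x y z" "z \<le> - int n \<Longrightarrow> D x y z"
    "D x y z \<Longrightarrow> int s \<le> x + y \<Longrightarrow> z \<le> - int n"
    "D (x + int m) (y - int m) z \<longleftrightarrow> D x y z"
proof -
  note * = assms[unfolded cyl_ideals_def mem_Collect_eq]
  note r = conjunct2
  show "D (x + 1) y z \<Longrightarrow> D x y z" by (rule *[THEN conjunct1, rule_format])
  show "D x (y + 1) z \<Longrightarrow> D x y z" by (rule *[THEN r, THEN conjunct1, rule_format])
  show "D x y (z + 1) \<Longrightarrow> D x y z" by (rule *[THEN r, THEN r, THEN conjunct1, rule_format])
  show "D x y z \<Longrightarrow> z \<le> 0" by (rule *[THEN r, THEN r, THEN r, THEN conjunct1, rule_format])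
  show "x + y < 0 \<Longrightarrow> z \<le> 0 \<Longrightarrow> D x y z"
    by (rule *[THEN r, THEN r, THEN r, THEN r, THEN conjunct1, rule_format])
  show "z \<le> - int n \<Longrightarrow> D x y z"
    by (rule *[THEN r, THEN r, THEN r, THEN r, THEN r, THEN conjunct1, rule_format])
  show "D x y z \<Longrightarrow> int s \<le> x + y \<Longrightarrow> z \<le> - int n"
    by (rule *[THEN r, THEN r, THEN r, THEN r, THEN r, THEN r, THEN conjunct1, rule_format])
  show "D (x + int m) (y - int m) z \<longleftrightarrow> D x y z"
    by (rule *[THEN r, THEN r, THEN r, THEN r, THEN r, THEN r, THEN r, rule_format])
qed

lemma cyl_ideals_antimono:
  assumes D: "D \<in> cyl_ideals m n s" and *: "D x y z" "x' \<le> x" "y' \<le> y" "z' \<le> z"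
  shows "D x' y' z'"
proof -
  have a: "D (x - int k) y z" if "D x y z" for x y z k
    using that by (induction k) (auto intro: cyl_idealsD(1)[OF D] simp: algebra_simps)
  have b: "D x (y - int k) z" if "D x y z" for x y z k
    using that by (induction k) (auto intro: cyl_idealsD(2)[OF D] simp: algebra_simps)
  have c: "D x y (z - int k)" if "D x y z" for x y z k
    using that by (induction k) (auto intro: cyl_idealsD(3)[OF D] simp: algebra_simps)
  show ?thesis
    using a[OF b[OF c[OF *(1), of "nat (z - z')"], of "nat (y - y')"], of "nat (x - x')"] * by simp
qed

text \<open>The two lists are (s + m - 1, ..., s) and (m - 1, ..., 0), so row \<open>i\<close>
  occupies the columns from m - 1 - i to s + m - 2 - i. With x = i and y = c - m + 1 this is the
  strip 0 \<le> x + y < s.\<close>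

lemma skew_cells_staircase:
  "skew_cells (rev [s..<s + m]) (rev [0..<m]) =
     {(i, c). i < m \<and> 0 \<le> int i + (int c - int m + 1) \<and> int i + (int c - int m + 1) < int s}"
  by (auto simp: skew_cells_def row_length_def rev_nth)

text \<open>The copied bottom row is the row x = -1, and its displacement by \<open>m\<close>
  columns is the translation by (m, -m). Thus the additional property of cylindric partitions is
  monotonicity across the border of a period.\<close>

lemma card_bounded_cylindric_partitions:
  assumes m: "m \<ge> 1"
  shows "card (bounded_cylindric_partitions (rev [s..<s + m]) (rev [0..<m]) m n) = card (cyl_ideals m n s)"
proof -
  let ?C = "skew_cells (rev [s..<s + m]) (rev [0..<m])"
  let ?E = "extended_cells (rev [s..<s + m]) (rev [0..<m]) m"
  let ?A = "extended_array (rev [s..<s + m]) m"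
  let ?P = "bounded_cylindric_partitions (rev [s..<s + m]) (rev [0..<m]) m n"
  define R where "R = (\<lambda>(T :: nat \<times> nat \<Rightarrow> nat) (D :: int \<Rightarrow> int \<Rightarrow> int \<Rightarrow> bool).
    \<forall>i c z. (i, c) \<in> ?C \<longrightarrow> (D (int i) (int c - int m + 1) z \<longleftrightarrow> z + int n \<le> int (T (i, c))))"
  show ?thesis
  proof (rule card_eq_if_matching[of _ _ R])
    fix T assume T: "T \<in> ?P"
    have row: "T (i, j') \<le> T (i, j)" if "(i, j) \<in> ?C" "(i, j') \<in> ?C" "j \<le> j'" for i j j'
      using T that unfolding bounded_cylindric_partitions_def cylindric_partitions_def by blast
    have col: "T (i', j) \<le> T (i, j)" if "(i, j) \<in> ?C" "(i', j) \<in> ?C" "i \<le> i'" for i i' j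
      using T that unfolding bounded_cylindric_partitions_def cylindric_partitions_def by blast
    have ext: "?A T (i', j) \<le> ?A T (i, j)" if "(i, j) \<in> ?E" "(i', j) \<in> ?E" "i \<le> i'" for i i' j
      using T that unfolding bounded_cylindric_partitions_def cylindric_partitions_def by blast
    have wrap: "T (0, c + m) \<le> T (m - 1, c)" if "(m - 1, c) \<in> ?C" "(0, c + m) \<in> ?C" for c
    proof -
      have "(0, c + m) \<in> ?E" using that(1) by (auto simp: extended_cells_def)
      moreover have "(Suc 0, c + m) \<in> ?E" using that(2) by (auto simp: extended_cells_def)
      ultimately show ?thesis using ext[of 0 "c + m" "Suc 0"] by (simp add: extended_array_def)
    qed
    have bound: "T c \<le> n" if "c \<in> ?C" for c
      using T that unfolding bounded_cylindric_partitions_def by blast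
    \<comment> \<open>The cell that represents (x, y) modulo (m, -m): the row is x reduced modulo m,
      and the column keeps x + y.\<close>
    define cell where "cell = (\<lambda>x y. (nat (x mod int m), nat (x + y - x mod int m + int m - 1)))"
    have mod: "0 \<le> x mod int m" "x mod int m < int m" for x using m by auto
    have cell: "cell x y \<in> ?C" if "0 \<le> x + y" "x + y < int s" for x y
      using that mod[of x] by (auto simp: cell_def skew_cells_staircase)
    have Tx: "T (cell (x + 1) y) \<le> T (cell x y)" if xy: "0 \<le> x + y" "x + y + 1 < int s" for x y
    proof (cases "x mod int m + 1 < int m")
      case True
      then have "(x + 1) mod int m = x mod int m + 1"
        using mod_pos_pos_trivial[of "x mod int m + 1" "int m"] mod[of x] by (simp add: mod_add_left_eq)
      then show ?thesis
        using col[of "fst (cell x y)" "snd (cell x y)" "fst (cell (x + 1) y)"] cell[of x y] cell[of "x + 1" y] xy mod[of x]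
        by (auto simp: cell_def algebra_simps)
    next
      case False
      \<comment> \<open>Here x + 1 returns to row 0, and the column index rises by \<open>m\<close>,
        exactly as in the copied row.\<close>
      then have r: "x mod int m = int m - 1" using mod[of x] by linarith
      have "(x + 1) mod int m = (x mod int m + 1) mod int m" by (simp add: mod_add_left_eq)
      then have r': "(x + 1) mod int m = 0" using r by simp
      have "cell x y = (m - 1, nat (x + y))" "cell (x + 1) y = (0, nat (x + y) + m)"
        unfolding cell_def r r' using xy m nat_add_distrib[of "x + y" "int m"] by (auto simp: add_ac)
      then show ?thesis using wrap[of "nat (x + y)"] cell[of x y] cell[of "x + 1" y] xy by auto
    qed
    have Ty: "T (cell x (y + 1)) \<le> T (cell x y)" if xy: "0 \<le> x + y" "x + y + 1 < int s" for x y
      using row[of "fst (cell x y)" "snd (cell x y)" "snd (cell x (y + 1))"] cell[of x y] cell[of x "y + 1"] xy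
      by (auto simp: cell_def algebra_simps)
    define D where "D = (\<lambda>x y z. z \<le> 0 \<and>
      (x + y < 0 \<or> z \<le> - int n \<or> (x + y < int s \<and> z + int n \<le> int (T (cell x y)))))"
    have "D \<in> cyl_ideals m n s"
      unfolding cyl_ideals_def
    proof (intro CollectI conjI allI impI)
      fix x y z
      show "D x y z" if "D (x + 1) y z"
        using that Tx[of x y] unfolding D_def by (cases "x + y < 0") (auto simp: algebra_simps)
      show "D x y z" if "D x (y + 1) z"
        using that Ty[of x y] unfolding D_def by (cases "x + y < 0") (auto simp: algebra_simps)
      show "D (x + int m) (y - int m) z = D x y z"
        unfolding D_def by (simp add: cell_def algebra_simps)
    qed (auto simp: D_def)
    moreover have "R T D"
      unfolding R_def
    proof (intro allI impI)
      fix i c z assume ic: "(i, c) \<in> ?C"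
      then have "i < m" by (auto simp: skew_cells_staircase)
      then have "cell (int i) (int c - int m + 1) = (i, c)" by (simp add: cell_def)
      then show "D (int i) (int c - int m + 1) z \<longleftrightarrow> z + int n \<le> int (T (i, c))"
        using ic bound[OF ic] by (auto simp: D_def skew_cells_staircase)
    qed
    ultimately show "\<exists>D\<in>cyl_ideals m n s. R T D" by blast
  next
    fix D assume D: "D \<in> cyl_ideals m n s"
    have "\<exists>t. \<forall>z. D x y z \<longleftrightarrow> z \<le> t" for x y
    proof (rule int_cut_exists)
      show "D x y z" if "D x y (z + 1)" for z using that by (rule cyl_idealsD(3)[OF D])
      show "D x y (- int n)" by (rule cyl_idealsD(6)[OF D]) simp
      show "\<not> D x y 1" using cyl_idealsD(4)[OF D, of x y 1] by auto
    qed
    then obtain t where t: "\<And>x y z. D x y z \<longleftrightarrow> z \<le> t x y" by metis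
    have tb: "- int n \<le> t x y" "t x y \<le> 0" for x y
      using cyl_idealsD(6)[OF D, of "- int n" x y] cyl_idealsD(4)[OF D, of x y "t x y"] by (auto simp: t)
    have anti: "t x y \<le> t x' y'" if "x' \<le> x" "y' \<le> y" for x y x' y'
      using cyl_ideals_antimono[OF D _ that, of "t x y" "t x y"] by (simp add: t)
    have per: "t (x + int m) (y - int m) = t x y" for x y
      using cyl_idealsD(8)[OF D, of x y] unfolding t by (metis order_refl order_antisym)
    define T where "T = (\<lambda>p\<in>?C. nat (t (int (fst p)) (int (snd p) - int m + 1) + int n))"
    have T: "int (T (i, c)) = t (int i) (int c - int m + 1) + int n" if "(i, c) \<in> ?C" for i c
      using that tb[of "int i" "int c - int m + 1"] by (simp add: T_def)
    have "T \<in> ?P"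
      unfolding bounded_cylindric_partitions_def cylindric_partitions_def
    proof (intro CollectI conjI allI impI ballI)
      fix c assume "c \<in> ?C" then show "T c \<le> n"
        using T[of "fst c" "snd c"] tb(2)[of "int (fst c)" "int (snd c) - int m + 1"] by auto
    next
      show "T \<in> extensional ?C" by (simp add: T_def)
    next
      fix i j j' assume *: "(i, j) \<in> ?C" "(i, j') \<in> ?C" "j \<le> j'"
      then have "int (T (i, j')) \<le> int (T (i, j))" unfolding T[OF *(1)] T[OF *(2)] by (simp add: anti)
      then show "T (i, j') \<le> T (i, j)" by simp
    next
      fix i i' j assume *: "(i, j) \<in> ?C" "(i', j) \<in> ?C" "i \<le> i'"
      then have "int (T (i', j)) \<le> int (T (i, j))" unfolding T[OF *(1)] T[OF *(2)] by (simp add: anti)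
      then show "T (i', j) \<le> T (i, j)" by simp
    next
      fix i i' j assume *: "(i, j) \<in> ?E" "(i', j) \<in> ?E" "i \<le> i'"
      have A: "int (?A T (i, j)) = t (int i - 1) (int j - int m + 1) + int n" if e: "(i, j) \<in> ?E" for i j
      proof (cases i)
        case 0
        then obtain k where k: "j = k + m" "(m - 1, k) \<in> ?C" using e by (auto simp: extended_cells_def)
        show ?thesis
          using T[OF k(2)] per[of "-1" "int k + 1"] 0 k(1) m
          by (simp add: extended_array_def of_nat_diff algebra_simps)
      next
        case (Suc l)
        then have "(l, j) \<in> ?C" using that by (auto simp: extended_cells_def)
        then show ?thesis using T Suc by (simp add: extended_array_def)
      qed
      have "int (?A T (i', j)) \<le> int (?A T (i, j))" unfolding A[OF *(1)] A[OF *(2)] using *(3) by (simp add: anti)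
      then show "?A T (i', j) \<le> ?A T (i, j)" by simp
    qed
    moreover have "R T D" unfolding R_def using T by (simp add: t)
    ultimately show "\<exists>T\<in>?P. R T D" by blast
  next
    fix T D D' assume D: "D \<in> cyl_ideals m n s" and D': "D' \<in> cyl_ideals m n s" and R: "R T D" "R T D'"
    have eq0: "D x y z = D' x y z" if "0 \<le> x" "x < int m" for x y z
    proof (cases "0 \<le> x + y \<and> x + y < int s")
      case True
      then have *: "(nat x, nat (y + int m - 1)) \<in> ?C" "int (nat (y + int m - 1)) = y + int m - 1"
        using that by (auto simp: skew_cells_staircase)
      then show ?thesis using R that unfolding R_def by force
    next
      case False
      then show ?thesis
        using cyl_idealsD(4-7)[OF D, of x y z] cyl_idealsD(4-7)[OF D', of x y z]
          cyl_idealsD(6)[OF D, of z x y] cyl_idealsD(6)[OF D', of z x y] by linarith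
    qed
    have shift: "E (x + int m * k) (y - int m * k) z = E x y z" if E: "E \<in> cyl_ideals m n s" for E x y z k
    proof (induction k arbitrary: x y rule: int_induct[of _ 0])
      case (step1 i)
      then show ?case using cyl_idealsD(8)[OF E, of "x + int m * i" "y - int m * i" z] by (simp add: algebra_simps)
    next
      case (step2 i)
      then show ?case using cyl_idealsD(8)[OF E, of "x + int m * (i - 1)" "y - int m * (i - 1)" z] by (simp add: algebra_simps)
    qed simp
    have "D x y z = D' x y z" for x y z
    proof -
      have "D x y z = D (x mod int m) (y + int m * (x div int m)) z" "D' x y z = D' (x mod int m) (y + int m * (x div int m)) z"
        using shift[OF D, of x "- (x div int m)" y z] shift[OF D', of x "- (x div int m)" y z]
        by (simp_all add: minus_mult_div_eq_mod)
      then show ?thesis using eq0[of "x mod int m"] m by simp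
    qed
    then show "D = D'" by blast
  next
    fix T T' D assume T: "T \<in> ?P" "T' \<in> ?P" and R: "R T D" "R T' D"
    have "T p = T' p" if "p \<in> ?C" for p
    proof -
      obtain i c where p: "p = (i, c)" by (cases p)
      have "z + int n \<le> int (T p) \<longleftrightarrow> z + int n \<le> int (T' p)" for z
        using R that unfolding R_def p by blast
      from this[of "int (T p) - int n"] this[of "int (T' p) - int n"] show ?thesis by simp
    qed
    then show "T = T'"
      using T by (auto intro!: extensionalityI[of _ ?C] simp: bounded_cylindric_partitions_def cylindric_partitions_def)
  qed
qed

section \<open>Walkers\<close>

definition closed_walks :: "nat \<Rightarrow> nat \<Rightarrow> nat \<Rightarrow> (nat \<Rightarrow> nat) list set" where
  "closed_walks m n j = (\<Union>f\<in>inc_tuples n (sites j 0). tuple_walks n j (2 * m) f f)"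

lemma closed_walks_iff:
  "cs \<in> closed_walks m n j \<longleftrightarrow> length cs = Suc (2 * m) \<and> cs ! (2 * m) = cs ! 0 \<and>
     (\<forall>u\<le>2 * m. cs ! u \<in> inc_tuples n (sites j u)) \<and> (\<forall>u<2 * m. tuple_step n (cs ! u) (cs ! Suc u))"
  by (auto simp: closed_walks_def tuple_walks_def)

lemma card_closed_walks:
  "card (closed_walks m n j) = (\<Sum>f\<in>inc_tuples n (sites j 0). card (tuple_walks n j (2 * m) f f))"
  unfolding closed_walks_def
  by (intro card_UN_disjoint) (auto simp: finite_inc_tuples finite_tuple_walks, auto simp: tuple_walks_def)

text \<open>The walker with index \<open>i\<close> traces the boundary of the ideal at height \<open>-i\<close>, at time
  \<open>x - y + 1\<close> modulo \<open>2 m\<close>.  Its position is the largest \<open>x + y + 2\<close> in the ideal, rounded up to the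
  parity of the time, plus \<open>2 i\<close>, which turns the weak order of the levels into a strict one.\<close>

lemma card_cyl_ideals:
  assumes m: "m \<ge> 1"
  shows "card (cyl_ideals m n s) = card (closed_walks m n (2 * n + s))"
proof -
  let ?W = "closed_walks m n (2 * n + s)"
  define R where "R = (\<lambda>(D :: int \<Rightarrow> int \<Rightarrow> int \<Rightarrow> bool) (cs :: (nat \<Rightarrow> nat) list).
    \<forall>x y i. i < n \<longrightarrow> (D x y (- int i) \<longleftrightarrow>
      x + y + 2 + 2 * int i \<le> int ((cs ! nat ((x - y + 1) mod (2 * int m))) i)))"
  show ?thesis
  proof (rule card_eq_if_matching[of _ _ R])
    fix D assume D: "D \<in> cyl_ideals m n s"
    \<comment> \<open>Level -i and time u select the line x - y + 1 = u, which is traversed in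
      direction (1, 1, 0).\<close>
    have "\<exists>t. \<forall>k. D k (k + 1 - u) (- int i) \<longleftrightarrow> k \<le> t" if "i < n" for u i
    proof (rule int_cut_exists)
      show "D k (k + 1 - u) (- int i)" if "D (k + 1) (k + 1 + 1 - u) (- int i)" for k
        using cyl_ideals_antimono[OF D that, of k "k + 1 - u" "- int i"] by simp
      show "D (- 1 - \<bar>u\<bar>) (- 1 - \<bar>u\<bar> + 1 - u) (- int i)"
        by (rule cyl_idealsD(5)[OF D]) auto
      show "\<not> D (int s + \<bar>u\<bar>) (int s + \<bar>u\<bar> + 1 - u) (- int i)"
        using cyl_idealsD(7)[OF D, of "int s + \<bar>u\<bar>" "int s + \<bar>u\<bar> + 1 - u" "- int i"] that by auto
    qed
    note cut = this
    define t where "t = (\<lambda>u i. SOME t. \<forall>k. D k (k + 1 - u) (- int i) \<longleftrightarrow> k \<le> t)"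
    have t: "D k (k + 1 - u) (- int i) \<longleftrightarrow> k \<le> t u i" if "i < n" for u i k
      using someI_ex[OF cut[OF that, of u]] unfolding t_def by blast
    \<comment> \<open>The largest x + y on the line is 2 t + 1 - u. Adding 2 + 2 i leaves the parity
      opposite to that of u, and the further 1 rounds up.\<close>
    define C where "C = (\<lambda>u i. 2 * t u i + 4 - u + 2 * int i)"
    have DC: "D x y (- int i) \<longleftrightarrow> x + y + 2 + 2 * int i \<le> C (x - y + 1) i" if "i < n" for x y i
      using t[OF that, of x "x - y + 1"] unfolding C_def by auto
    have lo: "1 + 2 * int i \<le> C u i" if "i < n" for u i
    proof -
      \<comment> \<open>The last point of the line with x + y < 0, where the ideal is
        prescribed.\<close>
      have "D ((u - 2) div 2) ((u - 2) div 2 + 1 - u) (- int i)"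
        by (rule cyl_idealsD(5)[OF D]) auto
      then show ?thesis using t[OF that] unfolding C_def by force
    qed
    \<comment> \<open>For the last level, i = n - 1, this bound is the last site 2 n + s.\<close>
    have hi: "C u i \<le> int s + 2 + 2 * int i" if "i < n" for u i
      using cyl_idealsD(7)[OF D, of "t u i" "t u i + 1 - u" "- int i"] t[OF that, of "t u i" u] that
      unfolding C_def by force
    have step: "C (u + 1) i = C u i + 1 \<or> C (u + 1) i = C u i - 1" if "i < n" for u i
    proof -
      have "D (t u i) (t u i + 1 - (u + 1)) (- int i)"
        using t[OF that, of "t u i" u] cyl_ideals_antimono[OF D, of "t u i" "t u i + 1 - u" "- int i"] by simp
      then have "t u i \<le> t (u + 1) i" using t[OF that] by blast
      moreover have "D (t (u + 1) i - 1) (t (u + 1) i - 1 + 1 - u) (- int i)"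
        using t[OF that, of "t (u + 1) i" "u + 1"] cyl_ideals_antimono[OF D, of "t (u + 1) i" "t (u + 1) i + 1 - (u + 1)" "- int i"] by simp
      then have "t (u + 1) i - 1 \<le> t u i" using t[OF that] by blast
      ultimately show ?thesis unfolding C_def by auto
    qed
    have inc: "C u i + 2 \<le> C u (Suc i)" if "Suc i < n" for u i
    proof -
      have "D (t u i) (t u i + 1 - u) (- int (Suc i))"
        using t[of i "t u i" u] that cyl_ideals_antimono[OF D, of "t u i" "t u i + 1 - u" "- int i"] by simp
      then have "t u i \<le> t u (Suc i)" using t[OF that] by blast
      then show ?thesis unfolding C_def by simp
    qed
    have per: "C (u + 2 * int m) i = C u i" if "i < n" for u i
    proof -
      \<comment> \<open>Translation by (m, -m) raises the time by 2 m and the cut by m, and these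
        cancel in \<open>C\<close>.\<close>
      have *: "k \<le> t (u + 2 * int m) i \<longleftrightarrow> k - int m \<le> t u i" for k
        using t[OF that, of k "u + 2 * int m"] t[OF that, of "k - int m" u]
          cyl_idealsD(8)[OF D, of "k - int m" "k - int m + 1 - u" "- int i"] by (simp add: algebra_simps)
      from *[of "t (u + 2 * int m) i"] *[of "t u i + int m"] have "t (u + 2 * int m) i = t u i + int m" by simp
      then show ?thesis unfolding C_def by simp
    qed
    have permod: "C (u mod (2 * int m)) i = C u i" if "i < n" for u i
    proof -
      have "C (v + 2 * int m * k) i = C v i" for v k
      proof (induction k rule: int_induct[of _ 0])
        case (step1 k)
        then show ?case using per[OF that, of "v + 2 * int m * k"] by (simp add: algebra_simps)
      next
        case (step2 k)
        then show ?case using per[OF that, of "v + 2 * int m * (k - 1)"] by (simp add: algebra_simps)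
      qed simp
      from this[of u "- (u div (2 * int m))"] show ?thesis by (simp add: minus_mult_div_eq_mod)
    qed
    define cs where "cs = map (\<lambda>u. \<lambda>i\<in>{..<n}. nat (C (int u) i)) [0..<Suc (2 * m)]"
    have len: "length cs = Suc (2 * m)" by (simp add: cs_def)
    have nth: "int ((cs ! u) i) = C (int u) i" if "u \<le> 2 * m" "i < n" for u i
    proof -
      have "(cs ! u) i = nat (C (int u) i)" using that by (simp add: cs_def del: upt_Suc)
      then show ?thesis using lo[OF that(2), of "int u"] by simp
    qed
    have "cs \<in> ?W"
      unfolding closed_walks_iff
    proof (intro conjI allI impI len)
      show "cs ! (2 * m) = cs ! 0"
        using per[of _ 0] by (auto simp: cs_def simp del: upt_Suc)
    next
      fix u assume u: "u \<le> 2 * m"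
      have "C (int u) i < C (int u) k" if "i < k" "k < n" for i k
        using that
      proof (induction k)
        case (Suc k)
        then show ?case using inc[of k "int u"] by (cases "i = k") auto
      qed simp
      then have "(cs ! u) i < (cs ! u) k" if "i < k" "k < n" for i k
        using that nth[OF u, of i] nth[OF u, of k] by force
      moreover have "(cs ! u) i \<in> sites (2 * n + s) u" if "i < n" for i
      proof -
        have "even (C (int u) i + int u)" by (simp add: C_def)
        then have "even (int ((cs ! u) i + u))" using nth[OF u that] by simp
        then have "even ((cs ! u) i + u)" by (simp only: even_of_nat)
        then show ?thesis
          using nth[OF u that] lo[OF that, of "int u"] hi[OF that, of "int u"] that by (simp add: sites_def)
      qed
      moreover have "(cs ! u) \<in> extensional {..<n}" using u by (simp add: cs_def del: upt_Suc)
      ultimately show "cs ! u \<in> inc_tuples n (sites (2 * n + s) u)"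
        by (auto simp: inc_tuples_def strict_mono_on_def PiE_def)
    next
      fix u assume u: "u < 2 * m"
      show "tuple_step n (cs ! u) (cs ! Suc u)"
        unfolding tuple_step_def
      proof (intro allI impI)
        fix i assume i: "i < n"
        show "(cs ! u) i = Suc ((cs ! Suc u) i) \<or> (cs ! Suc u) i = Suc ((cs ! u) i)"
          using step[OF i, of "int u"] nth[OF _ i, of u] nth[OF _ i, of "Suc u"] u by (simp add: add.commute) linarith
      qed
    qed
    moreover have "R D cs"
      unfolding R_def
    proof (intro allI impI)
      fix x y i assume i: "i < n"
      have u: "0 \<le> (x - y + 1) mod (2 * int m)" "(x - y + 1) mod (2 * int m) < 2 * int m" using m by simp_all
      then have "int ((cs ! nat ((x - y + 1) mod (2 * int m))) i) = C ((x - y + 1) mod (2 * int m)) i"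
        using nth[OF _ i, of "nat ((x - y + 1) mod (2 * int m))"] by simp
      then show "D x y (- int i) \<longleftrightarrow> x + y + 2 + 2 * int i \<le> int ((cs ! nat ((x - y + 1) mod (2 * int m))) i)"
        using DC[OF i, of x y] permod[OF i] by simp
    qed
    ultimately show "\<exists>cs\<in>?W. R D cs" by blast
  next
    fix cs assume cs: "cs \<in> ?W"
    define C where "C = (\<lambda>u i. int ((cs ! nat (u mod (2 * int m))) i))"
    have mod: "0 \<le> u mod (2 * int m)" "u mod (2 * int m) < 2 * int m" for u using m by simp_all
    then have le: "nat (u mod (2 * int m)) < 2 * m" for u by (simp add: nat_less_iff)
    have tup: "cs ! nat (u mod (2 * int m)) \<in> inc_tuples n (sites (2 * n + s) (nat (u mod (2 * int m))))" for u
      using cs le[of u] by (simp add: closed_walks_iff)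
    have site: "1 \<le> C u i \<and> C u i \<le> 2 * int n + int s \<and> even (C u i + u)" if "i < n" for u i
    proof -
      let ?p = "(cs ! nat (u mod (2 * int m))) i" and ?v = "nat (u mod (2 * int m))"
      have *: "?p \<in> sites (2 * n + s) ?v"
        using inc_tuples_mem[OF tup that] .
      then have "even (?p + ?v)" by (simp add: sites_def)
      then have "even (int (?p + ?v))" by (simp only: even_of_nat)
      moreover have "int (?p + ?v) = C u i + u mod (2 * int m)" using mod by (simp add: C_def)
      ultimately have "even (C u i + u mod (2 * int m))" by (simp only:)
      then have "even (C u i + u)" by (metis dvd_mod_iff dvd_triv_left even_add)
      then show ?thesis using * by (auto simp: C_def sites_def)
    qed
    have inc: "C u i + 2 \<le> C u (Suc i)" if "Suc i < n" for u i
    proof -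
      have "C u i < C u (Suc i)"
        using inc_tuples_less[OF tup, of i "Suc i" u] that by (simp add: C_def)
      moreover have "even (C u i + u)" "even (C u (Suc i) + u)" using site that by auto
      ultimately show ?thesis by presburger
    qed
    have lo: "1 + 2 * int i \<le> C u i" if "i < n" for u i
      using that
    proof (induction i)
      case 0 then show ?case using site by simp
    next
      case (Suc i) then show ?case using inc[of i u] by simp
    qed
    have hi: "C u i \<le> int s + 2 + 2 * int i" if "i < n" for u i
    proof -
      \<comment> \<open>Each of the n - 1 - i walkers beyond this one uses up at least two more
        sites before the end of the path.\<close>
      have "C u i + 2 * int k \<le> C u (i + k)" if "i + k < n" for k
        using that
      proof (induction k)
        case (Suc k) then show ?case using inc[of "i + k" u] by simp
      qed simp
      from this[of "n - 1 - i"] site[of "n - 1" u] that show ?thesis by (simp add: of_nat_diff)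
    qed
    have step: "C (u + 1) i = C u i + 1 \<or> C (u + 1) i = C u i - 1" if "i < n" for u i
    proof -
      let ?v = "nat (u mod (2 * int m))"
      have "tuple_step n (cs ! ?v) (cs ! Suc ?v)"
        using cs le[of u] by (simp add: closed_walks_iff)
      moreover have "cs ! nat ((u + 1) mod (2 * int m)) = cs ! Suc ?v"
      proof (cases "u mod (2 * int m) + 1 < 2 * int m")
        case True
        then have "(u + 1) mod (2 * int m) = u mod (2 * int m) + 1"
          using mod_pos_pos_trivial[of "u mod (2 * int m) + 1" "2 * int m"] mod[of u] by (simp add: mod_add_left_eq)
        then show ?thesis using mod[of u] by (simp add: nat_add_distrib)
      next
        case False
        then have r: "u mod (2 * int m) = 2 * int m - 1" using mod[of u] by linarith
        have "(u + 1) mod (2 * int m) = (u mod (2 * int m) + 1) mod (2 * int m)" by (simp add: mod_add_left_eq)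
        then have "(u + 1) mod (2 * int m) = 0" using r by simp
        moreover have "Suc ?v = 2 * m" using r m by simp
        ultimately show ?thesis using cs by (simp add: closed_walks_iff)
      qed
      ultimately show ?thesis using that by (auto simp: C_def tuple_step_def)
    qed
    have per: "C (u + 2 * int m) i = C u i" for u i by (simp add: C_def)
    define D where "D = (\<lambda>x y z. z \<le> - int n \<or>
      (z \<le> 0 \<and> x + y + 2 - 2 * z \<le> C (x - y + 1) (nat (- z))))"
    have "D \<in> cyl_ideals m n s"
      unfolding cyl_ideals_def
    proof (intro CollectI conjI allI impI)
      fix x y z
      show "D x y z" if "D (x + 1) y z"
      proof (cases "z \<le> - int n")
        case False
        then have "nat (- z) < n" using that unfolding D_def by auto
        then show ?thesis using that False step[of "nat (- z)" "x - y + 1"] unfolding D_def by (auto simp: algebra_simps)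
      qed (simp add: D_def)
      show "D x y z" if "D x (y + 1) z"
      proof (cases "z \<le> - int n")
        case False
        then have "nat (- z) < n" using that unfolding D_def by auto
        then show ?thesis using that False step[of "nat (- z)" "x - y"] unfolding D_def by (auto simp: algebra_simps)
      qed (simp add: D_def)
      show "D x y z" if "D x y (z + 1)"
      proof (cases "z \<le> - int n")
        case False
        then have "nat (- z) = Suc (nat (- (z + 1)))" "Suc (nat (- (z + 1))) < n" "z + 1 \<le> 0"
          using that unfolding D_def by auto
        then show ?thesis using that False inc[of "nat (- (z + 1))" "x - y + 1"] unfolding D_def by auto
      qed (simp add: D_def)
      show "D x y z" if "x + y < 0" "z \<le> 0"
      proof (cases "z \<le> - int n")
        case False
        then have "nat (- z) < n" using that by auto
        then show ?thesis using that lo[of "nat (- z)" "x - y + 1"] unfolding D_def by auto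
      qed (simp add: D_def)
      show "z \<le> - int n" if "D x y z" "int s \<le> x + y"
      proof (rule ccontr)
        assume *: "\<not> z \<le> - int n"
        then have z: "z \<le> 0" "nat (- z) < n" "x + y + 2 - 2 * z \<le> C (x - y + 1) (nat (- z))"
          using that(1) unfolding D_def by auto
        \<comment> \<open>The bounds leave only equality, and that has the wrong parity: this is
          where rounding up is harmless.\<close>
        then have "C (x - y + 1) (nat (- z)) = x + y + 2 - 2 * z"
          using hi[OF z(2), of "x - y + 1"] that(2) by simp
        moreover have "even (C (x - y + 1) (nat (- z)) + (x - y + 1))" using site[OF z(2)] by blast
        ultimately show False by presburger
      qed
      show "D (x + int m) (y - int m) z = D x y z"
        using per[of "x - y + 1" "nat (- z)"] by (simp add: D_def algebra_simps)
    qed (auto simp: D_def)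
    moreover have "R D cs" unfolding R_def D_def C_def by auto
    ultimately show "\<exists>D\<in>cyl_ideals m n s. R D cs" by blast
  next
    fix D cs cs' assume cs: "cs \<in> ?W" "cs' \<in> ?W" and R: "R D cs" "R D cs'"
    have eq: "cs ! u = cs' ! u" if u: "u < 2 * m" for u
    proof
      fix i
      have tup: "cs ! u \<in> inc_tuples n (sites (2 * n + s) u)" "cs' ! u \<in> inc_tuples n (sites (2 * n + s) u)"
        using cs u by (simp_all add: closed_walks_iff)
      show "(cs ! u) i = (cs' ! u) i"
      proof (cases "i < n")
        case True
        have umod: "nat (int u mod (2 * int m)) = u" using u by simp
        have *: "k + (k + 1 - int u) + 2 + 2 * int i \<le> int ((cs ! u) i) \<longleftrightarrow>
          k + (k + 1 - int u) + 2 + 2 * int i \<le> int ((cs' ! u) i)" for k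
          using R(1)[unfolded R_def, rule_format, OF True, of k "k + 1 - int u"]
            R(2)[unfolded R_def, rule_format, OF True, of k "k + 1 - int u"] umod by simp
        have ev: "even ((cs ! u) i + u)" "even ((cs' ! u) i + u)"
          using inc_tuples_mem[OF tup(1) True] inc_tuples_mem[OF tup(2) True] by (auto simp: sites_def)
        then have "even (int ((cs ! u) i) + int u)" "even (int ((cs' ! u) i) + int u)" by simp_all
        \<comment> \<open>A test point reads off a position only up to one, since x + y + 2 + 2 i
          has the parity opposite to u; the common parity of the two positions closes the
          gap.\<close>
        then have "int ((cs ! u) i) - 1 \<le> int ((cs' ! u) i)" "int ((cs' ! u) i) - 1 \<le> int ((cs ! u) i)"
          using *[of "(int ((cs ! u) i) + int u) div 2 - 2 - int i"] *[of "(int ((cs' ! u) i) + int u) div 2 - 2 - int i"]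
          by (auto elim!: evenE)
        then show ?thesis using ev by presburger
      next
        case False
        then show ?thesis using inc_tuples_undefined[OF tup(1)] inc_tuples_undefined[OF tup(2)] by simp
      qed
    qed
    show "cs = cs'"
    proof (rule nth_equalityI)
      show "length cs = length cs'" using cs by (simp add: closed_walks_iff)
      fix u assume "u < length cs"
      then consider "u < 2 * m" | "u = 2 * m" using cs by (fastforce simp: closed_walks_iff)
      then show "cs ! u = cs' ! u"
      proof cases
        case 2
        then show ?thesis using eq[of 0] m cs by (simp add: closed_walks_iff)
      qed (rule eq)
    qed
  next
    fix D D' cs assume D: "D \<in> cyl_ideals m n s" "D' \<in> cyl_ideals m n s" and R: "R D cs" "R D' cs"
    have "D x y z = D' x y z" for x y z
    proof (cases "- int n < z \<and> z \<le> 0")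
      case True
      then have "nat (- z) < n" "z = - int (nat (- z))" by auto
      then show ?thesis using R unfolding R_def by metis
    next
      case False
      then show ?thesis using cyl_idealsD(4,6)[OF D(1)] cyl_idealsD(4,6)[OF D(2)] by (metis not_le)
    qed
    then show "D = D'" by blast
  qed
qed

section \<open>Height functions\<close>

text \<open>\<open>g a b\<close> is the height at which the diagonal through \<open>(a, b, 0)\<close> meets the surface, so that the
  surface contains the lattice point \<open>(a + g a b, b + g a b, g a b)\<close>.\<close>

definition height_function :: "nat \<Rightarrow> int \<Rightarrow> (int \<Rightarrow> int \<Rightarrow> int) \<Rightarrow> bool" where
  "height_function n j g \<longleftrightarrow>
     (\<forall>a b. g (a + 1) b \<le> g a b) \<and> (\<forall>a b. g a (b + 1) \<le> g a b) \<and>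
     (\<forall>a b. g a b \<le> g (a + 1) (b + 1) + 1) \<and>
     (\<forall>a b. a + b \<le> 1 \<longrightarrow> g a b = 0) \<and> (\<forall>a b. j \<le> a + b \<longrightarrow> g a b = - int n)"

definition heights :: "nat \<Rightarrow> nat \<Rightarrow> nat \<Rightarrow> (int \<Rightarrow> int \<Rightarrow> int) set" where
  "heights m n s = {g. height_function n (2 * int n + int s) g \<and>
     (\<forall>a b. g (a + int m) (b - int m) = g a b)}"

lemma height_functionD:
  assumes "height_function n j g"
  shows "g (a + 1) b \<le> g a b" "g a (b + 1) \<le> g a b" "g a b \<le> g (a + 1) (b + 1) + 1"
    "a + b \<le> 1 \<Longrightarrow> g a b = 0" "j \<le> a + b \<Longrightarrow> g a b = - int n"
  using assms unfolding height_function_def by blast+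

lemma height_function_antimono:
  assumes g: "height_function n j g" and *: "a' \<le> a" "b' \<le> b"
  shows "g a b \<le> g a' b'"
proof -
  have "g (a' + int k) b \<le> g a' b" for k
  proof (induction k)
    case (Suc k) then show ?case using height_functionD(1)[OF g, of "a' + int k" b] by (simp add: algebra_simps)
  qed simp
  from this[of "nat (a - a')"] have "g a b \<le> g a' b" using * by simp
  also have "g a' (b' + int k) \<le> g a' b'" for k
  proof (induction k)
    case (Suc k) then show ?case using height_functionD(2)[OF g, of a' "b' + int k"] by (simp add: algebra_simps)
  qed simp
  from this[of "nat (b - b')"] have "g a' b \<le> g a' b'" using * by simp
  finally show ?thesis .
qed

lemma height_function_diagonal:
  assumes g: "height_function n j g" and "0 \<le> k"
  shows "g a b \<le> g (a + k) (b + k) + k"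
proof -
  have "g a b \<le> g (a + int l) (b + int l) + int l" for l
  proof (induction l)
    case (Suc l) then show ?case using height_functionD(3)[OF g, of "a + int l" "b + int l"] by (simp add: algebra_simps)
  qed simp
  from this[of "nat k"] show ?thesis using assms(2) by simp
qed

lemma height_function_bounds:
  assumes g: "height_function n j g"
  shows "g a b \<le> 0" "- int n \<le> g a b"
  using height_function_antimono[OF g, of "min a (- b)" a b b] height_functionD(4)[OF g, of "min a (- b)" b]
    height_function_antimono[OF g, of a "max a (j - b)" b b]
    height_functionD(5)[OF g, of "max a (j - b)" b] by simp_all

text \<open>The inequality says that the far corner (x + 1, y + 1, z) of a cell lies at or below the
  surface on its own space diagonal. Lowering z by d moves d steps along a diagonal of the plane,
  which costs at most d in height.\<close>

lemma height_function_ideal_down: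
  assumes g: "height_function n j g" and "z \<le> g (x + 1 - z) (y + 1 - z)" "z' \<le> z"
  shows "z' \<le> g (x + 1 - z') (y + 1 - z')"
  using height_function_diagonal[OF g, of "z - z'" "x + 1 - z" "y + 1 - z"] assms(2,3)
  by (simp add: algebra_simps)

text \<open>A diagonal from \<open>j mod 2\<close>, where the height is 0, to \<open>j\<close>,
  where it is \<open>- n\<close>, has \<open>j div 2\<close> steps, each of which descends by at
  most one.\<close>

lemma height_function_length:
  assumes g: "height_function n j g" and j: "0 \<le> j"
  shows "2 * int n \<le> j"
proof -
  have "j mod 2 \<le> 1" by simp
  then have "g (j mod 2) 0 = 0" using height_functionD(4)[OF g] by simp
  moreover have "g (j mod 2 + j div 2) (0 + j div 2) = - int n"
    by (rule height_functionD(5)[OF g]) presburger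
  moreover have "g (j mod 2) 0 \<le> g (j mod 2 + j div 2) (0 + j div 2) + j div 2"
    by (rule height_function_diagonal[OF g]) (use j in simp)
  ultimately show ?thesis by linarith
qed

text \<open>The discrete source of injectivity. If the second point were strictly above the first in
  every coordinate, going along the diagonal for z' - z - 1 steps would bound its height by less
  than z'.\<close>

lemma height_function_antichain:
  assumes g: "height_function n j g" and "g (x - z) (y - z) = z" "g (x' - z') (y' - z') = z'"
    and "x < x'" "y < y'" "z < z'"
  shows False
proof -
  let ?d = "z' - z"
  have "g (x' - z') (y' - z') \<le> g (x - z - ?d + 1) (y - z - ?d + 1)"
    by (rule height_function_antimono[OF g]) (use assms in auto)
  also have "\<dots> \<le> g (x - z - ?d + 1 + (?d - 1)) (y - z - ?d + 1 + (?d - 1)) + (?d - 1)"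
    by (rule height_function_diagonal[OF g]) (use assms in auto)
  also have "\<dots> = g (x - z) (y - z) + (?d - 1)" by simp
  finally show False using assms by simp
qed

text \<open>On space diagonals the three monotonicity conditions of an ideal become the three
  inequalities of a height function. The far corner at z = 0 turns x + y < 0 into a + b \<le> 1, and
  the one at z = 1 - n turns s \<le> x + y into 2 n + s \<le> a + b.\<close>

lemma card_heights: "card (heights m n s) = card (cyl_ideals m n s)"
proof -
  define R where "R = (\<lambda>(g :: int \<Rightarrow> int \<Rightarrow> int) (D :: int \<Rightarrow> int \<Rightarrow> int \<Rightarrow> bool).
    \<forall>x y z. D x y z \<longleftrightarrow> z \<le> g (x + 1 - z) (y + 1 - z))"
  show ?thesis
  proof (rule card_eq_if_matching[of _ _ R])
    fix g assume g: "g \<in> heights m n s"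
    then have h: "height_function n (2 * int n + int s) g" and per: "g (a + int m) (b - int m) = g a b" for a b
      by (auto simp: heights_def)
    define D where "D = (\<lambda>x y z. z \<le> g (x + 1 - z) (y + 1 - z))"
    have zdown: "D x y z'" if "D x y z" "z' \<le> z" for x y z z'
      using height_function_ideal_down[OF h] that unfolding D_def by blast
    have "D \<in> cyl_ideals m n s"
      unfolding cyl_ideals_def
    proof (intro CollectI conjI allI impI)
      fix x y z
      show "D x y z" if "D (x + 1) y z"
        using that height_functionD(1)[OF h, of "x + 1 - z" "y + 1 - z"] by (simp add: D_def algebra_simps)
      show "D x y z" if "D x (y + 1) z"
        using that height_functionD(2)[OF h, of "x + 1 - z" "y + 1 - z"] by (simp add: D_def algebra_simps)
      show "D x y z" if "D x y (z + 1)" using zdown that by force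
      show "z \<le> 0" if "D x y z" using that height_function_bounds[OF h] unfolding D_def by (metis order_trans)
      show "D x y z" if "x + y < 0" "z \<le> 0"
        using zdown[of x y 0 z] that height_functionD(4)[OF h, of "x + 1" "y + 1"] by (simp add: D_def)
      show "D x y z" if "z \<le> - int n" using that height_function_bounds[OF h] unfolding D_def by (metis order_trans)
      show "z \<le> - int n" if "D x y z" "int s \<le> x + y"
      proof (rule ccontr)
        assume "\<not> z \<le> - int n"
        then have "D x y (1 - int n)" using zdown[OF that(1), of "1 - int n"] by simp
        then show False using height_functionD(5)[OF h, of "x + int n" "y + int n"] that(2) by (simp add: D_def)
      qed
      show "D (x + int m) (y - int m) z = D x y z"
        using per[of "x + 1 - z" "y + 1 - z"] by (simp add: D_def algebra_simps)
    qed
    then show "\<exists>D\<in>cyl_ideals m n s. R g D" by (auto simp: R_def D_def)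
  next
    fix D assume D: "D \<in> cyl_ideals m n s"
    have "\<exists>t. \<forall>z. D (a + z - 1) (b + z - 1) z \<longleftrightarrow> z \<le> t" for a b
    proof (rule int_cut_exists)
      show "D (a + z - 1) (b + z - 1) z" if "D (a + (z + 1) - 1) (b + (z + 1) - 1) (z + 1)" for z
        using cyl_ideals_antimono[OF D that, of "a + z - 1" "b + z - 1" z] by simp
      show "D (a + - int n - 1) (b + - int n - 1) (- int n)" by (simp add: cyl_idealsD(6)[OF D])
      show "\<not> D (a + 1 - 1) (b + 1 - 1) 1" using cyl_idealsD(4)[OF D, of "a + 1 - 1" "b + 1 - 1" 1] by auto
    qed
    then obtain g where g: "\<And>a b z. D (a + z - 1) (b + z - 1) z \<longleftrightarrow> z \<le> g a b" by metis
    have le: "g a b \<le> 0" and ge: "- int n \<le> g a b" for a b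
      using g[of a "g a b" b] cyl_idealsD(4)[OF D, of _ _ "g a b"] g[of a "- int n" b] cyl_idealsD(6)[OF D, of "- int n"]
      by auto
    have "g \<in> heights m n s"
      unfolding heights_def height_function_def
    proof (intro CollectI conjI allI impI)
      fix a b
      show "g (a + 1) b \<le> g a b"
        using g[of "a + 1" "g (a + 1) b" b] g[of a "g (a + 1) b" b]
          cyl_ideals_antimono[OF D, of "a + 1 + g (a + 1) b - 1" "b + g (a + 1) b - 1" "g (a + 1) b" "a + g (a + 1) b - 1"] by simp
      show "g a (b + 1) \<le> g a b"
        using g[of a "g a (b + 1)" "b + 1"] g[of a "g a (b + 1)" b]
          cyl_ideals_antimono[OF D, of "a + g a (b + 1) - 1" "b + 1 + g a (b + 1) - 1" "g a (b + 1)" _ "b + g a (b + 1) - 1"] by simp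
      show "g a b \<le> g (a + 1) (b + 1) + 1"
        using g[of a "g a b" b] g[of "a + 1" "g a b - 1" "b + 1"]
          cyl_ideals_antimono[OF D, of "a + g a b - 1" "b + g a b - 1" "g a b" "a + g a b - 1" "b + g a b - 1" "g a b - 1"]
        by (simp add: algebra_simps)
      show "g a b = 0" if "a + b \<le> 1"
        using g[of a 0 b] cyl_idealsD(5)[OF D, of "a - 1" "b - 1" 0] that le[of a b] by simp
      show "g a b = - int n" if "2 * int n + int s \<le> a + b"
      proof -
        have "\<not> D (a + (1 - int n) - 1) (b + (1 - int n) - 1) (1 - int n)"
          using cyl_idealsD(7)[OF D, of "a + (1 - int n) - 1" "b + (1 - int n) - 1" "1 - int n"] that by auto
        then have "\<not> 1 - int n \<le> g a b" using g[of a "1 - int n" b] by blast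
        then show ?thesis using ge[of a b] by linarith
      qed
      have "z \<le> g (a + int m) (b - int m) \<longleftrightarrow> z \<le> g a b" for z
        using g[of "a + int m" z "b - int m"] g[of a z b] cyl_idealsD(8)[OF D, of "a + z - 1" "b + z - 1" z]
        by (simp add: algebra_simps)
      from this[of "g (a + int m) (b - int m)"] this[of "g a b"]
      show "g (a + int m) (b - int m) = g a b" by simp
    qed
    moreover have "R g D"
      unfolding R_def
    proof (intro allI)
      fix x y z show "D x y z \<longleftrightarrow> z \<le> g (x + 1 - z) (y + 1 - z)"
        using g[of "x + 1 - z" z "y + 1 - z"] by simp
    qed
    ultimately show "\<exists>g\<in>heights m n s. R g D" by blast
  next
    fix g D D' assume "R g D" "R g D'"
    then show "D = D'" unfolding R_def by (intro ext) simp
  next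
    fix g g' D assume R: "R g D" "R g' D"
    show "g = g'"
    proof (intro ext)
      fix a b
      have "z \<le> g a b \<longleftrightarrow> z \<le> g' a b" for z
        using R unfolding R_def by (metis add_diff_cancel_right' diff_add_cancel)
      from this[of "g a b"] this[of "g' a b"] show "g a b = g' a b" by simp
    qed
  qed
qed

section \<open>The region between two zigzags\<close>

text \<open>The plane of projection is given the coordinates \<open>(\<alpha>, \<beta>) = (x - z, y - z)\<close>, in which the
  projected \<open>z\<close>-axis points towards \<open>(-1, -1)\<close>.\<close>

definition stair :: "int \<Rightarrow> real \<Rightarrow> real \<Rightarrow> bool" where
  "stair j \<alpha> \<beta> \<longleftrightarrow> (\<exists>k :: int.
     (\<beta> = of_int (j - k) \<and> of_int k \<le> \<alpha> \<and> \<alpha> \<le> of_int k + 1) \<or>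
     (\<alpha> = of_int k + 1 \<and> of_int (j - k) - 1 \<le> \<beta> \<and> \<beta> \<le> of_int (j - k)))"

text \<open>The closed region between the staircases 0 and \<open>j\<close>. A point on or past the
  first dominates one of its corners (k, -k); a point on or before the second is dominated by one of
  its corners (k + 1, j - k).\<close>

definition strip :: "int \<Rightarrow> real \<Rightarrow> real \<Rightarrow> bool" where
  "strip j \<alpha> \<beta> \<longleftrightarrow> (\<exists>k :: int. of_int k \<le> \<alpha> \<and> of_int (- k) \<le> \<beta>) \<and>
     (\<exists>k :: int. \<alpha> \<le> of_int k + 1 \<and> \<beta> \<le> of_int (j - k))"

lemma stair_shift: "stair j (\<alpha> + of_int c) (\<beta> + of_int d) \<longleftrightarrow> stair (j - c - d) \<alpha> \<beta>"
proof -
  have 1: "stair (j - c - d) \<alpha> \<beta>" if "stair j (\<alpha> + of_int c) (\<beta> + of_int d)" for j c d \<alpha> \<beta>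
  proof -
    from that obtain k :: int where
      "(\<beta> + of_int d = of_int (j - k) \<and> of_int k \<le> \<alpha> + of_int c \<and> \<alpha> + of_int c \<le> of_int k + 1) \<or>
       (\<alpha> + of_int c = of_int k + 1 \<and> of_int (j - k) - 1 \<le> \<beta> + of_int d \<and> \<beta> + of_int d \<le> of_int (j - k))"
      unfolding stair_def by blast
    then show ?thesis unfolding stair_def by (intro exI[of _ "k - c"]) auto
  qed
  from 1[of j \<alpha> c \<beta> d] 1[of "j - c - d" "\<alpha> + of_int c" "- c" "\<beta> + of_int d" "- d"] show ?thesis
    by auto
qed

text \<open>Reflection in the origin exchanges the two sides of a staircase, so
  \<open>stair_above_iff\<close> can be derived from \<open>stair_below_iff\<close>.\<close>

lemma stair_reflect: "stair j \<alpha> \<beta> \<longleftrightarrow> stair (- j - 1) (- \<alpha>) (- \<beta>)"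
proof -
  have 1: "stair (- j - 1) (- \<alpha>) (- \<beta>)" if "stair j \<alpha> \<beta>" for j \<alpha> \<beta>
  proof -
    from that obtain k :: int where
      "(\<beta> = of_int (j - k) \<and> of_int k \<le> \<alpha> \<and> \<alpha> \<le> of_int k + 1) \<or>
       (\<alpha> = of_int k + 1 \<and> of_int (j - k) - 1 \<le> \<beta> \<and> \<beta> \<le> of_int (j - k))"
      unfolding stair_def by blast
    then show ?thesis
    proof
      assume "\<beta> = of_int (j - k) \<and> of_int k \<le> \<alpha> \<and> \<alpha> \<le> of_int k + 1"
      then show ?thesis unfolding stair_def by (intro exI[of _ "- k - 1"] disjI1) auto
    next
      assume "\<alpha> = of_int k + 1 \<and> of_int (j - k) - 1 \<le> \<beta> \<and> \<beta> \<le> of_int (j - k)"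
      then show ?thesis unfolding stair_def by (intro exI[of _ "- k - 2"] disjI2) auto
    qed
  qed
  from 1[of j \<alpha> \<beta>] 1[of "- j - 1" "- \<alpha>" "- \<beta>"] show ?thesis by auto
qed

text \<open>The staircase is met when descending from a point above it by the largest \<open>t\<close> for which some
  corner of the staircase stays below and to the left of \<open>(\<alpha> - t, \<beta> - t)\<close>.\<close>

lemma stair_below_iff:
  "(\<exists>t\<ge>0. stair j (\<alpha> - t) (\<beta> - t)) \<longleftrightarrow> (\<exists>k :: int. of_int k \<le> \<alpha> \<and> of_int (j - k) \<le> \<beta>)"
proof
  assume "\<exists>t\<ge>0. stair j (\<alpha> - t) (\<beta> - t)"
  then obtain t and k :: int where "t \<ge> 0" and
    "(\<beta> - t = of_int (j - k) \<and> of_int k \<le> \<alpha> - t \<and> \<alpha> - t \<le> of_int k + 1) \<or>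
     (\<alpha> - t = of_int k + 1 \<and> of_int (j - k) - 1 \<le> \<beta> - t \<and> \<beta> - t \<le> of_int (j - k))"
    unfolding stair_def by blast
  then have "(of_int k \<le> \<alpha> \<and> of_int (j - k) \<le> \<beta>) \<or> (of_int (k + 1) \<le> \<alpha> \<and> of_int (j - (k + 1)) \<le> \<beta>)"
    by auto
  then show "\<exists>k :: int. of_int k \<le> \<alpha> \<and> of_int (j - k) \<le> \<beta>" by blast
next
  assume "\<exists>k :: int. of_int k \<le> \<alpha> \<and> of_int (j - k) \<le> \<beta>"
  then obtain k0 :: int where k0: "of_int k0 \<le> \<alpha>" "of_int (j - k0) \<le> \<beta>" by blast
  \<comment> \<open>\<open>\<delta>\<close> is constant along the diagonal through the point, and
    \<open>k\<close> is the step of the staircase that this diagonal meets. The meeting point has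
    first coordinate \<open>min (\<delta> - k) (k + 1)\<close>, according to which of the two edges
    of the step is hit.\<close>
  define \<delta> where "\<delta> = \<alpha> - \<beta> + of_int j"
  define k where "k = \<lfloor>\<delta> / 2\<rfloor>"
  have k: "2 * of_int k \<le> \<delta>" "\<delta> < 2 * of_int k + 2" unfolding k_def by linarith+
  have le: "min (\<delta> - of_int k) (of_int k + 1) \<le> \<alpha>"
  proof (cases "k0 \<le> k")
    case True
    then have "real_of_int k0 \<le> of_int k" by simp
    then show ?thesis using k0 unfolding \<delta>_def by auto
  next
    case False
    then have "real_of_int (k + 1) \<le> of_int k0" by linarith
    then show ?thesis using k0 by auto
  qed
  show "\<exists>t\<ge>0. stair j (\<alpha> - t) (\<beta> - t)"
  proof (cases "\<delta> - of_int k \<le> of_int k + 1")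
    case True
    then have "stair j (\<alpha> - (\<alpha> - \<delta> + of_int k)) (\<beta> - (\<alpha> - \<delta> + of_int k))"
      unfolding stair_def using k by (intro exI[of _ k] disjI1) (auto simp: \<delta>_def)
    moreover have "\<alpha> - \<delta> + of_int k \<ge> 0" using le True by linarith
    ultimately show ?thesis by blast
  next
    case False
    then have "stair j (\<alpha> - (\<alpha> - of_int k - 1)) (\<beta> - (\<alpha> - of_int k - 1))"
      unfolding stair_def using k by (intro exI[of _ k] disjI2) (auto simp: \<delta>_def)
    moreover have "\<alpha> - of_int k - 1 \<ge> 0" using le False by linarith
    ultimately show ?thesis by blast
  qed
qed

lemma stair_above_iff:
  "(\<exists>t\<ge>0. stair j (\<alpha> + t) (\<beta> + t)) \<longleftrightarrow> (\<exists>k :: int. \<alpha> \<le> of_int k + 1 \<and> \<beta> \<le> of_int (j - k))"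
proof -
  have "(\<exists>t\<ge>0. stair j (\<alpha> + t) (\<beta> + t)) \<longleftrightarrow> (\<exists>t\<ge>0. stair (- j - 1) (- \<alpha> - t) (- \<beta> - t))"
    by (subst stair_reflect) (simp add: algebra_simps)
  also have "\<dots> \<longleftrightarrow> (\<exists>k :: int. of_int k \<le> - \<alpha> \<and> of_int (- j - 1 - k) \<le> - \<beta>)"
    by (rule stair_below_iff)
  also have "\<dots> \<longleftrightarrow> (\<exists>k :: int. \<alpha> \<le> of_int k + 1 \<and> \<beta> \<le> of_int (j - k))"
  proof
    assume "\<exists>k :: int. of_int k \<le> - \<alpha> \<and> of_int (- j - 1 - k) \<le> - \<beta>"
    then obtain k :: int where "of_int k \<le> - \<alpha>" "of_int (- j - 1 - k) \<le> - \<beta>" by blast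
    then show "\<exists>k :: int. \<alpha> \<le> of_int k + 1 \<and> \<beta> \<le> of_int (j - k)"
      by (intro exI[of _ "- k - 1"]) auto
  next
    assume "\<exists>k :: int. \<alpha> \<le> of_int k + 1 \<and> \<beta> \<le> of_int (j - k)"
    then obtain k :: int where "\<alpha> \<le> of_int k + 1" "\<beta> \<le> of_int (j - k)" by blast
    then show "\<exists>k :: int. of_int k \<le> - \<alpha> \<and> of_int (- j - 1 - k) \<le> - \<beta>"
      by (intro exI[of _ "- k - 1"]) auto
  qed
  finally show ?thesis .
qed

lemma strip_int_iff: "strip j (of_int a) (of_int b) \<longleftrightarrow> 0 \<le> a + b \<and> a + b \<le> j + 1"
proof
  assume "strip j (of_int a) (of_int b)"
  then obtain k l :: int where "real_of_int k \<le> of_int a" "of_int (- k) \<le> real_of_int b"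
    "of_int a \<le> real_of_int l + 1" "of_int b \<le> real_of_int (j - l)"
    unfolding strip_def by blast
  then show "0 \<le> a + b \<and> a + b \<le> j + 1" by linarith
next
  assume "0 \<le> a + b \<and> a + b \<le> j + 1"
  then show "strip j (of_int a) (of_int b)"
    unfolding strip_def by (intro conjI exI[of _ a] exI[of _ "a - 1"]) auto
qed

lemma strip_if_box:
  assumes "of_int a \<le> \<alpha>" "of_int b \<le> \<beta>" "0 \<le> a + b" "\<alpha> \<le> of_int c" "\<beta> \<le> of_int d" "c + d \<le> j + 1"
  shows "strip j \<alpha> \<beta>"
  unfolding strip_def
proof
  have "- real_of_int a \<le> of_int b" using assms(3) by linarith
  then show "\<exists>k :: int. of_int k \<le> \<alpha> \<and> of_int (- k) \<le> \<beta>" using assms by (intro exI[of _ a]) auto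
  have "real_of_int d \<le> of_int (j - (c - 1))" using assms(6) by linarith
  then show "\<exists>k :: int. \<alpha> \<le> of_int k + 1 \<and> \<beta> \<le> of_int (j - k)"
    using assms by (intro exI[of _ "c - 1"]) auto
qed

lemma strip_if_stair:
  assumes "stair i \<alpha> \<beta>" "0 \<le> i" "i \<le> j"
  shows "strip j \<alpha> \<beta>"
proof -
  from assms(1) obtain k :: int where
    "(\<beta> = of_int (i - k) \<and> of_int k \<le> \<alpha> \<and> \<alpha> \<le> of_int k + 1) \<or>
     (\<alpha> = of_int k + 1 \<and> of_int (i - k) - 1 \<le> \<beta> \<and> \<beta> \<le> of_int (i - k))"
    unfolding stair_def by blast
  then show ?thesis
  proof
    assume "\<beta> = of_int (i - k) \<and> of_int k \<le> \<alpha> \<and> \<alpha> \<le> of_int k + 1"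
    then show ?thesis using assms by (intro strip_if_box[of k _ "i - k" _ "k + 1" "i - k"]) auto
  next
    assume "\<alpha> = of_int k + 1 \<and> of_int (i - k) - 1 \<le> \<beta> \<and> \<beta> \<le> of_int (i - k)"
    then show ?thesis using assms by (intro strip_if_box[of "k + 1" _ "i - k - 1" _ "k + 1" "i - k"]) auto
  qed
qed

lemma stair_int_iff: "stair j (of_int a) (of_int b) \<longleftrightarrow> a + b = j \<or> a + b = j + 1"
proof
  assume "stair j (of_int a) (of_int b)"
  then obtain k :: int where
    "(real_of_int b = of_int (j - k) \<and> of_int k \<le> real_of_int a \<and> real_of_int a \<le> of_int k + 1) \<or>
     (real_of_int a = of_int k + 1 \<and> of_int (j - k) - 1 \<le> real_of_int b \<and> real_of_int b \<le> of_int (j - k))"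
    unfolding stair_def by blast
  then show "a + b = j \<or> a + b = j + 1" by linarith
next
  assume "a + b = j \<or> a + b = j + 1"
  then show "stair j (of_int a) (of_int b)"
  proof
    assume "a + b = j"
    then show ?thesis unfolding stair_def by (intro exI[of _ a] disjI1) auto
  next
    assume "a + b = j + 1"
    then show ?thesis unfolding stair_def by (intro exI[of _ "a - 1"] disjI1) auto
  qed
qed

text \<open>Unit cells with a lower corner this far down touch the strip only in its border. Such
  points are covered by the lower zigzag, and \<open>surface_covers\<close> treats them apart from
  the faces.\<close>

lemma stair_if_strip_bottom:
  assumes "strip j \<alpha> \<beta>" "j \<le> \<lfloor>\<alpha>\<rfloor> + \<lfloor>\<beta>\<rfloor>"
  shows "stair j \<alpha> \<beta>"
proof -
  define a b where "a = \<lfloor>\<alpha>\<rfloor>" and "b = \<lfloor>\<beta>\<rfloor>"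
  have ab: "of_int a \<le> \<alpha>" "\<alpha> < of_int a + 1" "of_int b \<le> \<beta>" "\<beta> < of_int b + 1" "j \<le> a + b"
    using assms(2) unfolding a_def b_def by linarith+
  obtain k :: int where k: "\<alpha> \<le> of_int k + 1" "\<beta> \<le> of_int (j - k)"
    using assms(1) unfolding strip_def by blast
  have *: "a \<le> k + 1" "b \<le> j - k" using ab k by linarith+
  consider "a = k + 1" "b = j - k" | "a = k + 1" "b = j - k - 1" | "a = k" "b = j - k" using * ab(5) by linarith
  then show ?thesis
  proof cases
    case 1
    then have "\<alpha> = of_int a" "\<beta> = of_int b" using ab k by linarith+
    then show ?thesis using 1 stair_int_iff[of j a b] by simp
  next
    case 2
    then have "\<alpha> = of_int k + 1" "of_int (j - k) - 1 \<le> \<beta>" "\<beta> \<le> of_int (j - k)" using ab k by auto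
    then show ?thesis unfolding stair_def by blast
  next
    case 3
    then have "\<beta> = of_int (j - k)" "of_int k \<le> \<alpha>" "\<alpha> \<le> of_int k + 1" using ab k by auto
    then show ?thesis unfolding stair_def by blast
  qed
qed

lemma strip_floor:
  assumes "strip j \<alpha> \<beta>"
  shows "0 \<le> \<lfloor>\<alpha>\<rfloor> + \<lfloor>\<beta>\<rfloor>"
proof -
  obtain k :: int where "of_int k \<le> \<alpha>" "of_int (- k) \<le> \<beta>"
    using assms unfolding strip_def by blast
  then have "k \<le> \<lfloor>\<alpha>\<rfloor>" "- k \<le> \<lfloor>\<beta>\<rfloor>" by linarith+
  then show ?thesis by simp
qed

section \<open>Height functions and cliffs\<close>

locale lattice_frame =
  fixes P :: "real ^ 3"
  assumes lattice: "P \<in> lattice_points"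
begin

definition pnt :: "real \<Rightarrow> real \<Rightarrow> real \<Rightarrow> real ^ 3" where
  "pnt x y z = P + vector [x, y, z]"

definition ipnt :: "int \<Rightarrow> int \<Rightarrow> int \<Rightarrow> real ^ 3" where
  "ipnt x y z = pnt (of_int x) (of_int y) (of_int z)"

definition xc :: "real ^ 3 \<Rightarrow> real" where "xc v = v $ 1 - P $ 1"
definition yc :: "real ^ 3 \<Rightarrow> real" where "yc v = v $ 2 - P $ 2"
definition zc :: "real ^ 3 \<Rightarrow> real" where "zc v = v $ 3 - P $ 3"
definition al :: "real ^ 3 \<Rightarrow> real" where "al v = xc v - zc v"
definition be :: "real ^ 3 \<Rightarrow> real" where "be v = yc v - zc v"

lemma pnt_coords [simp]: "xc (pnt x y z) = x" "yc (pnt x y z) = y" "zc (pnt x y z) = z"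
  "al (pnt x y z) = x - z" "be (pnt x y z) = y - z"
  by (simp_all add: pnt_def xc_def yc_def zc_def al_def be_def)

lemma ipnt_coords [simp]: "xc (ipnt x y z) = of_int x" "yc (ipnt x y z) = of_int y" "zc (ipnt x y z) = of_int z"
  "al (ipnt x y z) = of_int (x - z)" "be (ipnt x y z) = of_int (y - z)"
  by (simp_all add: ipnt_def)

lemma vec_eq_iff_coords: "v = w \<longleftrightarrow> xc v = xc w \<and> yc v = yc w \<and> zc v = zc w"
  by (auto simp: vec_eq_iff forall_3 xc_def yc_def zc_def)

lemma pnt_eq_iff [simp]: "pnt x y z = pnt x' y' z' \<longleftrightarrow> x = x' \<and> y = y' \<and> z = z'"
  by (auto simp: vec_eq_iff_coords)

lemma ipnt_eq_iff [simp]: "ipnt x y z = ipnt x' y' z' \<longleftrightarrow> x = x' \<and> y = y' \<and> z = z'"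
  by (simp add: ipnt_def)

lemma lattice_ex: "\<exists>k :: int. P $ i = of_int k"
  using lattice by (auto simp: lattice_points_def elim: Ints_cases)

lemma lattice_points_eq: "lattice_points = {ipnt x y z | x y z. True}"
proof (intro equalityI subsetI)
  fix v assume "v \<in> lattice_points"
  then have "v $ i - P $ i \<in> \<int>" for i
    using lattice by (auto simp: lattice_points_def)
  then have fl: "v $ i - P $ i = of_int \<lfloor>v $ i - P $ i\<rfloor>" for i
    by (metis Ints_cases floor_of_int)
  have "v = ipnt \<lfloor>v $ 1 - P $ 1\<rfloor> \<lfloor>v $ 2 - P $ 2\<rfloor> \<lfloor>v $ 3 - P $ 3\<rfloor>"
    unfolding vec_eq_iff_coords ipnt_coords using fl[of 1] fl[of 2] fl[of 3]
    by (simp add: xc_def yc_def zc_def)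
  then show "v \<in> {ipnt x y z | x y z. True}" by blast
next
  fix v assume "v \<in> {ipnt x y z | x y z. True}"
  then show "v \<in> lattice_points"
    using lattice by (auto simp: lattice_points_def ipnt_def pnt_def forall_3)
qed

lemma proj_eq_iff: "proj v = proj w \<longleftrightarrow> al v = al w \<and> be v = be w"
  by (auto simp: proj_def vec_eq_iff forall_3 inner_vec_def sum_3 al_def be_def xc_def yc_def zc_def field_simps)

lemma proj_add: "proj (v + t *\<^sub>R w) = proj v + t *\<^sub>R proj w"
  by (simp add: proj_def inner_add_left algebra_simps add_divide_distrib)

lemma coords_add_axis3:
  "al (v + t *\<^sub>R axis 3 1) = al v - t" "be (v + t *\<^sub>R axis 3 1) = be v - t"
  by (simp_all add: al_def be_def xc_def yc_def zc_def axis_def)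

definition sq :: "3 \<Rightarrow> int \<Rightarrow> int \<Rightarrow> int \<Rightarrow> (real ^ 3) set" where
  "sq i x y z = unit_square (ipnt x y z) i"

lemma unit_squares_eq: "unit_squares = {sq i x y z | i x y z. True}"
  unfolding unit_squares_def lattice_points_eq sq_def by blast

lemma horizontal_squares_eq: "horizontal_squares = {sq 3 x y z | x y z. True}"
  unfolding horizontal_squares_def lattice_points_eq sq_def by blast

lemma mem_sq_1: "v \<in> sq 1 x y z \<longleftrightarrow> xc v = of_int x \<and> of_int y \<le> yc v \<and> yc v \<le> of_int y + 1 \<and>
    of_int z \<le> zc v \<and> zc v \<le> of_int z + 1"
  by (auto simp: sq_def unit_square_def forall_3 ipnt_def pnt_def xc_def yc_def zc_def)

lemma mem_sq_2: "v \<in> sq 2 x y z \<longleftrightarrow> yc v = of_int y \<and> of_int x \<le> xc v \<and> xc v \<le> of_int x + 1 \<and>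
    of_int z \<le> zc v \<and> zc v \<le> of_int z + 1"
  by (auto simp: sq_def unit_square_def forall_3 ipnt_def pnt_def xc_def yc_def zc_def)

lemma mem_sq_3: "v \<in> sq 3 x y z \<longleftrightarrow> zc v = of_int z \<and> of_int x \<le> xc v \<and> xc v \<le> of_int x + 1 \<and>
    of_int y \<le> yc v \<and> yc v \<le> of_int y + 1"
  by (auto simp: sq_def unit_square_def forall_3 ipnt_def pnt_def xc_def yc_def zc_def)

lemmas mem_sq = mem_sq_1 mem_sq_2 mem_sq_3

lemma mem_zigzag_from:
  "v \<in> zigzag_from (ipnt p q r) \<longleftrightarrow> zc v = of_int r \<and> stair (p + q) (xc v) (yc v)"
proof -
  have seg1: "v \<in> closed_segment w (w + axis 1 1) \<longleftrightarrow>
      zc v = zc w \<and> yc v = yc w \<and> xc w \<le> xc v \<and> xc v \<le> xc w + 1" for w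
  proof
    assume "v \<in> closed_segment w (w + axis 1 1)"
    then obtain u where "v = (1 - u) *\<^sub>R w + u *\<^sub>R (w + axis 1 1)" "0 \<le> u" "u \<le> 1"
      by (auto simp: closed_segment_def)
    then show "zc v = zc w \<and> yc v = yc w \<and> xc w \<le> xc v \<and> xc v \<le> xc w + 1"
      by (simp add: xc_def yc_def zc_def axis_def algebra_simps)
  next
    assume *: "zc v = zc w \<and> yc v = yc w \<and> xc w \<le> xc v \<and> xc v \<le> xc w + 1"
    then have "v = (1 - (xc v - xc w)) *\<^sub>R w + (xc v - xc w) *\<^sub>R (w + axis 1 1)"
      by (auto simp: vec_eq_iff forall_3 xc_def yc_def zc_def axis_def algebra_simps)
    then show "v \<in> closed_segment w (w + axis 1 1)"
      unfolding closed_segment_def using * by (intro CollectI exI[of _ "xc v - xc w"]) auto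
  qed
  have seg2: "v \<in> closed_segment w (w - axis 2 1) \<longleftrightarrow>
      zc v = zc w \<and> xc v = xc w \<and> yc w - 1 \<le> yc v \<and> yc v \<le> yc w" for w
  proof
    assume "v \<in> closed_segment w (w - axis 2 1)"
    then obtain u where u: "v = (1 - u) *\<^sub>R w + u *\<^sub>R (w - axis 2 1)" "0 \<le> u" "u \<le> 1"
      by (auto simp: closed_segment_def)
    then show "zc v = zc w \<and> xc v = xc w \<and> yc w - 1 \<le> yc v \<and> yc v \<le> yc w"
      unfolding u(1) using u(2,3) by (simp add: xc_def yc_def zc_def axis_def algebra_simps)
  next
    assume *: "zc v = zc w \<and> xc v = xc w \<and> yc w - 1 \<le> yc v \<and> yc v \<le> yc w"
    then have "v = (1 - (yc w - yc v)) *\<^sub>R w + (yc w - yc v) *\<^sub>R (w - axis 2 1)"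
      by (auto simp: vec_eq_iff forall_3 xc_def yc_def zc_def axis_def algebra_simps)
    then show "v \<in> closed_segment w (w - axis 2 1)"
      unfolding closed_segment_def using * by (intro CollectI exI[of _ "yc w - yc v"]) auto
  qed
  let ?w = "\<lambda>k :: int. ipnt p q r + of_int k *\<^sub>R (axis 1 1 - axis 2 1)"
  have w: "xc (?w k) = of_int (p + k)" "yc (?w k) = of_int (q - k)" "zc (?w k) = of_int r"
    "xc (?w k + axis 1 1) = of_int (p + k) + 1" "yc (?w k + axis 1 1) = of_int (q - k)"
    "zc (?w k + axis 1 1) = of_int r" for k
    by (simp_all add: xc_def yc_def zc_def ipnt_def pnt_def axis_def)
  have "v \<in> zigzag_from (ipnt p q r) \<longleftrightarrow> zc v = of_int r \<and> (\<exists>k :: int.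
      (yc v = of_int (q - k) \<and> of_int (p + k) \<le> xc v \<and> xc v \<le> of_int (p + k) + 1) \<or>
      (xc v = of_int (p + k) + 1 \<and> of_int (q - k) - 1 \<le> yc v \<and> yc v \<le> of_int (q - k)))"
    unfolding zigzag_from_def Let_def by (simp only: UN_iff Un_iff seg1 seg2 w) blast
  also have "\<dots> \<longleftrightarrow> zc v = of_int r \<and> stair (p + q) (xc v) (yc v)"
  proof (intro conj_cong refl)
    show "(\<exists>k :: int.
        (yc v = of_int (q - k) \<and> of_int (p + k) \<le> xc v \<and> xc v \<le> of_int (p + k) + 1) \<or>
        (xc v = of_int (p + k) + 1 \<and> of_int (q - k) - 1 \<le> yc v \<and> yc v \<le> of_int (q - k)))
      \<longleftrightarrow> stair (p + q) (xc v) (yc v)" (is "(\<exists>k. ?L k) \<longleftrightarrow> _")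
    proof
      assume "\<exists>k. ?L k"
      then obtain k where "?L k" by blast
      then show "stair (p + q) (xc v) (yc v)" unfolding stair_def by (intro exI[of _ "p + k"]) simp
    next
      assume "stair (p + q) (xc v) (yc v)"
      then obtain k :: int where
        "(yc v = of_int (p + q - k) \<and> of_int k \<le> xc v \<and> xc v \<le> of_int k + 1) \<or>
         (xc v = of_int k + 1 \<and> of_int (p + q - k) - 1 \<le> yc v \<and> yc v \<le> of_int (p + q - k))"
        unfolding stair_def by blast
      then show "\<exists>k. ?L k" by (intro exI[of _ "k - p"]) (simp add: algebra_simps)
    qed
  qed
  finally show ?thesis .
qed

text \<open>At height \<open>r\<close> both plane coordinates are smaller by \<open>r\<close> than
  the space coordinates, so the index of the staircase drops by \<open>2 * r\<close>.\<close>

lemma proj_mem_zigzag_from: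
  "proj v \<in> proj ` zigzag_from (ipnt p q r) \<longleftrightarrow> stair (p + q - 2 * r) (al v) (be v)"
proof -
  have "proj v \<in> proj ` zigzag_from (ipnt p q r) \<longleftrightarrow>
      (\<exists>w. al v = al w \<and> be v = be w \<and> zc w = of_int r \<and> stair (p + q) (xc w) (yc w))"
    by (auto simp: image_iff proj_eq_iff mem_zigzag_from)
  also have "\<dots> \<longleftrightarrow> stair (p + q) (al v + of_int r) (be v + of_int r)"
  proof
    assume "\<exists>w. al v = al w \<and> be v = be w \<and> zc w = of_int r \<and> stair (p + q) (xc w) (yc w)"
    then obtain w where w: "al v = al w" "be v = be w" "zc w = of_int r" "stair (p + q) (xc w) (yc w)" by blast
    then have "al v + of_int r = xc w" "be v + of_int r = yc w" unfolding al_def be_def by auto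
    then show "stair (p + q) (al v + of_int r) (be v + of_int r)" using w(4) by simp
  next
    assume "stair (p + q) (al v + of_int r) (be v + of_int r)"
    then show "\<exists>w. al v = al w \<and> be v = be w \<and> zc w = of_int r \<and> stair (p + q) (xc w) (yc w)"
      by (intro exI[of _ "pnt (al v + of_int r) (be v + of_int r) (of_int r)"]) simp
  qed
  also have "\<dots> \<longleftrightarrow> stair (p + q - 2 * r) (al v) (be v)"
    by (simp add: stair_shift)
  finally show ?thesis .
qed

abbreviation upper :: "(real ^ 3) set" where
  "upper \<equiv> zigzag_from P"

lemma P_eq_pnt: "P = ipnt 0 0 0"
  by (simp add: vec_eq_iff_coords) (simp add: xc_def yc_def zc_def)

lemma upper_eq: "upper = zigzag_from (ipnt 0 0 0)"
  using P_eq_pnt by simp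

lemma mem_upper: "v \<in> upper \<longleftrightarrow> zc v = 0 \<and> stair 0 (xc v) (yc v)"
  using mem_zigzag_from[of v 0 0 0] P_eq_pnt by simp

lemma P_mem_upper: "P \<in> upper"
proof -
  have "ipnt 0 0 0 \<in> zigzag_from (ipnt 0 0 0)"
    unfolding mem_zigzag_from ipnt_coords stair_int_iff by simp
  then show ?thesis using P_eq_pnt by simp
qed

definition surface :: "(real ^ 3) set \<Rightarrow> (real ^ 3) set set \<Rightarrow> (real ^ 3) set" where
  "surface B F = \<Union>F \<union> upper \<union> B"

text \<open>The plane coordinates \<open>al\<close> and \<open>be\<close> separate exactly the
  points with different projections, which turns the region between the projected zigzags into a
  \<open>strip\<close>.\<close>

lemma cliff_iff:
  assumes B: "B = zigzag_from (ipnt p q r)"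
  shows "cliff upper B F \<longleftrightarrow> F \<subseteq> unit_squares \<and>
    (\<forall>v\<in>surface B F. \<forall>w\<in>surface B F. al v = al w \<longrightarrow> be v = be w \<longrightarrow> v = w) \<and>
    (\<forall>\<alpha> \<beta>. strip (p + q - 2 * r) \<alpha> \<beta> \<longleftrightarrow> (\<exists>v\<in>surface B F. al v = \<alpha> \<and> be v = \<beta>))"
proof -
  let ?j = "p + q - 2 * r"
  have zz: "zigzag upper" "zigzag B"
    using lattice lattice_points_eq B unfolding zigzag_def by blast+
  have inj: "inj_on proj (surface B F) \<longleftrightarrow>
      (\<forall>v\<in>surface B F. \<forall>w\<in>surface B F. al v = al w \<longrightarrow> be v = be w \<longrightarrow> v = w)"
    unfolding inj_on_def proj_eq_iff by blast
  have inj': "inj_on proj (surface B F) \<Longrightarrow> inj_on proj (\<Union>F)"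
    by (rule inj_on_subset) (auto simp: surface_def)
  have region: "proj v \<in> region_between (proj ` upper) (proj ` B) \<longleftrightarrow> strip ?j (al v) (be v)" for v
  proof -
    have A: "proj v + t *\<^sub>R proj (axis 3 1) \<in> proj ` upper \<longleftrightarrow> stair 0 (al v - t) (be v - t)" for t
      using proj_mem_zigzag_from[of "v + t *\<^sub>R axis 3 1" 0 0 0]
      unfolding P_eq_pnt[symmetric] by (simp add: proj_add coords_add_axis3)
    have B': "proj v - t *\<^sub>R proj (axis 3 1) \<in> proj ` B \<longleftrightarrow> stair ?j (al v + t) (be v + t)" for t
      using proj_mem_zigzag_from[of "v + (- t) *\<^sub>R axis 3 1" p q r]
      unfolding B proj_add coords_add_axis3 by simp
    show ?thesis
      unfolding region_between_def mem_Collect_eq A B' strip_def stair_below_iff stair_above_iff by simp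
  qed
  \<comment> \<open>\<open>region_between\<close> is defined by points of the whole space; all of
    its members nevertheless lie in the plane of projection, so both sets can be compared on
    projections.\<close>
  have range: "q \<in> range proj" if "q \<in> region_between (proj ` upper) (proj ` B)" for q
  proof -
    obtain t a where "q + t *\<^sub>R proj (axis 3 1) = proj a"
      using \<open>q \<in> region_between _ _\<close> unfolding region_between_def by blast
    then have "q = proj (a + (- t) *\<^sub>R axis 3 1)" unfolding proj_add by (simp add: algebra_simps)
    then show ?thesis by blast
  qed
  have "proj ` surface B F = region_between (proj ` upper) (proj ` B) \<longleftrightarrow>
      (\<forall>v. proj v \<in> proj ` surface B F \<longleftrightarrow> proj v \<in> region_between (proj ` upper) (proj ` B))"
    using range by (auto simp: set_eq_iff)
  also have "\<dots> \<longleftrightarrow> (\<forall>v. (\<exists>w\<in>surface B F. al v = al w \<and> be v = be w) \<longleftrightarrow> strip ?j (al v) (be v))"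
    by (simp add: region image_iff proj_eq_iff)
  also have "\<dots> \<longleftrightarrow> (\<forall>\<alpha> \<beta>. strip ?j \<alpha> \<beta> \<longleftrightarrow> (\<exists>v\<in>surface B F. al v = \<alpha> \<and> be v = \<beta>))"
  proof
    assume *: "\<forall>v. (\<exists>w\<in>surface B F. al v = al w \<and> be v = be w) \<longleftrightarrow> strip ?j (al v) (be v)"
    show "\<forall>\<alpha> \<beta>. strip ?j \<alpha> \<beta> \<longleftrightarrow> (\<exists>v\<in>surface B F. al v = \<alpha> \<and> be v = \<beta>)"
    proof (intro allI)
      fix \<alpha> \<beta>
      show "strip ?j \<alpha> \<beta> \<longleftrightarrow> (\<exists>v\<in>surface B F. al v = \<alpha> \<and> be v = \<beta>)"
        using *[rule_format, of "pnt \<alpha> \<beta> 0"] by auto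
    qed
  next
    assume *: "\<forall>\<alpha> \<beta>. strip ?j \<alpha> \<beta> \<longleftrightarrow> (\<exists>v\<in>surface B F. al v = \<alpha> \<and> be v = \<beta>)"
    show "\<forall>v. (\<exists>w\<in>surface B F. al v = al w \<and> be v = be w) \<longleftrightarrow> strip ?j (al v) (be v)"
      unfolding *[rule_format] by metis
  qed
  finally show ?thesis
    unfolding cliff_def stepped_surface_def using zz inj inj' by (auto simp: surface_def)
qed


section \<open>Faces over vertices and edge midpoints of the triangular lattice\<close>

lemma sq_cases:
  obtains "i = 1" | "i = 2" | "i = (3 :: 3)"
  using exhaust_3[of i] by (elim disjE)

lemma ipnt_mem_sq_1: "ipnt x' y' z' \<in> sq 1 x y z \<longleftrightarrow> x' = x \<and> (y' = y \<or> y' = y + 1) \<and> (z' = z \<or> z' = z + 1)"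
  unfolding mem_sq ipnt_coords by linarith

lemma ipnt_mem_sq_2: "ipnt x' y' z' \<in> sq 2 x y z \<longleftrightarrow> y' = y \<and> (x' = x \<or> x' = x + 1) \<and> (z' = z \<or> z' = z + 1)"
  unfolding mem_sq ipnt_coords by linarith

lemma ipnt_mem_sq_3: "ipnt x' y' z' \<in> sq 3 x y z \<longleftrightarrow> z' = z \<and> (x' = x \<or> x' = x + 1) \<and> (y' = y \<or> y' = y + 1)"
  unfolding mem_sq ipnt_coords by linarith

lemmas ipnt_mem_sq = ipnt_mem_sq_1 ipnt_mem_sq_2 ipnt_mem_sq_3

lemma sq_3_inj: "sq 3 x y z = sq 3 x' y' z' \<longleftrightarrow> x = x' \<and> y = y' \<and> z = z'"
proof
  assume *: "sq 3 x y z = sq 3 x' y' z'"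
  have "ipnt x y z \<in> sq 3 x y z" "ipnt (x + 1) (y + 1) z \<in> sq 3 x y z" by (simp_all add: ipnt_mem_sq)
  then show "x = x' \<and> y = y' \<and> z = z'" unfolding * ipnt_mem_sq by linarith
qed simp

text \<open>One coordinate is a fixed integer on the face, which makes the offset along the diagonal
  an integer.\<close>

lemma sq_lattice_point:
  assumes "v \<in> sq i x y z" "al v = of_int a" "be v = of_int b"
  shows "\<exists>c. v = ipnt (a + c) (b + c) c"
proof (rule sq_cases[of i])
  assume "i = 1"
  then show ?thesis using assms by (intro exI[of _ "x - a"]) (auto simp: mem_sq vec_eq_iff_coords al_def be_def)
next
  assume "i = 2"
  then show ?thesis using assms by (intro exI[of _ "y - b"]) (auto simp: mem_sq vec_eq_iff_coords al_def be_def)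
next
  assume "i = 3"
  then show ?thesis using assms by (intro exI[of _ z]) (auto simp: mem_sq vec_eq_iff_coords al_def be_def)
qed

text \<open>A face covering the midpoint of an edge of the triangular lattice either has a side above that
  edge, or has the edge as its short diagonal.\<close>

lemma sq_midpoint_1:
  assumes "v \<in> sq i x y z" "al v = of_int a + 1 / 2" "be v = of_int b"
  shows "(\<exists>c. ipnt (a + c) (b + c) c \<in> sq i x y z \<and> ipnt (a + 1 + c) (b + c) c \<in> sq i x y z) \<or>
    (\<exists>c. sq i x y z = sq 1 (a + 1 + c) (b + c) c)"
proof (rule sq_cases[of i])
  assume i: "i = 1"
  then have "xc v = of_int x" "zc v = of_int (x - a) - 1 / 2" "yc v = of_int (b + x - a) - 1 / 2"
    "of_int y \<le> yc v" "yc v \<le> of_int y + 1" "of_int z \<le> zc v" "zc v \<le> of_int z + 1"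
    using assms by (auto simp: mem_sq al_def be_def)
  then have "y = b + x - a - 1" "z = x - a - 1" by linarith+
  then have "x = a + 1 + z" "y = b + z" by simp_all
  then show ?thesis using i by (intro disjI2 exI[of _ z]) (simp add: algebra_simps)
next
  assume i: "i = 2"
  then have "yc v = of_int y" "zc v = of_int (y - b)" "xc v = of_int (a + y - b) + 1 / 2"
    "of_int x \<le> xc v" "xc v \<le> of_int x + 1" "of_int z \<le> zc v" "zc v \<le> of_int z + 1"
    using assms by (auto simp: mem_sq al_def be_def)
  then have "x = a + y - b" "y - b = z \<or> y - b = z + 1" by linarith+
  then show ?thesis using i by (intro disjI1 exI[of _ "y - b"]) (auto simp: ipnt_mem_sq algebra_simps)
next
  assume i: "i = 3"
  then have "zc v = of_int z" "yc v = of_int (b + z)" "xc v = of_int (a + z) + 1 / 2"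
    "of_int x \<le> xc v" "xc v \<le> of_int x + 1" "of_int y \<le> yc v" "yc v \<le> of_int y + 1"
    using assms by (auto simp: mem_sq al_def be_def)
  then have "x = a + z" "b + z = y \<or> b + z = y + 1" by linarith+
  then show ?thesis using i by (intro disjI1 exI[of _ z]) (auto simp: ipnt_mem_sq algebra_simps)
qed

lemma sq_midpoint_2:
  assumes "v \<in> sq i x y z" "al v = of_int a" "be v = of_int b + 1 / 2"
  shows "(\<exists>c. ipnt (a + c) (b + c) c \<in> sq i x y z \<and> ipnt (a + c) (b + 1 + c) c \<in> sq i x y z) \<or>
    (\<exists>c. sq i x y z = sq 2 (a + c) (b + 1 + c) c)"
proof (rule sq_cases[of i])
  assume i: "i = 2"
  then have "yc v = of_int y" "zc v = of_int (y - b) - 1 / 2" "xc v = of_int (a + y - b) - 1 / 2"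
    "of_int x \<le> xc v" "xc v \<le> of_int x + 1" "of_int z \<le> zc v" "zc v \<le> of_int z + 1"
    using assms by (auto simp: mem_sq al_def be_def)
  then have "x = a + y - b - 1" "z = y - b - 1" by linarith+
  then have "x = a + z" "y = b + 1 + z" by simp_all
  then show ?thesis using i by (intro disjI2 exI[of _ z]) (simp add: algebra_simps)
next
  assume i: "i = 1"
  then have "xc v = of_int x" "zc v = of_int (x - a)" "yc v = of_int (b + x - a) + 1 / 2"
    "of_int y \<le> yc v" "yc v \<le> of_int y + 1" "of_int z \<le> zc v" "zc v \<le> of_int z + 1"
    using assms by (auto simp: mem_sq al_def be_def)
  then have "y = b + x - a" "x - a = z \<or> x - a = z + 1" by linarith+
  then show ?thesis using i by (intro disjI1 exI[of _ "x - a"]) (auto simp: ipnt_mem_sq algebra_simps)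
next
  assume i: "i = 3"
  then have "zc v = of_int z" "xc v = of_int (a + z)" "yc v = of_int (b + z) + 1 / 2"
    "of_int x \<le> xc v" "xc v \<le> of_int x + 1" "of_int y \<le> yc v" "yc v \<le> of_int y + 1"
    using assms by (auto simp: mem_sq al_def be_def)
  then have "y = b + z" "a + z = x \<or> a + z = x + 1" by linarith+
  then show ?thesis using i by (intro disjI1 exI[of _ z]) (auto simp: ipnt_mem_sq algebra_simps)
qed

lemma sq_midpoint_3:
  assumes "v \<in> sq i x y z" "al v = of_int a + 1 / 2" "be v = of_int b + 1 / 2"
  shows "(\<exists>c. ipnt (a + 1 + c) (b + 1 + c) c \<in> sq i x y z \<and> ipnt (a + 1 + c) (b + 1 + c) (c + 1) \<in> sq i x y z) \<or>
    (\<exists>c. sq i x y z = sq 3 (a + c) (b + c) c)"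
proof (rule sq_cases[of i])
  assume i: "i = 3"
  then have "zc v = of_int z" "xc v = of_int (a + z) + 1 / 2" "yc v = of_int (b + z) + 1 / 2"
    "of_int x \<le> xc v" "xc v \<le> of_int x + 1" "of_int y \<le> yc v" "yc v \<le> of_int y + 1"
    using assms by (auto simp: mem_sq al_def be_def)
  then have "x = a + z" "y = b + z" by linarith+
  then show ?thesis using i by (intro disjI2 exI[of _ z]) (simp add: algebra_simps)
next
  assume i: "i = 1"
  then have "xc v = of_int x" "zc v = of_int (x - a) - 1 / 2" "yc v = of_int (b + x - a)"
    "of_int y \<le> yc v" "yc v \<le> of_int y + 1" "of_int z \<le> zc v" "zc v \<le> of_int z + 1"
    using assms by (auto simp: mem_sq al_def be_def)
  then have "z = x - a - 1" "b + x - a = y \<or> b + x - a = y + 1" by linarith+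
  then show ?thesis using i by (intro disjI1 exI[of _ z]) (auto simp: ipnt_mem_sq algebra_simps)
next
  assume i: "i = 2"
  then have "yc v = of_int y" "zc v = of_int (y - b) - 1 / 2" "xc v = of_int (a + y - b)"
    "of_int x \<le> xc v" "xc v \<le> of_int x + 1" "of_int z \<le> zc v" "zc v \<le> of_int z + 1"
    using assms by (auto simp: mem_sq al_def be_def)
  then have "z = y - b - 1" "a + y - b = x \<or> a + y - b = x + 1" by linarith+
  then show ?thesis using i by (intro disjI1 exI[of _ z]) (auto simp: ipnt_mem_sq algebra_simps)
qed

text \<open>A zigzag runs along edges parallel to the x- and y-axes, so it never passes over the
  midpoint of a projected vertical edge. This is the impossible last case.\<close>

lemma zigzag_midpoint:
  assumes v: "v \<in> zigzag_from (ipnt p q r)"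
  shows "al v = of_int a \<Longrightarrow> be v = of_int b \<Longrightarrow> v = ipnt (a + r) (b + r) r"
    and "al v = of_int a + 1 / 2 \<Longrightarrow> be v = of_int b \<Longrightarrow>
      ipnt (a + r) (b + r) r \<in> zigzag_from (ipnt p q r) \<and> ipnt (a + 1 + r) (b + r) r \<in> zigzag_from (ipnt p q r)"
    and "al v = of_int a \<Longrightarrow> be v = of_int b + 1 / 2 \<Longrightarrow>
      ipnt (a + r) (b + r) r \<in> zigzag_from (ipnt p q r) \<and> ipnt (a + r) (b + 1 + r) r \<in> zigzag_from (ipnt p q r)"
    and "al v = of_int a + 1 / 2 \<Longrightarrow> be v = of_int b + 1 / 2 \<Longrightarrow> False"
proof -
  from v have z: "zc v = of_int r" and "stair (p + q) (xc v) (yc v)" by (simp_all add: mem_zigzag_from)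
  then obtain k :: int where k:
    "(yc v = of_int (p + q - k) \<and> of_int k \<le> xc v \<and> xc v \<le> of_int k + 1) \<or>
     (xc v = of_int k + 1 \<and> of_int (p + q - k) - 1 \<le> yc v \<and> yc v \<le> of_int (p + q - k))"
    unfolding stair_def by blast
  have mem: "ipnt x y r \<in> zigzag_from (ipnt p q r) \<longleftrightarrow> x + y = p + q \<or> x + y = p + q + 1" for x y
    by (simp add: mem_zigzag_from stair_int_iff)
  show "al v = of_int a \<Longrightarrow> be v = of_int b \<Longrightarrow> v = ipnt (a + r) (b + r) r"
    using z by (auto simp: vec_eq_iff_coords al_def be_def)
  show "ipnt (a + r) (b + r) r \<in> zigzag_from (ipnt p q r) \<and> ipnt (a + 1 + r) (b + r) r \<in> zigzag_from (ipnt p q r)"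
    if "al v = of_int a + 1 / 2" "be v = of_int b"
  proof -
    have "xc v = of_int (a + r) + 1 / 2" "yc v = of_int (b + r)" using that z by (auto simp: al_def be_def)
    then have "a + r + (b + r) = p + q" using k by linarith
    then show ?thesis unfolding mem by linarith
  qed
  show "ipnt (a + r) (b + r) r \<in> zigzag_from (ipnt p q r) \<and> ipnt (a + r) (b + 1 + r) r \<in> zigzag_from (ipnt p q r)"
    if "al v = of_int a" "be v = of_int b + 1 / 2"
  proof -
    have "xc v = of_int (a + r)" "yc v = of_int (b + r) + 1 / 2" using that z by (auto simp: al_def be_def)
    then have "a + r + (b + r) = p + q" using k by linarith
    then show ?thesis unfolding mem by linarith
  qed
  show False if "al v = of_int a + 1 / 2" "be v = of_int b + 1 / 2"
  proof -
    have "xc v = of_int (a + r) + 1 / 2" "yc v = of_int (b + r) + 1 / 2" using that z by (auto simp: al_def be_def)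
    with k have "real_of_int (2 * (b + r) + 1) = of_int (2 * (p + q - k)) \<or>
        real_of_int (2 * (a + r) + 1) = of_int (2 * (k + 1))"
      by auto
    then have "2 * (b + r) + 1 = 2 * (p + q - k) \<or> 2 * (a + r) + 1 = 2 * (k + 1)"
      by (simp only: of_int_eq_iff)
    then show False by presburger
  qed
qed

definition on_graph :: "int \<Rightarrow> (int \<Rightarrow> int \<Rightarrow> int) \<Rightarrow> int \<Rightarrow> int \<Rightarrow> int \<Rightarrow> bool" where
  "on_graph j g x y z \<longleftrightarrow> 0 \<le> x + y - 2 * z \<and> x + y - 2 * z \<le> j + 1 \<and> g (x - z) (y - z) = z"

text \<open>The lattice points of a unit square are its four vertices, so this collects every square
  that the height function permits. \<open>faces_eq\<close> shows that a cliff contains all of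
  them.\<close>

definition faces_of :: "int \<Rightarrow> (int \<Rightarrow> int \<Rightarrow> int) \<Rightarrow> (real ^ 3) set set" where
  "faces_of j g = {f \<in> unit_squares. \<forall>x y z. ipnt x y z \<in> f \<longrightarrow> on_graph j g x y z}"

lemma sq_mem_faces_of_iff:
  "sq 1 x y z \<in> faces_of j g \<longleftrightarrow> on_graph j g x y z \<and> on_graph j g x (y + 1) z \<and>
     on_graph j g x y (z + 1) \<and> on_graph j g x (y + 1) (z + 1)"
  "sq 2 x y z \<in> faces_of j g \<longleftrightarrow> on_graph j g x y z \<and> on_graph j g (x + 1) y z \<and>
     on_graph j g x y (z + 1) \<and> on_graph j g (x + 1) y (z + 1)"
  "sq 3 x y z \<in> faces_of j g \<longleftrightarrow> on_graph j g x y z \<and> on_graph j g (x + 1) y z \<and>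
     on_graph j g x (y + 1) z \<and> on_graph j g (x + 1) (y + 1) z"
  by (auto simp: faces_of_def unit_squares_eq ipnt_mem_sq)

lemma faces_ofE:
  assumes "f \<in> faces_of j g"
  obtains x y z where "f = sq 1 x y z" | x y z where "f = sq 2 x y z" | x y z where "f = sq 3 x y z"
proof -
  obtain i x y z where "f = sq i x y z" using assms by (auto simp: faces_of_def unit_squares_eq)
  then show ?thesis using that by (cases rule: sq_cases[of i]) auto
qed

end

section \<open>The height function of a cliff\<close>

locale cliff_frame = lattice_frame +
  fixes p q r j :: int and B :: "(real ^ 3) set" and F :: "(real ^ 3) set set"
  assumes B: "B = zigzag_from (ipnt p q r)" and j: "j = p + q - 2 * r" and cliff: "cliff upper B F"
begin

abbreviation S where "S \<equiv> surface B F"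

lemma faces_unit: "F \<subseteq> unit_squares"
  and inj: "v \<in> S \<Longrightarrow> w \<in> S \<Longrightarrow> al v = al w \<Longrightarrow> be v = be w \<Longrightarrow> v = w"
  and surj: "strip j \<alpha> \<beta> \<longleftrightarrow> (\<exists>v\<in>S. al v = \<alpha> \<and> be v = \<beta>)"
proof -
  note * = cliff[unfolded cliff_iff[OF B] j[symmetric]]
  show "F \<subseteq> unit_squares" by (rule *[THEN conjunct1])
  show "v \<in> S \<Longrightarrow> w \<in> S \<Longrightarrow> al v = al w \<Longrightarrow> be v = be w \<Longrightarrow> v = w"
    by (rule *[THEN conjunct2, THEN conjunct1, rule_format])
  show "strip j \<alpha> \<beta> \<longleftrightarrow> (\<exists>v\<in>S. al v = \<alpha> \<and> be v = \<beta>)"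
    by (rule *[THEN conjunct2, THEN conjunct2, rule_format])
qed

lemma upper_sub: "upper \<subseteq> S" and B_sub: "B \<subseteq> S" and face_sub: "f \<in> F \<Longrightarrow> f \<subseteq> S"
  by (auto simp: surface_def)

lemma surface_cases:
  assumes "v \<in> S"
  obtains i x y z where "sq i x y z \<in> F" "v \<in> sq i x y z" | p' q' r' where
    "v \<in> zigzag_from (ipnt p' q' r')" "zigzag_from (ipnt p' q' r') \<subseteq> S"
proof -
  consider f where "f \<in> F" "v \<in> f" | "v \<in> upper" | "v \<in> B" using assms by (auto simp: surface_def)
  then show ?thesis
  proof cases
    case 1
    have "f \<in> {sq i x y z | i x y z. True}"
      using subsetD[OF faces_unit 1(1)] unfolding unit_squares_eq .
    then obtain i x y z where "f = sq i x y z" by blast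
    then show ?thesis using 1 that(1) by blast
  next
    case 2 then show ?thesis using that(2) upper_sub unfolding upper_eq by blast
  next
    case 3 then show ?thesis using that(2) B_sub unfolding B by blast
  qed
qed

lemma surface_lattice_point:
  assumes "v \<in> S" "al v = of_int a" "be v = of_int b"
  shows "\<exists>c. v = ipnt (a + c) (b + c) c"
  using assms(1)
proof (cases rule: surface_cases)
  case 1 then show ?thesis using sq_lattice_point assms by blast
next
  case 2 then show ?thesis using zigzag_midpoint(1) assms by blast
qed

text \<open>The midpoint of this edge lies in the strip and is therefore covered. Probes of this
  kind, one for each edge direction, yield both the inequalities between neighbouring heights and
  the presence of faces.\<close>

lemma surface_midpoint_1:
  assumes "0 \<le> a + b" "a + b \<le> j"
  shows "(\<exists>c. ipnt (a + c) (b + c) c \<in> S \<and> ipnt (a + 1 + c) (b + c) c \<in> S) \<or>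
    (\<exists>c. sq 1 (a + 1 + c) (b + c) c \<in> F)"
proof -
  have "strip j (of_int a + 1 / 2) (of_int b)"
    using assms by (intro strip_if_box[of a _ b _ "a + 1" b]) auto
  then obtain v where v: "v \<in> S" "al v = of_int a + 1 / 2" "be v = of_int b" using surj by blast
  from v(1) show ?thesis
  proof (cases rule: surface_cases)
    case (1 i x y z)
    then show ?thesis using sq_midpoint_1[OF 1(2) v(2,3)] face_sub by (metis subsetD)
  next
    case (2 p' q' r')
    then show ?thesis using zigzag_midpoint(2)[OF 2(1) v(2,3)] by blast
  qed
qed

lemma surface_midpoint_2:
  assumes "0 \<le> a + b" "a + b \<le> j"
  shows "(\<exists>c. ipnt (a + c) (b + c) c \<in> S \<and> ipnt (a + c) (b + 1 + c) c \<in> S) \<or>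
    (\<exists>c. sq 2 (a + c) (b + 1 + c) c \<in> F)"
proof -
  have "strip j (of_int a) (of_int b + 1 / 2)"
    using assms by (intro strip_if_box[of a _ b _ a "b + 1"]) auto
  then obtain v where v: "v \<in> S" "al v = of_int a" "be v = of_int b + 1 / 2" using surj by blast
  from v(1) show ?thesis
  proof (cases rule: surface_cases)
    case (1 i x y z)
    then show ?thesis using sq_midpoint_2[OF 1(2) v(2,3)] face_sub by (metis subsetD)
  next
    case (2 p' q' r')
    then show ?thesis using zigzag_midpoint(3)[OF 2(1) v(2,3)] by blast
  qed
qed

lemma surface_midpoint_3:
  assumes "0 \<le> a + b" "a + b + 1 \<le> j"
  shows "(\<exists>c. ipnt (a + 1 + c) (b + 1 + c) c \<in> S \<and> ipnt (a + 1 + c) (b + 1 + c) (c + 1) \<in> S) \<or>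
    (\<exists>c. sq 3 (a + c) (b + c) c \<in> F)"
proof -
  have "strip j (of_int a + 1 / 2) (of_int b + 1 / 2)"
    using assms by (intro strip_if_box[of a _ b _ "a + 1" "b + 1"]) auto
  then obtain v where v: "v \<in> S" "al v = of_int a + 1 / 2" "be v = of_int b + 1 / 2" using surj by blast
  from v(1) show ?thesis
  proof (cases rule: surface_cases)
    case (1 i x y z)
    then show ?thesis using sq_midpoint_3[OF 1(2) v(2,3)] face_sub by (metis subsetD)
  next
    case (2 p' q' r')
    then show ?thesis using zigzag_midpoint(4)[OF 2(1) v(2,3)] by blast
  qed
qed

lemma j_nonneg: "0 \<le> j"
proof -
  \<comment> \<open>A vertex with coordinate sum 1; one with sum 0 would only give -1 \<le>
    j.\<close>
  have "ipnt 1 0 0 \<in> upper" unfolding upper_eq mem_zigzag_from ipnt_coords stair_int_iff by simp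
  then have "ipnt 1 0 0 \<in> S" using upper_sub by blast
  then have "strip j (of_int 1) (of_int 0)" unfolding surj by (intro bexI[of _ "ipnt 1 0 0"]) auto
  then show ?thesis unfolding strip_int_iff by simp
qed

lemma ex1_height:
  assumes "0 \<le> a + b" "a + b \<le> j + 1"
  shows "\<exists>!c. ipnt (a + c) (b + c) c \<in> S"
proof -
  obtain v where "v \<in> S" "al v = of_int a" "be v = of_int b"
    using assms surj strip_int_iff by blast
  then obtain c where c: "ipnt (a + c) (b + c) c \<in> S" using surface_lattice_point by blast
  moreover have "d = c" if "ipnt (a + d) (b + d) d \<in> S" for d
    using inj[OF that c] by simp
  ultimately show ?thesis by blast
qed

text \<open>Beyond the strip the heights of the two zigzags are continued, so that the inequalities
  of a height function hold on the whole lattice.\<close>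

definition height where
  "height a b = (if a + b < 0 then 0 else if j + 1 < a + b then r else (THE c. ipnt (a + c) (b + c) c \<in> S))"

lemma ipnt_mem_surface: "ipnt x y z \<in> S \<longleftrightarrow> on_graph j height x y z"
proof -
  have "strip j (of_int (x - z)) (of_int (y - z))" if "ipnt x y z \<in> S"
    unfolding surj using that by (intro bexI[of _ "ipnt x y z"]) auto
  then have *: "0 \<le> x + y - 2 * z \<and> x + y - 2 * z \<le> j + 1" if "ipnt x y z \<in> S"
    using that unfolding strip_int_iff by fastforce
  show ?thesis
  proof (cases "0 \<le> x + y - 2 * z \<and> x + y - 2 * z \<le> j + 1")
    case True
    then have ex1: "\<exists>!c. ipnt (x - z + c) (y - z + c) c \<in> S" by (intro ex1_height) auto
    have "height (x - z) (y - z) = (THE c. ipnt (x - z + c) (y - z + c) c \<in> S)"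
      using True by (simp add: height_def)
    then have "height (x - z) (y - z) = z \<longleftrightarrow> ipnt (x - z + z) (y - z + z) z \<in> S"
      using theI'[OF ex1] the1_equality[OF ex1, of z] by metis
    then show ?thesis using True by (simp add: on_graph_def)
  next
    case False then show ?thesis using * by (auto simp: on_graph_def)
  qed
qed

lemma on_graphD: "on_graph j g x y z \<Longrightarrow> g (x - z) (y - z) = z"
  by (simp add: on_graph_def)

lemma face_on_graph: "f \<in> F \<Longrightarrow> ipnt x y z \<in> f \<Longrightarrow> height (x - z) (y - z) = z"
  using face_sub ipnt_mem_surface on_graphD by blast

lemma height_top: "a + b \<le> 1 \<Longrightarrow> height a b = 0"
proof -
  have "height a b = 0" if "a + b = 0 \<or> a + b = 1"
  proof -
    have "ipnt a b 0 \<in> upper" unfolding upper_eq mem_zigzag_from ipnt_coords stair_int_iff using that by simp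
    then show ?thesis using upper_sub ipnt_mem_surface[of a b 0] on_graphD[of height a b 0] by auto
  qed
  moreover assume "a + b \<le> 1"
  ultimately show "height a b = 0" by (cases "a + b < 0") (simp add: height_def, linarith)
qed

lemma height_bottom: "j \<le> a + b \<Longrightarrow> height a b = r"
proof -
  have "height a b = r" if "a + b = j \<or> a + b = j + 1"
  proof -
    have "ipnt (a + r) (b + r) r \<in> B" unfolding B mem_zigzag_from ipnt_coords stair_int_iff using that j by auto
    then show ?thesis
      using B_sub ipnt_mem_surface[of "a + r" "b + r" r] on_graphD[of height "a + r" "b + r" r] by auto
  qed
  moreover assume "j \<le> a + b"
  ultimately show "height a b = r"
    using j_nonneg by (cases "j + 1 < a + b") (simp add: height_def, linarith)
qed

lemma height_step_1: "height (a + 1) b \<le> height a b"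
proof -
  \<comment> \<open>The second alternative is the edge as the short diagonal of a face.\<close>
  have "height (a + 1) b = height a b \<or> height a b = height (a + 1) b + 1"
  proof (cases "0 \<le> a + b \<and> a + b \<le> j")
    case True
    then consider c where "ipnt (a + c) (b + c) c \<in> S" "ipnt (a + 1 + c) (b + c) c \<in> S"
      | c where "sq 1 (a + 1 + c) (b + c) c \<in> F" using surface_midpoint_1 by blast
    then show ?thesis
    proof cases
      case 1
      then have "on_graph j height (a + c) (b + c) c" "on_graph j height (a + 1 + c) (b + c) c"
        using ipnt_mem_surface by blast+
      from this[THEN on_graphD] show ?thesis by simp
    next
      case 2
      have "ipnt (a + 1 + c) (b + c) c \<in> sq 1 (a + 1 + c) (b + c) c"
        "ipnt (a + 1 + c) (b + c + 1) (c + 1) \<in> sq 1 (a + 1 + c) (b + c) c" unfolding ipnt_mem_sq by simp_all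
      from this[THEN face_on_graph[OF 2]] show ?thesis by simp
    qed
  next
    case False
    then show ?thesis using height_top[of a b] height_top[of "a + 1" b] height_bottom[of a b] height_bottom[of "a + 1" b]
      by auto
  qed
  then show ?thesis by auto
qed

lemma height_step_2: "height a (b + 1) \<le> height a b"
proof (cases "0 \<le> a + b \<and> a + b \<le> j")
  case True
  then consider c where "ipnt (a + c) (b + c) c \<in> S" "ipnt (a + c) (b + 1 + c) c \<in> S"
    | c where "sq 2 (a + c) (b + 1 + c) c \<in> F" using surface_midpoint_2 by blast
  then show ?thesis
  proof cases
    case 1
    then have "on_graph j height (a + c) (b + c) c" "on_graph j height (a + c) (b + 1 + c) c"
      using ipnt_mem_surface by blast+
    from this[THEN on_graphD] show ?thesis by simp
  next
    case 2
    have "ipnt (a + c) (b + 1 + c) c \<in> sq 2 (a + c) (b + 1 + c) c"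
      "ipnt (a + c + 1) (b + 1 + c) (c + 1) \<in> sq 2 (a + c) (b + 1 + c) c" unfolding ipnt_mem_sq by simp_all
    from this[THEN face_on_graph[OF 2]] show ?thesis by simp
  qed
next
  case False
  then show ?thesis using height_top[of a b] height_top[of a "b + 1"] height_bottom[of a b] height_bottom[of a "b + 1"]
    by auto
qed

lemma height_step_3: "height a b \<le> height (a + 1) (b + 1) + 1"
proof (cases "0 \<le> a + b \<and> a + b + 1 \<le> j")
  case True
  then consider c where "ipnt (a + 1 + c) (b + 1 + c) c \<in> S" "ipnt (a + 1 + c) (b + 1 + c) (c + 1) \<in> S"
    | c where "sq 3 (a + c) (b + c) c \<in> F" using surface_midpoint_3 by blast
  then show ?thesis
  proof cases
    case 1
    then have "on_graph j height (a + 1 + c) (b + 1 + c) c" "on_graph j height (a + 1 + c) (b + 1 + c) (c + 1)"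
      using ipnt_mem_surface by blast+
    from this[THEN on_graphD] show ?thesis by simp
  next
    case 2
    have "ipnt (a + c) (b + c) c \<in> sq 3 (a + c) (b + c) c"
      "ipnt (a + c + 1) (b + c + 1) c \<in> sq 3 (a + c) (b + c) c" unfolding ipnt_mem_sq by simp_all
    from this[THEN face_on_graph[OF 2]] show ?thesis by simp
  qed
next
  case False
  then show ?thesis
    using height_top[of a b] height_top[of "a + 1" "b + 1"] height_bottom[of a b] height_bottom[of "a + 1" "b + 1"]
    by auto
qed

text \<open>The order of the zigzags is prescribed only in projection. That the second also lies
  lower in space follows by walking along a row, on which heights never increase.\<close>

lemma r_nonpos: "r \<le> 0"
proof -
  have "height (int k) 0 \<le> 0" for k
  proof (induction k)
    case 0 then show ?case using height_top[of 0 0] by simp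
  next
    case (Suc k) then show ?case using height_step_1[of "int k" 0] by (simp add: add.commute)
  qed
  from this[of "nat j"] height_bottom[of j 0] j_nonneg show ?thesis by simp
qed

lemma height_function_height: "height_function (nat (- r)) j height"
  using height_step_1 height_step_2 height_step_3 height_top height_bottom r_nonpos
  unfolding height_function_def by auto

text \<open>For a square permitted by the heights, the midpoint of its short diagonal is probed. The
  heights at the two ends exclude an edge of the surface there, so the probe returns a face, and the
  heights identify it with the square.\<close>

lemma faces_eq: "F = faces_of j height"
proof (intro equalityI subsetI)
  fix f assume "f \<in> F"
  then show "f \<in> faces_of j height"
    using faces_unit face_sub ipnt_mem_surface unfolding faces_of_def by blast
next
  fix f assume f: "f \<in> faces_of j height"
  then show "f \<in> F"
  proof (cases rule: faces_ofE)
    case (1 x y z)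
    \<comment> \<open>Of the four vertices, the two ends of the short diagonal.\<close>
    then have on: "on_graph j height x y z" "on_graph j height x (y + 1) (z + 1)"
      using f sq_mem_faces_of_iff(1) by auto
    note h = on[THEN on_graphD]
    have "0 \<le> x - z - 1 + (y - z)" "x - z - 1 + (y - z) \<le> j" using on by (auto simp: on_graph_def)
    then consider c where "ipnt (x - z - 1 + c) (y - z + c) c \<in> S" "ipnt (x - z - 1 + 1 + c) (y - z + c) c \<in> S"
      | c where "sq 1 (x - z - 1 + 1 + c) (y - z + c) c \<in> F" using surface_midpoint_1 by blast
    then show ?thesis
    proof cases
      case (1 c)
      then have "on_graph j height (x - z - 1 + c) (y - z + c) c" "on_graph j height (x - z - 1 + 1 + c) (y - z + c) c"
        using ipnt_mem_surface by blast+
      from this[THEN on_graphD] h show ?thesis by (simp add: algebra_simps)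
    next
      case (2 c)
      have "ipnt (x - z - 1 + 1 + c) (y - z + c) c \<in> sq 1 (x - z - 1 + 1 + c) (y - z + c) c"
        unfolding ipnt_mem_sq by simp
      from face_on_graph[OF 2 this] h have "c = z" by simp
      then show ?thesis using 2 \<open>f = sq 1 x y z\<close> by simp
    qed
  next
    case (2 x y z)
    then have on: "on_graph j height x y z" "on_graph j height (x + 1) y (z + 1)"
      using f sq_mem_faces_of_iff(2) by auto
    note h = on[THEN on_graphD]
    have "0 \<le> x - z + (y - z - 1)" "x - z + (y - z - 1) \<le> j" using on by (auto simp: on_graph_def)
    then consider c where "ipnt (x - z + c) (y - z - 1 + c) c \<in> S" "ipnt (x - z + c) (y - z - 1 + 1 + c) c \<in> S"
      | c where "sq 2 (x - z + c) (y - z - 1 + 1 + c) c \<in> F" using surface_midpoint_2 by blast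
    then show ?thesis
    proof cases
      case (1 c)
      then have "on_graph j height (x - z + c) (y - z - 1 + c) c" "on_graph j height (x - z + c) (y - z - 1 + 1 + c) c"
        using ipnt_mem_surface by blast+
      from this[THEN on_graphD] h show ?thesis by (simp add: algebra_simps)
    next
      case c: (2 c)
      have "ipnt (x - z + c) (y - z - 1 + 1 + c) c \<in> sq 2 (x - z + c) (y - z - 1 + 1 + c) c"
        unfolding ipnt_mem_sq by simp
      from face_on_graph[OF c this] h have "c = z" by simp
      then show ?thesis using c 2 by simp
    qed
  next
    case (3 x y z)
    then have on: "on_graph j height x y z" "on_graph j height (x + 1) (y + 1) z"
      using f sq_mem_faces_of_iff(3) by auto
    note h = on[THEN on_graphD]
    have "0 \<le> x - z + (y - z)" "x - z + (y - z) + 1 \<le> j" using on by (auto simp: on_graph_def)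
    then consider c where "ipnt (x - z + 1 + c) (y - z + 1 + c) c \<in> S" "ipnt (x - z + 1 + c) (y - z + 1 + c) (c + 1) \<in> S"
      | c where "sq 3 (x - z + c) (y - z + c) c \<in> F" using surface_midpoint_3 by blast
    then show ?thesis
    proof cases
      case (1 c)
      then have "on_graph j height (x - z + 1 + c) (y - z + 1 + c) c" "on_graph j height (x - z + 1 + c) (y - z + 1 + c) (c + 1)"
        using ipnt_mem_surface by blast+
      from this[THEN on_graphD] h show ?thesis by (simp add: algebra_simps)
    next
      case (2 c)
      have "ipnt (x - z + c) (y - z + c) c \<in> sq 3 (x - z + c) (y - z + c) c"
        unfolding ipnt_mem_sq by simp
      from face_on_graph[OF 2 this] h have "c = z" by simp
      then show ?thesis using 2 3 by simp
    qed
  qed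
qed

end

section \<open>The cliff of a height function\<close>

context lattice_frame
begin

lemma on_graph_shift: "on_graph j g (a + c) (b + c) c \<longleftrightarrow> 0 \<le> a + b \<and> a + b \<le> j + 1 \<and> g a b = c"
  by (auto simp: on_graph_def)

lemma zigzag_box:
  assumes "v \<in> zigzag_from (ipnt p q r)"
  shows "\<exists>x y x' y'. of_int x \<le> xc v \<and> xc v \<le> of_int x' \<and> of_int y \<le> yc v \<and> yc v \<le> of_int y' \<and>
    x + y = p + q \<and> x' + y' = p + q + 1"
proof -
  from assms have "stair (p + q) (xc v) (yc v)" by (simp add: mem_zigzag_from)
  then obtain k :: int where
    "(yc v = of_int (p + q - k) \<and> of_int k \<le> xc v \<and> xc v \<le> of_int k + 1) \<or>
     (xc v = of_int k + 1 \<and> of_int (p + q - k) - 1 \<le> yc v \<and> yc v \<le> of_int (p + q - k))"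
    unfolding stair_def by blast
  then show ?thesis
  proof
    assume "yc v = of_int (p + q - k) \<and> of_int k \<le> xc v \<and> xc v \<le> of_int k + 1"
    then show ?thesis
      by (intro exI[of _ k] exI[of _ "p + q - k"] exI[of _ "k + 1"]) auto
  next
    assume "xc v = of_int k + 1 \<and> of_int (p + q - k) - 1 \<le> yc v \<and> yc v \<le> of_int (p + q - k)"
    then show ?thesis
      by (intro exI[of _ "k + 1"] exI[of _ "p + q - k - 1"] exI[of _ "p + q - k"]) auto
  qed
qed

end

text \<open>A zigzag depends only on its height and on the sum of the first two coordinates of its
  base point. The base point (0, s, -n) gives the staircase index s + 2 n in projection.\<close>

locale graph_frame = lattice_frame +
  fixes n s :: nat and j :: int and g :: "int \<Rightarrow> int \<Rightarrow> int" and B :: "(real ^ 3) set"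
  assumes g: "height_function n j g" and j: "j = 2 * int n + int s"
    and B: "B = zigzag_from (ipnt 0 (int s) (- int n))"
begin

abbreviation S where "S \<equiv> surface B (faces_of j g)"

lemma zigzags_on_graph:
  "x + y = 0 \<or> x + y = 1 \<Longrightarrow> g (x - 0) (y - 0) = 0"
  "x + y = int s \<or> x + y = int s + 1 \<Longrightarrow> g (x - (- int n)) (y - (- int n)) = - int n"
proof -
  show "x + y = 0 \<or> x + y = 1 \<Longrightarrow> g (x - 0) (y - 0) = 0"
    using height_functionD(4)[OF g, of x y] by auto
  assume "x + y = int s \<or> x + y = int s + 1"
  then have "j \<le> x + int n + (y + int n)" using j by linarith
  then show "g (x - (- int n)) (y - (- int n)) = - int n"
    using height_functionD(5)[OF g, of "x + int n" "y + int n"] by simp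
qed

lemma surface_boxI:
  assumes "of_int x \<le> xc v" "xc v \<le> of_int x'" "of_int y \<le> yc v" "yc v \<le> of_int y'"
    "of_int z \<le> zc v" "zc v \<le> of_int z'" "g (x - z) (y - z) = z" "g (x' - z') (y' - z') = z'"
  shows "\<exists>x y z x' y' z'. of_int x \<le> xc v \<and> xc v \<le> of_int x' \<and> of_int y \<le> yc v \<and> yc v \<le> of_int y' \<and>
    of_int z \<le> zc v \<and> zc v \<le> of_int z' \<and> g (x - z) (y - z) = z \<and> g (x' - z') (y' - z') = z'"
  by (intro exI conjI) (fact assms)+

text \<open>The two bounds are the lowest and the highest vertex of a face, or vertices at the ends
  of a zigzag edge. They carry injectivity from real points over to vertices.\<close>

lemma surface_box:
  assumes "v \<in> S"
  shows "\<exists>x y z x' y' z'. of_int x \<le> xc v \<and> xc v \<le> of_int x' \<and> of_int y \<le> yc v \<and> yc v \<le> of_int y' \<and>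
    of_int z \<le> zc v \<and> zc v \<le> of_int z' \<and> g (x - z) (y - z) = z \<and> g (x' - z') (y' - z') = z'"
proof -
  consider f where "f \<in> faces_of j g" "v \<in> f" | "v \<in> zigzag_from (ipnt 0 0 0)" | "v \<in> B"
    using assms P_eq_pnt by (auto simp: surface_def)
  then show ?thesis
  proof cases
    case (1 f)
    from 1(1) show ?thesis
    proof (cases rule: faces_ofE)
      case f: (1 x y z)
      then have on: "on_graph j g x y z" "on_graph j g x (y + 1) (z + 1)"
        using 1(1) sq_mem_faces_of_iff(1) by auto
      show ?thesis using 1(2) on unfolding f mem_sq on_graph_def
        by (intro surface_boxI[of x v x y "y + 1" z "z + 1"]) auto
    next
      case f: (2 x y z)
      then have on: "on_graph j g x y z" "on_graph j g (x + 1) y (z + 1)"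
        using 1(1) sq_mem_faces_of_iff(2) by auto
      show ?thesis using 1(2) on unfolding f mem_sq on_graph_def
        by (intro surface_boxI[of x v "x + 1" y y z "z + 1"]) auto
    next
      case f: (3 x y z)
      then have on: "on_graph j g x y z" "on_graph j g (x + 1) (y + 1) z"
        using 1(1) sq_mem_faces_of_iff(3) by auto
      show ?thesis using 1(2) on unfolding f mem_sq on_graph_def
        by (intro surface_boxI[of x v "x + 1" y "y + 1" z z]) auto
    qed
  next
    case 2
    then obtain x y x' y' where *: "of_int x \<le> xc v" "xc v \<le> of_int x'" "of_int y \<le> yc v" "yc v \<le> of_int y'"
      "x + y = 0 + 0" "x' + y' = 0 + 0 + 1" using zigzag_box[OF 2] by blast
    have "zc v = of_int 0" using 2 by (simp add: mem_zigzag_from)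
    then show ?thesis using * zigzags_on_graph(1)[of x y] zigzags_on_graph(1)[of x' y']
      by (intro surface_boxI[of x v x' y y' 0 0]) simp_all
  next
    case 3
    then obtain x y x' y' where *: "of_int x \<le> xc v" "xc v \<le> of_int x'" "of_int y \<le> yc v" "yc v \<le> of_int y'"
      "x + y = 0 + int s" "x' + y' = 0 + int s + 1" using zigzag_box[OF 3[unfolded B]] by blast
    have "zc v = of_int (- int n)" using 3 unfolding B by (simp add: mem_zigzag_from)
    then show ?thesis using * zigzags_on_graph(2)[of x y] zigzags_on_graph(2)[of x' y']
      by (intro surface_boxI[of x v x' y y' "- int n" "- int n"]) simp_all
  qed
qed

text \<open>Distinct points with the same projection are strictly ordered in all three coordinates.
  The lower bounding vertex of one and the upper bounding vertex of the other inherit this order,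
  against \<open>height_function_antichain\<close>.\<close>

lemma surface_inj:
  assumes "v \<in> S" "w \<in> S" "al v = al w" "be v = be w"
  shows "v = w"
proof -
  have no: False if vw: "v \<in> S" "w \<in> S" "al v = al w" "be v = be w" "zc v < zc w" for v w
  proof -
    obtain x y z where v: "of_int x \<le> xc v" "of_int y \<le> yc v" "of_int z \<le> zc v" "g (x - z) (y - z) = z"
      using surface_box[OF vw(1)] by blast
    obtain x' y' z' where w: "xc w \<le> of_int x'" "yc w \<le> of_int y'" "zc w \<le> of_int z'" "g (x' - z') (y' - z') = z'"
      using surface_box[OF vw(2)] by blast
    have "xc v < xc w" "yc v < yc w" using vw(3-5) unfolding al_def be_def by linarith+
    then have "real_of_int x < of_int x'" "real_of_int y < of_int y'" "real_of_int z < of_int z'"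
      using v w vw(5) by linarith+
    then show False using height_function_antichain[OF g v(4) w(4)] by simp
  qed
  have "zc v = zc w" using no[of v w] no[of w v] assms by force
  then show ?thesis using assms(3,4) unfolding vec_eq_iff_coords al_def be_def by simp
qed

lemma strip_if_mem_face:
  assumes "f \<in> faces_of j g" "v \<in> f"
  shows "strip j (al v) (be v)"
  using assms(1)
proof (cases rule: faces_ofE)
  case f: (1 x y z)
  then have on: "on_graph j g x y (z + 1)" "on_graph j g x (y + 1) z"
    using assms(1) sq_mem_faces_of_iff(1) by auto
  show ?thesis
    using assms(2) on unfolding f mem_sq on_graph_def al_def be_def
    by (intro strip_if_box[of "x - z - 1" _ "y - z - 1" _ "x - z" "y - z + 1"]) auto
next
  case f: (2 x y z)
  then have on: "on_graph j g x y (z + 1)" "on_graph j g (x + 1) y z"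
    using assms(1) sq_mem_faces_of_iff(2) by auto
  show ?thesis
    using assms(2) on unfolding f mem_sq on_graph_def al_def be_def
    by (intro strip_if_box[of "x - z - 1" _ "y - z - 1" _ "x - z + 1" "y - z"]) auto
next
  case f: (3 x y z)
  then have on: "on_graph j g x y z" "on_graph j g (x + 1) (y + 1) z"
    using assms(1) sq_mem_faces_of_iff(3) by auto
  show ?thesis
    using assms(2) on unfolding f mem_sq on_graph_def al_def be_def
    by (intro strip_if_box[of "x - z" _ "y - z" _ "x - z + 1" "y - z + 1"]) auto
qed

lemma strip_if_mem_surface:
  assumes "v \<in> S"
  shows "strip j (al v) (be v)"
proof -
  consider f where "f \<in> faces_of j g" "v \<in> f" | "v \<in> zigzag_from (ipnt 0 0 0)" | "v \<in> B"
    using assms P_eq_pnt by (auto simp: surface_def)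
  then show ?thesis
  proof cases
    case 2
    then have "stair 0 (al v) (be v)" by (simp add: mem_zigzag_from al_def be_def)
    then show ?thesis by (rule strip_if_stair) (simp_all add: j)
  next
    case 3
    then have "zc v = of_int (- int n)" "stair (0 + int s) (xc v) (yc v)" unfolding B mem_zigzag_from by auto
    then have "stair (int s) (al v + of_int (- int n)) (be v + of_int (- int n))" by (simp add: al_def be_def)
    then have "stair j (al v) (be v)" unfolding stair_shift by (simp add: j algebra_simps)
    then show ?thesis by (rule strip_if_stair) (simp_all add: j)
  qed (rule strip_if_mem_face)
qed

text \<open>The unit triangle around a point has exactly one edge that is the short diagonal of a face.\<close>

lemma surface_covers:
  assumes strip: "strip j \<alpha> \<beta>"
  shows "\<exists>v\<in>S. al v = \<alpha> \<and> be v = \<beta>"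
proof (cases "j \<le> \<lfloor>\<alpha>\<rfloor> + \<lfloor>\<beta>\<rfloor>")
  case True
  then have "stair j \<alpha> \<beta>" using stair_if_strip_bottom strip by blast
  then have "stair (int s) (\<alpha> + of_int (- int n)) (\<beta> + of_int (- int n))"
    unfolding stair_shift by (simp add: j algebra_simps)
  then have "pnt (\<alpha> - n) (\<beta> - n) (- real n) \<in> B" unfolding B mem_zigzag_from by simp
  then show ?thesis by (intro bexI[of _ "pnt (\<alpha> - n) (\<beta> - n) (- real n)"]) (auto simp: surface_def)
next
  case False
  define a b where "a = \<lfloor>\<alpha>\<rfloor>" and "b = \<lfloor>\<beta>\<rfloor>"
  have ab: "of_int a \<le> \<alpha>" "\<alpha> \<le> of_int a + 1" "of_int b \<le> \<beta>" "\<beta> \<le> of_int b + 1" "0 \<le> a + b" "a + b + 1 \<le> j"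
    using False strip_floor[OF strip] unfolding a_def b_def by linarith+
  note D = height_functionD[OF g]
  have witness: ?thesis if "sq i x y z \<in> faces_of j g" "v \<in> sq i x y z" "al v = \<alpha>" "be v = \<beta>" for i x y z v
    using that by (intro bexI[of _ v]) (auto simp: surface_def)
  consider "g a b = g (a + 1) (b + 1)" | "g a b = g (a + 1) (b + 1) + 1"
    using D(1)[of a b] D(2)[of "a + 1" b] D(3)[of a b] by linarith
  then show ?thesis
  proof cases
    case 1
    define z where "z = g a b"
    have "g (a + 1) b = z" "g a (b + 1) = z" "g (a + 1) (b + 1) = z"
      using 1 D(1)[of a b] D(2)[of "a + 1" b] D(2)[of a b] D(1)[of a "b + 1"] unfolding z_def by linarith+
    then have "sq 3 (a + z) (b + z) z \<in> faces_of j g"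
      using ab unfolding sq_mem_faces_of_iff by (simp add: on_graph_def z_def)
    then show ?thesis
      by (rule witness[of _ _ _ _ "pnt (\<alpha> + z) (\<beta> + z) z"]) (use ab in \<open>auto simp: mem_sq\<close>)
  next
    case 2
    define z where "z = g (a + 1) (b + 1)"
    have gab: "g a b = z + 1" using 2 by (simp add: z_def)
    \<comment> \<open>The lattice edge from (a, b) to (a + 1, b + 1) halves the unit cell, and the
      comparison selects the triangle that contains the point. Since the height drops by one along
      this edge, it drops along exactly one of the other two edges of the triangle.\<close>
    show ?thesis
    proof (cases "\<beta> - of_int b \<le> \<alpha> - of_int a")
      case le: True
      consider "g (a + 1) b = z" | "g (a + 1) b = z + 1"
        using D(1)[of a b] D(2)[of "a + 1" b] gab unfolding z_def by linarith
      then show ?thesis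
      proof cases
        case 1
        have "g a (b - 1) = z + 1" using D(2)[of a "b - 1"] D(3)[of a "b - 1"] 1 gab by simp
        \<comment> \<open>The face extends beyond the triangle to a vertex over (a, b - 1), which
          still has to lie in the strip. Near the upper border the heights are constant, so no drop
          could occur there.\<close>
        moreover have "0 < a + b" using D(4)[of a b] D(4)[of "a + 1" b] ab(5) 1 gab by linarith
        ultimately have "sq 1 (a + 1 + z) (b + z) z \<in> faces_of j g"
          using ab 1 gab unfolding sq_mem_faces_of_iff by (simp add: on_graph_def z_def)
        then show ?thesis
          by (rule witness[of _ _ _ _ "pnt (a + 1 + z) (\<beta> - \<alpha> + (a + 1 + z)) (a + 1 + z - \<alpha>)"])
            (use ab le in \<open>auto simp: mem_sq\<close>)
      next
        case 2
        have "g (a + 2) (b + 1) = z"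
          using D(1)[of "a + 1" "b + 1"] D(3)[of "a + 1" b] 2 unfolding z_def by (simp add: algebra_simps)
        moreover have "a + b + 2 \<le> j"
          using D(5)[of "a + 1" b] D(5)[of "a + 1" "b + 1"] ab(6) 2 unfolding z_def by linarith
        ultimately have "sq 2 (a + 1 + z) (b + 1 + z) z \<in> faces_of j g"
          using ab 2 gab unfolding sq_mem_faces_of_iff by (simp add: on_graph_def z_def add.commute)
        then show ?thesis
          by (rule witness[of _ _ _ _ "pnt (\<alpha> - \<beta> + (b + 1 + z)) (b + 1 + z) (b + 1 + z - \<beta>)"])
            (use ab le in \<open>auto simp: mem_sq\<close>)
      qed
    next
      case gt: False
      consider "g a (b + 1) = z" | "g a (b + 1) = z + 1"
        using D(2)[of a b] D(1)[of a "b + 1"] gab unfolding z_def by linarith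
      then show ?thesis
      proof cases
        case 1
        have "g (a - 1) b = z + 1" using D(1)[of "a - 1" b] D(3)[of "a - 1" b] 1 gab by simp
        moreover have "0 < a + b" using D(4)[of a b] D(4)[of a "b + 1"] ab(5) 1 gab by linarith
        ultimately have "sq 2 (a + z) (b + 1 + z) z \<in> faces_of j g"
          using ab 1 gab unfolding sq_mem_faces_of_iff by (simp add: on_graph_def z_def)
        then show ?thesis
          by (rule witness[of _ _ _ _ "pnt (\<alpha> - \<beta> + (b + 1 + z)) (b + 1 + z) (b + 1 + z - \<beta>)"])
            (use ab gt in \<open>auto simp: mem_sq\<close>)
      next
        case 2
        have "g (a + 1) (b + 2) = z"
          using D(2)[of "a + 1" "b + 1"] D(3)[of a "b + 1"] 2 unfolding z_def by (simp add: algebra_simps)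
        moreover have "a + b + 2 \<le> j"
          using D(5)[of a "b + 1"] D(5)[of "a + 1" "b + 1"] ab(6) 2 unfolding z_def by linarith
        ultimately have "sq 1 (a + 1 + z) (b + 1 + z) z \<in> faces_of j g"
          using ab 2 gab unfolding sq_mem_faces_of_iff by (simp add: on_graph_def z_def add.commute)
        then show ?thesis
          by (rule witness[of _ _ _ _ "pnt (a + 1 + z) (\<beta> - \<alpha> + (a + 1 + z)) (a + 1 + z - \<alpha>)"])
            (use ab gt in \<open>auto simp: mem_sq\<close>)
      qed
    qed
  qed
qed

lemma cliff_faces_of: "cliff upper B (faces_of j g)"
proof -
  have "0 + int s - 2 * - int n = j" by (simp add: j)
  moreover have "faces_of j g \<subseteq> unit_squares" by (auto simp: faces_of_def)
  ultimately show ?thesis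
    unfolding cliff_iff[OF B] using surface_inj surface_covers strip_if_mem_surface by metis
qed

lemma ipnt_mem_surface_graph:
  assumes "ipnt x y z \<in> S"
  shows "g (x - z) (y - z) = z"
proof -
  consider f where "f \<in> faces_of j g" "ipnt x y z \<in> f" | "ipnt x y z \<in> zigzag_from (ipnt 0 0 0)" | "ipnt x y z \<in> B"
    using assms P_eq_pnt by (auto simp: surface_def)
  then show ?thesis
  proof cases
    case 1 then show ?thesis by (auto simp: faces_of_def on_graph_def)
  next
    case 2
    then show ?thesis using zigzags_on_graph(1)[of x y] by (auto simp: mem_zigzag_from stair_int_iff)
  next
    case 3
    then have "real_of_int z = of_int (- int n)" "stair (0 + int s) (of_int x) (of_int y)"
      unfolding B mem_zigzag_from ipnt_coords by simp_all
    then have "z = - int n" "x + y = int s \<or> x + y = int s + 1" unfolding of_int_eq_iff stair_int_iff by simp_all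
    then show ?thesis using zigzags_on_graph(2)[of x y] by blast
  qed
qed

end

section \<open>Displacement, periods and height\<close>

context lattice_frame
begin

text \<open>A slice consists of the columns over cells with fixed x, and each column has one top.
  Tops with x + y outside the range from 0 to j - 2 n - 1 have height 0 or -n and project outside
  the strip. Hence every slice has j - 2 n horizontal faces, and the displacement fixes the distance
  of the zigzags.\<close>

lemma displacement_iff:
  assumes g: "height_function n j g" and j: "0 \<le> j"
  shows "has_horizontal_displacement (faces_of j g) s \<longleftrightarrow> j = 2 * int n + int s"
proof -
  obtain P1 where P1: "P $ 1 = of_int P1" using lattice_ex by blast
  define K where "K = (\<lambda>x. {(y, z). sq 3 x y z \<in> faces_of j g})"
  have slab: "sq 3 x y z \<subseteq> {v. of_int i \<le> v $ 1 \<and> v $ 1 \<le> of_int i + 1} \<longleftrightarrow> x = i - P1" for x y z i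
  proof
    assume *: "sq 3 x y z \<subseteq> {v. of_int i \<le> v $ 1 \<and> v $ 1 \<le> of_int i + 1}"
    have "ipnt x y z \<in> sq 3 x y z" "ipnt (x + 1) y z \<in> sq 3 x y z" unfolding ipnt_mem_sq by auto
    then have "of_int i \<le> ipnt x y z $ 1" "ipnt (x + 1) y z $ 1 \<le> of_int i + 1" using * by auto
    then have "of_int i \<le> xc (ipnt x y z) + of_int P1" "xc (ipnt (x + 1) y z) + of_int P1 \<le> of_int i + 1"
      by (simp_all add: xc_def P1 del: ipnt_coords)
    then show "x = i - P1" unfolding ipnt_coords by linarith
  next
    assume "x = i - P1"
    then show "sq 3 x y z \<subseteq> {v. of_int i \<le> v $ 1 \<and> v $ 1 \<le> of_int i + 1}"
      by (auto simp: mem_sq xc_def P1)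
  qed
  have faces: "{f \<in> faces_of j g \<inter> horizontal_squares. f \<subseteq> {v. of_int i \<le> v $ 1 \<and> v $ 1 \<le> of_int i + 1}} =
      (\<lambda>(y, z). sq 3 (i - P1) y z) ` K (i - P1)" for i
  proof (intro equalityI subsetI)
    fix f assume "f \<in> {f \<in> faces_of j g \<inter> horizontal_squares. f \<subseteq> {v. of_int i \<le> v $ 1 \<and> v $ 1 \<le> of_int i + 1}}"
    then obtain x y z where f: "f \<in> faces_of j g" "f = sq 3 x y z" "f \<subseteq> {v. of_int i \<le> v $ 1 \<and> v $ 1 \<le> of_int i + 1}"
      unfolding horizontal_squares_eq by blast
    then have "x = i - P1" using slab by simp
    then show "f \<in> (\<lambda>(y, z). sq 3 (i - P1) y z) ` K (i - P1)"
      using f unfolding K_def by (intro image_eqI[of _ _ "(y, z)"]) simp_all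
  next
    fix f assume "f \<in> (\<lambda>(y, z). sq 3 (i - P1) y z) ` K (i - P1)"
    then obtain y z where "f = sq 3 (i - P1) y z" "f \<in> faces_of j g" unfolding K_def by auto
    then show "f \<in> {f \<in> faces_of j g \<inter> horizontal_squares. f \<subseteq> {v. of_int i \<le> v $ 1 \<and> v $ 1 \<le> of_int i + 1}}"
      using slab[of "i - P1" y z i] unfolding horizontal_squares_eq by blast
  qed
  let ?D = "\<lambda>x y z. z \<le> g (x + 1 - z) (y + 1 - z)"
  \<comment> \<open>A square is a face exactly if it is the top of its column in the ideal given by
    \<open>?D\<close>.\<close>
  have K: "K x = {(y, z). ?D x y z \<and> \<not> ?D x y (z + 1) \<and> 0 \<le> x + y \<and> x + y < j - 2 * int n}" for x
  proof -
    have "sq 3 x y z \<in> faces_of j g \<longleftrightarrow> ?D x y z \<and> \<not> ?D x y (z + 1) \<and> 0 \<le> x + y \<and> x + y < j - 2 * int n" for y z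
    proof
      assume "sq 3 x y z \<in> faces_of j g"
      then have on: "on_graph j g x y z" "on_graph j g (x + 1) (y + 1) z" unfolding sq_mem_faces_of_iff by auto
      then have D: "?D x y z" "\<not> ?D x y (z + 1)" by (auto simp: on_graph_def)
      have strip: "0 \<le> x + y - 2 * z" "x + y - 2 * z \<le> j - 1" using on by (auto simp: on_graph_def)
      have z: "z \<le> 0" using D(1) height_function_bounds(1)[OF g] by (meson order_trans)
      have "0 \<le> x + y"
      proof (rule ccontr)
        assume neg: "\<not> 0 \<le> x + y"
        then have "0 \<le> g (x + 1 - 0) (y + 1 - 0)" using height_functionD(4)[OF g, of "x + 1" "y + 1"] by simp
        then have "\<not> z + 1 \<le> 0" using height_function_ideal_down[OF g, of 0 x y "z + 1"] D(2) by auto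
        then show False using z strip neg by simp
      qed
      moreover have "x + y < j - 2 * int n"
      proof (rule ccontr)
        assume ge: "\<not> x + y < j - 2 * int n"
        then have "\<not> ?D x y (1 - int n)" using height_functionD(5)[OF g, of "x + int n" "y + int n"] by simp
        then have "\<not> 1 - int n \<le> z" using height_function_ideal_down[OF g D(1)] by blast
        then show False using strip ge by simp
      qed
      ultimately show "?D x y z \<and> \<not> ?D x y (z + 1) \<and> 0 \<le> x + y \<and> x + y < j - 2 * int n" using D by simp
    next
      assume *: "?D x y z \<and> \<not> ?D x y (z + 1) \<and> 0 \<le> x + y \<and> x + y < j - 2 * int n"
      have "g (x + 1 - z) (y + 1 - z) \<le> g (x - z) (y + 1 - z)" "g (x - z) (y + 1 - z) \<le> g (x - z) (y - z)"
        "g (x + 1 - z) (y + 1 - z) \<le> g (x + 1 - z) (y - z)" "g (x + 1 - z) (y - z) \<le> g (x - z) (y - z)"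
        by (simp_all add: height_function_antimono[OF g])
      moreover have "g (x - z) (y - z) \<le> z" "z \<le> g (x + 1 - z) (y + 1 - z)" using * by auto
      ultimately have eq: "g (x + 1 - z) (y + 1 - z) = z" "g (x - z) (y + 1 - z) = z"
        "g (x + 1 - z) (y - z) = z" "g (x - z) (y - z) = z" by linarith+
      have "z \<le> 0" using eq(1) height_function_bounds(1)[OF g] by metis
      moreover have "x + y - 2 * z < j"
        using height_functionD(5)[OF g, of "x - z" "y - z"] eq(4) * by linarith
      ultimately show "sq 3 x y z \<in> faces_of j g"
        unfolding sq_mem_faces_of_iff on_graph_def using eq * by simp
    qed
    then show ?thesis unfolding K_def by simp
  qed
  have inj: "inj_on fst (K x)" for x
  proof (rule inj_onI, clarify)
    fix y z y' z' assume *: "(y, z) \<in> K x" "(y', z') \<in> K x" "fst (y, z) = fst (y', z')"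
    then have D: "?D x y z" "\<not> ?D x y (z + 1)" "?D x y z'" "\<not> ?D x y (z' + 1)" unfolding K by auto
    have "\<not> z + 1 \<le> z'" "\<not> z' + 1 \<le> z"
      using height_function_ideal_down[OF g D(3)] height_function_ideal_down[OF g D(1)] D(2,4) by blast+
    then show "y = y' \<and> z = z'" using * by auto
  qed
  have img: "fst ` K x = {- x..<- x + (j - 2 * int n)}" for x
  proof (intro equalityI subsetI)
    fix y assume "y \<in> {- x..<- x + (j - 2 * int n)}"
    then have y: "0 \<le> x + y" "x + y < j - 2 * int n" by auto
    have "\<exists>t. \<forall>z. ?D x y z \<longleftrightarrow> z \<le> t"
    proof (rule int_cut_exists)
      show "?D x y z" if "?D x y (z + 1)" for z using height_function_ideal_down[OF g that] by simp
      show "?D x y (- int n)" by (rule height_function_bounds(2)[OF g])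
      show "\<not> ?D x y 1" using height_function_bounds(1)[OF g, of "x + 1 - 1" "y + 1 - 1"] by linarith
    qed
    then obtain t where t: "\<And>z. ?D x y z \<longleftrightarrow> z \<le> t" by blast
    have "(y, t) \<in> K x" unfolding K using y t[of t] t[of "t + 1"] by simp
    then show "y \<in> fst ` K x" by force
  qed (auto simp: K)
  have card: "finite (K x) \<and> card (K x) = nat (j - 2 * int n)" for x
    using inj[of x] img[of x] finite_image_iff[OF inj] card_image[OF inj] by (metis card_atLeastLessThan_int finite_atLeastLessThan_int add_diff_cancel_left')
  have "inj_on (\<lambda>(y, z). sq 3 (i - P1) y z) (K (i - P1))" for i
    by (auto simp: inj_on_def sq_3_inj)
  then have "has_horizontal_displacement (faces_of j g) s \<longleftrightarrow> nat (j - 2 * int n) = s"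
    unfolding has_horizontal_displacement_def Let_def faces using card by (simp add: card_image)
  \<comment> \<open>The bound \<open>2 * n \<le> j\<close> ensures that \<open>nat\<close> does not
    truncate.\<close>
  then show ?thesis using height_function_length[OF g j] by auto
qed

definition along :: "int \<Rightarrow> real ^ 3" where
  "along k = vector [of_int k, - of_int k, 0]"

lemma along_coords: "along k $ 1 = of_int k" "along k $ 2 = - of_int k" "along k $ 3 = 0"
  by (simp_all add: along_def)

lemma along_minus: "along (- k) = - along k"
  by (simp add: vec_eq_iff forall_3 along_coords)

lemma coords_add_along [simp]: "xc (along k + v) = xc v + of_int k" "yc (along k + v) = yc v - of_int k"
  "zc (along k + v) = zc v" "al (along k + v) = al v + of_int k" "be (along k + v) = be v - of_int k"
  by (simp_all add: xc_def yc_def zc_def al_def be_def along_coords)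

lemma mem_translate_iff: "w \<in> (+) (along k) ` X \<longleftrightarrow> along (- k) + w \<in> X"
  by (auto simp: along_minus image_iff intro: bexI[of _ "- along k + w"])

lemma translate_sq: "(+) (along k) ` sq i x y z = sq i (x + k) (y - k) z"
  by (rule sq_cases[of i]) (auto simp: set_eq_iff mem_translate_iff mem_sq)

lemma translate_zigzag: "(+) (along k) ` zigzag_from (ipnt p q r) = zigzag_from (ipnt p q r)"
proof -
  have "stair (p + q) (\<alpha> - of_int k) (\<beta> + of_int k) \<longleftrightarrow> stair (p + q) \<alpha> \<beta>" for \<alpha> \<beta>
    using stair_shift[of "p + q" \<alpha> "- k" \<beta> k] by simp
  then show ?thesis by (auto simp: set_eq_iff mem_translate_iff mem_zigzag_from)
qed

abbreviation translate :: "int \<Rightarrow> (real ^ 3) set set \<Rightarrow> (real ^ 3) set set" where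
  "translate k F \<equiv> (\<lambda>f. (+) (along k) ` f) ` F"

lemma translate_translate: "translate (- k) (translate k F) = F"
  by (simp add: image_image along_minus)

lemma translate_faces_of:
  assumes per: "\<And>a b. g (a + k) (b - k) = g a b"
  shows "translate k (faces_of j g) = faces_of j g"
proof -
  have sub: "translate k (faces_of j g) \<subseteq> faces_of j g" if per: "\<And>a b. g (a + k) (b - k) = g a b" for k
  proof
    fix f' assume "f' \<in> translate k (faces_of j g)"
    then obtain f where f: "f \<in> faces_of j g" "f' = (+) (along k) ` f" by blast
    then have "f' \<in> unit_squares" by (auto simp: faces_of_def unit_squares_eq translate_sq) blast
    moreover have "on_graph j g x y z" if "ipnt x y z \<in> f'" for x y z
    proof -
      have "along (- k) + ipnt x y z = ipnt (x - k) (y + k) z" by (simp add: vec_eq_iff_coords)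
      then have "ipnt (x - k) (y + k) z \<in> f" using that f(2) by (simp add: mem_translate_iff)
      then have "on_graph j g (x - k) (y + k) z" using f(1) by (simp add: faces_of_def)
      then show ?thesis using per[of "x - k - z" "y + k - z"] by (simp add: on_graph_def algebra_simps)
    qed
    ultimately show "f' \<in> faces_of j g" by (simp add: faces_of_def)
  qed
  have "g (a + (- k)) (b - (- k)) = g a b" for a b using per[of "a - k" "b + k"] by simp
  \<comment> \<open>The inclusion for \<open>- k\<close>, translated by \<open>k\<close>, is the
    missing reverse inclusion.\<close>
  from sub[OF this] have "translate k (translate (- k) (faces_of j g)) \<subseteq> translate k (faces_of j g)"
    by (rule image_mono)
  then show ?thesis using sub[OF per] translate_translate[of "- k"] by auto
qed

text \<open>A period maps P into the upper zigzag and some point of it to P, so both v and -v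
  satisfy the equations of the staircase. Coordinate sums on the staircase lie between 0 and 1,
  hence the sum of v is 0, and only vertices have that sum.\<close>

lemma zigzag_period_along:
  assumes "B = zigzag_from (ipnt p q r)"
  shows "zigzag_period upper B v \<longleftrightarrow> (\<exists>k. k \<noteq> 0 \<and> v = along k)"
proof
  assume v: "zigzag_period upper B v"
  note P = P_mem_upper
  have "v + P \<in> upper" using v P by (auto simp: zigzag_period_def)
  then have 1: "v $ 3 = 0" "stair 0 (v $ 1) (v $ 2)" by (simp_all add: mem_upper xc_def yc_def zc_def)
  obtain w where "w \<in> upper" "P = v + w" using v P unfolding zigzag_period_def by blast
  then have "w = P - v" by simp
  then have 2: "stair 0 (- (v $ 1)) (- (v $ 2))" using \<open>w \<in> upper\<close> by (simp add: mem_upper xc_def yc_def zc_def)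
  from 2 obtain l :: int where l: "(- (v $ 2) = of_int (0 - l) \<and> of_int l \<le> - (v $ 1) \<and> - (v $ 1) \<le> of_int l + 1) \<or>
     (- (v $ 1) = of_int l + 1 \<and> of_int (0 - l) - 1 \<le> - (v $ 2) \<and> - (v $ 2) \<le> of_int (0 - l))"
    unfolding stair_def by blast
  from 1(2) obtain k :: int where k: "(v $ 2 = of_int (0 - k) \<and> of_int k \<le> v $ 1 \<and> v $ 1 \<le> of_int k + 1) \<or>
     (v $ 1 = of_int k + 1 \<and> of_int (0 - k) - 1 \<le> v $ 2 \<and> v $ 2 \<le> of_int (0 - k))"
    unfolding stair_def by blast
  have "0 \<le> v $ 1 + v $ 2" using k by auto
  moreover have "0 \<le> - (v $ 1) + - (v $ 2)" using l by auto
  ultimately have "v $ 2 = - (v $ 1)" by simp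
  moreover obtain c :: int where "v $ 1 = of_int c"
  proof -
    have "v $ 1 = of_int k \<or> v $ 1 = of_int (k + 1)" using k \<open>v $ 2 = - (v $ 1)\<close> by auto
    then show ?thesis using that by blast
  qed
  ultimately have "v = along c" using 1(1) by (simp add: vec_eq_iff forall_3 along_coords)
  moreover have "c \<noteq> 0" using v \<open>v = along c\<close> by (auto simp: zigzag_period_def along_coords vec_eq_iff forall_3)
  ultimately show "\<exists>k. k \<noteq> 0 \<and> v = along k" by blast
next
  assume "\<exists>k. k \<noteq> 0 \<and> v = along k"
  then obtain k where k: "k \<noteq> 0" "v = along k" by blast
  then have "v \<noteq> 0" by (auto simp: along_coords vec_eq_iff forall_3)
  then show "zigzag_period upper B v"
    using translate_zigzag[of k 0 0 0] translate_zigzag[of k p q r] k P_eq_pnt assms by (simp add: zigzag_period_def)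
qed

lemma norm_along: "norm (along k) = \<bar>of_int k\<bar> * norm (along 1)"
proof -
  have "along k = of_int k *\<^sub>R along 1" by (simp add: vec_eq_iff forall_3 along_coords)
  then show ?thesis by simp
qed

text \<open>The shortest periods are \<open>along 1\<close> and its negative, and invariance under a
  translation is equivalent to invariance under the opposite one.\<close>

lemma periodic_cliff_iff:
  assumes B: "B = zigzag_from (ipnt p q r)"
  shows "periodic_cliff m upper B F \<longleftrightarrow> cliff upper B F \<and> translate (int m) F = F"
proof -
  have pos: "norm (along 1) > 0" using along_coords(1)[of 1] by auto
  have shortest: "(\<forall>w. zigzag_period upper B w \<longrightarrow> norm (along k) \<le> norm w) \<longleftrightarrow> k = 1 \<or> k = -1" if "k \<noteq> 0" for k
  proof
    assume "\<forall>w. zigzag_period upper B w \<longrightarrow> norm (along k) \<le> norm w"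
    then have "norm (along k) \<le> norm (along 1)" using zigzag_period_along[OF B] by (metis zero_neq_one)
    then have "\<bar>real_of_int k\<bar> \<le> 1" unfolding norm_along[of k] using pos by simp
    then show "k = 1 \<or> k = -1" using that by linarith
  next
    assume k: "k = 1 \<or> k = -1"
    show "\<forall>w. zigzag_period upper B w \<longrightarrow> norm (along k) \<le> norm w"
    proof (intro allI impI)
      fix w assume "zigzag_period upper B w"
      then obtain l where l: "l \<noteq> 0" "w = along l" using zigzag_period_along[OF B] by blast
      then have "\<bar>real_of_int k\<bar> \<le> \<bar>real_of_int l\<bar>" using k by auto
      then show "norm (along k) \<le> norm w" unfolding l(2) norm_along[of k] norm_along[of l]
        by (rule mult_right_mono) simp
    qed
  qed
  have scale: "real m *\<^sub>R along 1 = along (int m)" "real m *\<^sub>R along (- 1) = along (- int m)"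
    by (simp_all add: vec_eq_iff forall_3 along_coords)
  have neg: "translate (int m) F = F" if "translate (- int m) F = F"
    using translate_translate[of "- int m" F] that by simp
  show ?thesis
  proof
    assume "periodic_cliff m upper B F"
    then obtain v where v: "cliff upper B F" "zigzag_period upper B v"
      "\<forall>w. zigzag_period upper B w \<longrightarrow> norm v \<le> norm w" "(\<lambda>f. (+) (real m *\<^sub>R v) ` f) ` F = F"
      unfolding periodic_cliff_def by blast
    obtain k where k: "k \<noteq> 0" "v = along k" using v(2) zigzag_period_along[OF B] by blast
    then have "k = 1 \<or> k = -1" using shortest v(3) by blast
    then have "translate (int m) F = F"
    proof
      assume "k = 1" then show ?thesis using v(4) unfolding k(2) by (simp only: scale)
    next
      assume "k = -1"
      then have "translate (- int m) F = F" using v(4) unfolding k(2) by (simp only: scale)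
      then show ?thesis by (rule neg)
    qed
    then show "cliff upper B F \<and> translate (int m) F = F" using v(1) by blast
  next
    assume *: "cliff upper B F \<and> translate (int m) F = F"
    have "zigzag_period upper B (along 1)" using zigzag_period_along[OF B] by (metis zero_neq_one)
    then show "periodic_cliff m upper B F"
      unfolding periodic_cliff_def using * shortest[of 1] scale by (intro conjI exI[of _ "along 1"]) auto
  qed
qed

lemma has_height_iff:
  assumes B: "B = zigzag_from (ipnt p q r)"
  shows "has_height upper B (real n) \<longleftrightarrow> \<bar>r\<bar> = int n"
proof -
  have mem: "P \<in> upper" "ipnt p q r \<in> B"
    using P_mem_upper unfolding B mem_zigzag_from ipnt_coords stair_int_iff by simp_all
  have up: "x $ 3 = P $ 3" if "x \<in> upper" for x using that by (simp add: mem_upper zc_def)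
  have lo: "x $ 3 = P $ 3 + of_int r" if "x \<in> B" for x using that unfolding B by (simp add: mem_zigzag_from zc_def)
  have "has_height upper B (real n) \<longleftrightarrow> \<bar>P $ 3 - (P $ 3 + of_int r)\<bar> = real n"
    unfolding has_height_def
  proof
    assume "\<exists>a b. (\<forall>x\<in>upper. x $ 3 = a) \<and> (\<forall>x\<in>B. x $ 3 = b) \<and> \<bar>a - b\<bar> = real n"
    then obtain a b where "\<forall>x\<in>upper. x $ 3 = a" "\<forall>x\<in>B. x $ 3 = b" "\<bar>a - b\<bar> = real n" by blast
    moreover have "a = P $ 3" using mem(1) calculation(1) by simp
    moreover have "b = P $ 3 + of_int r" using mem(2) calculation(2) lo by force
    ultimately show "\<bar>P $ 3 - (P $ 3 + of_int r)\<bar> = real n" by simp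
  next
    assume "\<bar>P $ 3 - (P $ 3 + of_int r)\<bar> = real n"
    then show "\<exists>a b. (\<forall>x\<in>upper. x $ 3 = a) \<and> (\<forall>x\<in>B. x $ 3 = b) \<and> \<bar>a - b\<bar> = real n"
      using up lo by (intro exI[of _ "P $ 3"] exI[of _ "P $ 3 + of_int r"]) blast
  qed
  also have "\<dots> \<longleftrightarrow> \<bar>r\<bar> = int n" by linarith
  finally show ?thesis .
qed

end

context cliff_frame
begin

lemma height_periodic:
  assumes F: "translate k F = F"
  shows "height (a + k) (b - k) = height a b"
proof (cases "0 \<le> a + b \<and> a + b \<le> j + 1")
  case True
  have S: "along k + v \<in> S" if "v \<in> S" for v
  proof -
    have "along k + v \<in> f'" "f' \<in> F" if "v \<in> f" "f \<in> F" "f' = (+) (along k) ` f" for f f'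
      using that F by blast+
    moreover have "along k + v \<in> upper" if "v \<in> upper" using that translate_zigzag[of k 0 0 0] upper_eq by auto
    moreover have "along k + v \<in> B" if "v \<in> B" using that translate_zigzag[of k p q r] B by auto
    ultimately show ?thesis using \<open>v \<in> S\<close> unfolding surface_def by blast
  qed
  define z where "z = height a b"
  have "on_graph j height (a + z) (b + z) z" unfolding on_graph_shift using True by (simp add: z_def)
  then have "along k + ipnt (a + z) (b + z) z \<in> S" using S ipnt_mem_surface by blast
  moreover have "along k + ipnt (a + z) (b + z) z = ipnt (a + k + z) (b - k + z) z"
    by (simp add: vec_eq_iff_coords)
  ultimately have "on_graph j height (a + k + z) (b - k + z) z" using ipnt_mem_surface by simp
  then show ?thesis unfolding on_graph_shift by (simp add: z_def)
next
  case False
  then show ?thesis by (auto simp: height_def)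
qed

end

section \<open>Counting cliffs\<close>

context lattice_frame
begin

text \<open>An element of \<open>cliffs\<close> does not record its lower zigzag. The height forces
  r = -n, and the displacement forces p + q - 2 r = 2 n + s, so the zigzag is determined by these
  numbers.\<close>

lemma card_cliffs: "card (cliffs upper m n s) = card (heights m n s)"
proof -
  let ?j = "2 * int n + int s"
  have graph: "graph_frame P n s ?j g (zigzag_from (ipnt 0 (int s) (- int n)))" if "g \<in> heights m n s" for g
    using that by unfold_locales (auto simp: heights_def)
  show ?thesis
  proof (rule card_eq_if_matching[of _ _ "\<lambda>F g. F = faces_of ?j g"])
    fix F assume "F \<in> cliffs upper m n s"
    then obtain B where Bs: "periodic_cliff m upper B F" "has_height upper B (real n)" "has_horizontal_displacement F s"
      unfolding cliffs_def by blast
    then have "zigzag B" by (simp add: periodic_cliff_def cliff_def)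
    then obtain p q r where pqr: "B = zigzag_from (ipnt p q r)" unfolding zigzag_def lattice_points_eq by blast
    have "cliff upper B F" using Bs(1) by (simp add: periodic_cliff_def)
    then interpret cliff_frame P p q r "p + q - 2 * r" B F
      using pqr by unfold_locales simp_all
    have r: "r = - int n" using Bs(2) r_nonpos unfolding has_height_iff[OF pqr] by simp
    then have h: "height_function n (p + q - 2 * r) height" using height_function_height by simp
    then have j: "p + q - 2 * r = ?j" using Bs(3) displacement_iff[OF h j_nonneg] faces_eq by simp
    have "height (a + int m) (b - int m) = height a b" for a b
      using Bs(1) unfolding periodic_cliff_iff[OF pqr] by (intro height_periodic) simp
    then have "height \<in> heights m n s" using h j by (simp add: heights_def)
    then show "\<exists>g\<in>heights m n s. F = faces_of ?j g" using faces_eq j by auto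
  next
    fix g assume gm: "g \<in> heights m n s"
    let ?B = "zigzag_from (ipnt 0 (int s) (- int n))"
    interpret graph_frame P n s ?j g ?B by (rule graph[OF gm])
    have "translate (int m) (faces_of ?j g) = faces_of ?j g"
      using gm by (intro translate_faces_of) (simp add: heights_def)
    then have "periodic_cliff m upper ?B (faces_of ?j g)"
      unfolding periodic_cliff_iff[OF refl] using cliff_faces_of by simp
    moreover have "has_height upper ?B (real n)" unfolding has_height_iff[OF refl] by simp
    moreover have "has_horizontal_displacement (faces_of ?j g) s"
      using displacement_iff[of n ?j g s] gm by (simp add: heights_def)
    ultimately show "\<exists>F\<in>cliffs upper m n s. F = faces_of ?j g" unfolding cliffs_def by blast
  next
    fix F g g' assume g: "g \<in> heights m n s" "g' \<in> heights m n s" and F: "F = faces_of ?j g" "F = faces_of ?j g'"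
    let ?B = "zigzag_from (ipnt 0 (int s) (- int n))"
    interpret G: graph_frame P n s ?j g ?B by (rule graph[OF g(1)])
    interpret G': graph_frame P n s ?j g' ?B by (rule graph[OF g(2)])
    interpret cliff_frame P 0 "int s" "- int n" ?j ?B F
      using G.cliff_faces_of F(1) by unfold_locales auto
    show "g = g'"
    proof (intro ext)
      fix a b
      show "g a b = g' a b"
      proof (cases "0 \<le> a + b \<and> a + b \<le> ?j + 1")
        case True
        then obtain v where "v \<in> S" "al v = of_int a" "be v = of_int b"
          using surj strip_int_iff by blast
        then obtain c where c: "ipnt (a + c) (b + c) c \<in> S" using surface_lattice_point by blast
        show ?thesis
          using G.ipnt_mem_surface_graph[of "a + c" "b + c" c] G'.ipnt_mem_surface_graph[of "a + c" "b + c" c] c F by simp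
      next
        case False
        then show ?thesis
          using height_functionD(4,5)[OF G.g, of a b] height_functionD(4,5)[OF G'.g, of a b] by force
      qed
    qed
  qed simp
qed

end

theorem theorem4p1:
  fixes m n s :: nat and A :: "(real ^ 3) set"
  assumes "m \<ge> 1" and "zigzag A"
  shows "card (cliffs A m n s)
           = card (bounded_cylindric_partitions (rev [s..<s + m]) (rev [0..<m]) m n)
       \<and> real (card (bounded_cylindric_partitions (rev [s..<s + m]) (rev [0..<m]) m n))
           = coeff (\<Prod>k = 1..n + s div 2.
               [:(2 + 2 * cos (2 * real k * pi / real (2 * n + s + 1))) ^ m, 1:]) (s div 2)"
proof -
  have part: "card (bounded_cylindric_partitions (rev [s..<s + m]) (rev [0..<m]) m n) = card (cyl_ideals m n s)"
    using assms(1) by (rule card_bounded_cylindric_partitions)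
  obtain P where P: "P \<in> lattice_points" "A = zigzag_from P"
    using assms(2) unfolding zigzag_def by blast
  interpret lattice_frame P by unfold_locales (rule P(1))
  have "card (cliffs A m n s) = card (cyl_ideals m n s)"
    unfolding P(2) card_cliffs by (rule card_heights)
  moreover have "real (card (cyl_ideals m n s)) = coeff (\<Prod>k = 1..n + s div 2.
      [:(2 + 2 * cos (2 * real k * pi / real (2 * n + s + 1))) ^ m, 1:]) (s div 2)"
  proof -
    \<comment> \<open>The number of even sites, which is the number of linear factors.\<close>
    have "(2 * n + s) div 2 = n + s div 2" by simp
    then show ?thesis
      using sum_card_closed_tuple_walks[where j = "2 * n + s" and m = m and n = n]
      unfolding card_cyl_ideals[OF assms(1)] card_closed_walks coeff_prod_linear by simp
  qed
  ultimately show ?thesis using part by simp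
qed

end
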